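(* Let $d\ge2$ and suppose that there exist $\beta_1,\beta_2,\alpha>0$ and $r\in(0,\infty)$ such that for all $t\ge 0$, $$\beta_1 e^{-\alpha t^r}\le \mathbb{P}(\tau_e>t)\le \beta_2 e^{-\alpha t^r}.$$ Let $x\in\mathbb{R}^d\setminus\{0\}$. (i) If $1<r<d$, then there exists $R>0$ such that for all $\xi>0$ there is $\varepsilon_0=\varepsilon_0(\xi)>0$ such that $$\mathbb{P}\big(\forall e\in E_R,\ \tau_e\le\varepsilon_0 n\ \big|\ \mathrm{T}(0,nx)\ge(\mu(x)+\xi)n\big)\to0\quad\text{as }n\to\infty.$$ (ii) If $r\ge d$, then for all $a>0$, $\xi>0$ and $\varepsilon_0>0$, $$\mathbb{P}\big(\forall e\in E_{n^a},\ \tau_e\le\varepsilon_0 n\ \big|\ \mathrm{T}(0,nx)\ge(\mu(x)+\xi)n\big)\to1\quad\text{as }n\to\infty.$$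
   Context: First-passage percolation on $\mathbb{Z}^d$. Let $E(\mathbb{Z}^d)$ be the set of undirected nearest-neighbor edges $\langle v,w\rangle=\{v,w\}$, $|v-w|_1=1$. To each edge $e\in E(\mathbb{Z}^d)$ is attached a non-negative random variable $\tau_e$; the family $(\tau_e)_{e\in E(\mathbb{Z}^d)}$ is independent and identically distributed. A path is a finite sequence of vertices whose successive elements are nearest neighbors; it is also viewed as its set of edges. The passage time of a path $\gamma$ is $\mathrm{T}(\gamma)=\sum_{e\in\gamma}\tau_e$. For $x\in\mathbb{R}^d$ let $\lfloor x\rfloor=(\lfloor x_1\rfloor,\dots,\lfloor x_d\rfloor)$. For $x,y\in\mathbb{R}^d$, the first passage time is $\mathrm{T}(x,y)=\inf_\gamma \mathrm{T}(\gamma)$, the infimum being over all finite paths from $\lfloor x\rfloor$ to $\lfloor y\rfloor$. When $\mathbb{E}\tau_e<\infty$, the time constant $\mu(x)\in[0,\infty)$ is the non-random limit $\mu(x)=\lim_{t\to\infty}t^{-1}\mathrm{T}(0,tx)=\lim_{t\to\infty}t^{-1}\mathbb{E}[\mathrm{T}(0,tx)]$ a.s. For real $M>0$, $D_M(0)=\{y\in\mathbb{Z}^d:|y|_\infty\le M\}$ and $E_M=\{\langle x,y\rangle: x,y\in D_M(0),\ |x-y|_1=1\}$. *)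

theory Defs
  imports "HOL-Probability.Probability"
begin

type_synonym 'd vertex = "int ^ 'd"
type_synonym 'd edge = "'d vertex set"

definition l1_norm :: "int ^ 'd::finite \<Rightarrow> int" where
  "l1_norm v = (\<Sum>i\<in>UNIV. \<bar>v $ i\<bar>)"

definition linf_norm :: "int ^ 'd::finite \<Rightarrow> int" where
  "linf_norm v = Max (range (\<lambda>i. \<bar>v $ i\<bar>))"

definition nearest_neighbors :: "'d::finite vertex \<Rightarrow> 'd vertex \<Rightarrow> bool" where
  "nearest_neighbors v w \<longleftrightarrow> l1_norm (v - w) = 1"

definition lattice_edges :: "'d::finite edge set" where
  "lattice_edges = {{v, w} | v w. nearest_neighbors v w}"

definition lattice_paths :: "'d::finite vertex \<Rightarrow> 'd vertex \<Rightarrow> 'd vertex list set" where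
  "lattice_paths v w =
     {\<gamma>. \<gamma> \<noteq> [] \<and> hd \<gamma> = v \<and> last \<gamma> = w \<and> successively nearest_neighbors \<gamma>}"

text \<open>A path is identified with its set of edges, so an edge that is traversed several times
  contributes only once to the passage time.\<close>

definition path_edges :: "'d::finite vertex list \<Rightarrow> 'd edge set" where
  "path_edges \<gamma> = {{\<gamma> ! i, \<gamma> ! Suc i} | i. Suc i < length \<gamma>}"

definition path_time :: "('d::finite edge \<Rightarrow> real) \<Rightarrow> 'd vertex list \<Rightarrow> real" where
  "path_time t \<gamma> = (\<Sum>e\<in>path_edges \<gamma>. t e)"

definition floor_vec :: "real ^ 'd::finite \<Rightarrow> 'd vertex" where
  "floor_vec x = (\<chi> i. \<lfloor>x $ i\<rfloor>)"

definition first_passage_time ::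
    "('d::finite edge \<Rightarrow> real) \<Rightarrow> real ^ 'd \<Rightarrow> real ^ 'd \<Rightarrow> real" where
  "first_passage_time t x y =
     (INF \<gamma>\<in>lattice_paths (floor_vec x) (floor_vec y). path_time t \<gamma>)"

text \<open>The time constant is the limit of the normalised expected passage times; for i.i.d.
  non-negative integrable edge weights this limit exists and coincides with the almost sure limit
  of the normalised passage times.\<close>

definition time_constant ::
    "'a measure \<Rightarrow> ('d::finite edge \<Rightarrow> 'a \<Rightarrow> real) \<Rightarrow> real ^ 'd \<Rightarrow> real" where
  "time_constant M \<tau> x =
     Lim at_top (\<lambda>s::real.
       (\<integral>\<omega>. first_passage_time (\<lambda>e. \<tau> e \<omega>) 0 (s *\<^sub>R x) \<partial>M) / s)"

definition lattice_box :: "real \<Rightarrow> 'd::finite vertex set" where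
  "lattice_box m = {y. real_of_int (linf_norm y) \<le> m}"

definition box_edges :: "real \<Rightarrow> 'd::finite edge set" where
  "box_edges m = {{v, w} | v w. v \<in> lattice_box m \<and> w \<in> lattice_box m \<and> nearest_neighbors v w}"

end

(* Let c(s) denote the least energy, i.e. the minimum of sum f(e)^r, of a configuration f on a large
   box for which the distance from the centre to the exterior is s; it equals s^r c(1).

   Cheap traps. For r >= d one has c(1) -> 0 as the box grows, by the choice f = 1/(k H) on edges
   joining the spheres of radius k-1 and k, with H a harmonic number. So a trap around the origin
   shows that P(T >= (mu+xi)n) decays slower than exp(-eta n^r) for every eta > 0, whereas a single
   weight above eps n costs exp(-alpha eps^r n^r); this gives (ii).

   The case 1 < r < d. Two traps of depth (xi/2+q)n, one at each endpoint, cost 2 c((1/2+q) xi), and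
   by a second moment argument the rest of space contributes a factor bounded below. If the weights
   near the origin are at most eps n, then, up to events of much smaller probability, the entire
   excess sits at the endpoint nx and costs nearly c(xi), which is larger because 2 (1/2)^r < 1.

   What must be shown for the latter is that outside traps the passage time is at most (mu+delta)n up
   to probability exp(-B delta^r n^r), with B as large as desired. Send a unit flow from each
   endpoint that is uniform on the simplices {y in N^d : |y|_1 = k} (Polya's urn), up to k = eps n, and
   join the two simplices by parallel translates of a chain of blocks. The passage time is at most
   the average of the weights under the flow, whose Laplace transform is controlled by
   sum over k of k^(-(d-1)/(r-1)) < infinity, plus the average over about n^(d-1) chains of length n,
   for which a Chernoff bound gives exp(-c n^d). *)

theory Submission
  imports Defs "HOL-Real_Asymp.Real_Asymp"
begin

section \<open>Lattice geometry\<close>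

text \<open>The theorem asks for R before \<xi>, while the trap at the endpoint needs a box whose
  size K grows as \<epsilon> shrinks. The constants are therefore fixed in the order q, B, R and
  only then, for a given \<xi>, in the order \<epsilon>, J, K. This is not circular for two reasons.
  The capacity of a box is bounded uniformly in K, so B can be taken large in advance. The flow
  estimate is homogeneous in the excess, so the R that it yields for B serves every \<xi>. Both
  sides of the comparison refer to the same finite box: a near-minimiser of its energy gives the
  lower bound with two traps, and the infimum gives the upper bound with one. Capacities are never
  passed to a limit in K. The flow estimate cannot cover the levels below R, where single edges
  carry a large share of the flow. The weights there must be bounded by hand, and this is how the
  event on E_R enters: it supplies the bound at the origin, so that an excess can come only from the
  other endpoint.\<close>

lemma l1_norm_minus_commute: "l1_norm (v - w) = l1_norm (w - v)"
  unfolding l1_norm_def by (simp add: abs_minus_commute)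

lemma l1_norm_nonneg: "l1_norm v \<ge> 0"
  unfolding l1_norm_def by (simp add: sum_nonneg)

lemma l1_norm_triangle: "l1_norm (v + w) \<le> l1_norm v + l1_norm w"
  unfolding l1_norm_def by (simp add: sum.distrib[symmetric] sum_mono abs_triangle_ineq)

lemma l1_norm_0_iff: "l1_norm v = 0 \<longleftrightarrow> v = 0"
  unfolding l1_norm_def by (subst sum_nonneg_eq_0_iff) (auto simp: vec_eq_iff)

lemma nearest_neighbors_sym: "nearest_neighbors v w \<longleftrightarrow> nearest_neighbors w v"
  unfolding nearest_neighbors_def by (simp add: l1_norm_minus_commute)

lemma nearest_neighbors_add: "nearest_neighbors (a + v) (a + w) \<longleftrightarrow> nearest_neighbors v w"
  unfolding nearest_neighbors_def by simp

lemma l1_norm_axis: "l1_norm (axis i c) = \<bar>c\<bar>"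
proof -
  have "l1_norm (axis i c) = (\<Sum>j\<in>UNIV. if j = i then \<bar>c\<bar> else 0)"
    unfolding l1_norm_def by (intro sum.cong) (auto simp: axis_def)
  then show ?thesis by simp
qed

lemma nearest_neighbors_axis: "\<bar>c\<bar> = 1 \<Longrightarrow> nearest_neighbors v (v + axis i c)"
  unfolding nearest_neighbors_def
  by (subst l1_norm_minus_commute) (simp add: l1_norm_axis)

lemma linf_norm_ge: "\<bar>v $ i\<bar> \<le> linf_norm v"
  unfolding linf_norm_def by simp

lemma linf_norm_le_iff: "linf_norm v \<le> c \<longleftrightarrow> (\<forall>i. \<bar>v $ i\<bar> \<le> c)"
  unfolding linf_norm_def by (subst Max_le_iff) auto

lemma linf_norm_nonneg: "linf_norm v \<ge> 0"
  using linf_norm_ge[of v undefined] abs_ge_zero order_trans by blast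

lemma linf_norm_zero [simp]: "linf_norm (0 :: int ^ 'd::finite) = 0"
  using linf_norm_nonneg[of "0 :: int ^ 'd"] linf_norm_le_iff[of "0 :: int ^ 'd" 0] by auto

lemma linf_norm_minus: "linf_norm (- v) = linf_norm v"
  unfolding linf_norm_def by simp

lemma linf_norm_triangle: "linf_norm (v + w) \<le> linf_norm v + linf_norm w"
  unfolding linf_norm_le_iff
  by (auto intro!: order_trans[OF abs_triangle_ineq] add_mono linf_norm_ge)

lemma linf_le_l1_norm: "linf_norm v \<le> l1_norm v"
  unfolding linf_norm_le_iff l1_norm_def by (auto intro!: member_le_sum)

lemma linf_norm_neighbor:
  assumes "nearest_neighbors v w"
  shows "linf_norm w \<le> linf_norm v + 1"
proof -
  have "linf_norm (v + (w - v)) \<le> linf_norm v + linf_norm (w - v)"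
    by (rule linf_norm_triangle)
  also have "linf_norm (w - v) \<le> l1_norm (w - v)" by (rule linf_le_l1_norm)
  also have "\<dots> = 1" using assms nearest_neighbors_sym[of v w]
    by (simp add: nearest_neighbors_def)
  finally show ?thesis by simp
qed

lemma lattice_edgesI: "nearest_neighbors v w \<Longrightarrow> {v, w} \<in> lattice_edges"
  unfolding lattice_edges_def by blast

text \<open>Coordinates embed the box into a product of intervals, which yields finiteness here and
  a polynomial cardinality bound later.\<close>

lemma lattice_box_subset:
  "lattice_box m \<subseteq> (\<lambda>f. \<chi> i. f i) ` (PiE UNIV (\<lambda>_::'d::finite. {- \<lfloor>m\<rfloor> .. \<lfloor>m\<rfloor>}))"
proof
  fix v :: "'d vertex" assume "v \<in> lattice_box m"
  then have "\<bar>v $ i\<bar> \<le> \<lfloor>m\<rfloor>" for i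
    using linf_norm_ge[of v i] unfolding lattice_box_def
    by (auto simp: le_floor_iff intro: order_trans[rotated])
  then have "(\<lambda>i. v $ i) \<in> PiE UNIV (\<lambda>_::'d. {- \<lfloor>m\<rfloor> .. \<lfloor>m\<rfloor>})"
    by (auto simp: abs_le_iff) (metis minus_le_iff)
  then show "v \<in> (\<lambda>f. \<chi> i. f i) ` (PiE UNIV (\<lambda>_::'d. {- \<lfloor>m\<rfloor> .. \<lfloor>m\<rfloor>}))"
    by (intro image_eqI[of _ _ "\<lambda>i. v $ i"]) auto
qed

lemma finite_lattice_box: "finite (lattice_box m :: 'd::finite vertex set)"
  by (rule finite_subset[OF lattice_box_subset]) (intro finite_imageI finite_PiE, auto)

lemma box_edges_subset_Pow: "box_edges m \<subseteq> Pow (lattice_box m)"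
  unfolding box_edges_def by auto

lemma finite_box_edges: "finite (box_edges m)"
  using box_edges_subset_Pow finite_lattice_box by (metis finite_Pow_iff finite_subset)

lemma box_edges_lattice: "box_edges m \<subseteq> lattice_edges"
  unfolding box_edges_def lattice_edges_def by auto

lemma box_edges_mono: "m \<le> m' \<Longrightarrow> box_edges m \<subseteq> box_edges m'"
  unfolding box_edges_def lattice_box_def by fastforce

section \<open>Paths and passage times between vertices\<close>

lemma path_edges_single [simp]: "path_edges [v] = {}"
  unfolding path_edges_def by auto

lemma path_edges_Cons2: "path_edges (v # w # \<gamma>) = insert {v, w} (path_edges (w # \<gamma>))"
proof -
  have "path_edges (v # w # \<gamma>) =
      (\<lambda>i. {(v # w # \<gamma>) ! i, (v # w # \<gamma>) ! Suc i}) ` {i. Suc i < length (v # w # \<gamma>)}"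
    unfolding path_edges_def by auto
  also have "{i. Suc i < length (v # w # \<gamma>)} = insert 0 (Suc ` {i. Suc i < length (w # \<gamma>)})"
    by (auto simp: image_iff less_Suc_eq_0_disj)
  also have "(\<lambda>i. {(v # w # \<gamma>) ! i, (v # w # \<gamma>) ! Suc i}) ` \<dots> = insert {v, w} (path_edges (w # \<gamma>))"
    unfolding path_edges_def by (auto simp: image_image)
  finally show ?thesis .
qed

lemma path_edges_Cons: "path_edges (v # \<gamma>) = (if \<gamma> = [] then {} else insert {v, hd \<gamma>} (path_edges \<gamma>))"
  by (cases \<gamma>) (auto simp: path_edges_Cons2)

lemma finite_path_edges: "finite (path_edges \<gamma>)"
proof -
  have "path_edges \<gamma> = (\<lambda>i. {\<gamma> ! i, \<gamma> ! Suc i}) ` {i. Suc i < length \<gamma>}"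
    unfolding path_edges_def by auto
  moreover have "finite {i. Suc i < length \<gamma>}"
    by (rule finite_subset[of _ "{..<length \<gamma>}"]) auto
  ultimately show ?thesis by simp
qed

lemma card_path_edges: "card (path_edges \<gamma>) \<le> length \<gamma> - 1"
proof -
  have "path_edges \<gamma> = (\<lambda>i. {\<gamma> ! i, \<gamma> ! Suc i}) ` {..<length \<gamma> - 1}"
    unfolding path_edges_def by auto
  then show ?thesis
    using card_image_le[of "{..<length \<gamma> - 1}" "\<lambda>i. {\<gamma> ! i, \<gamma> ! Suc i}"] by simp
qed

lemma path_edges_append:
  "\<gamma> \<noteq> [] \<Longrightarrow> \<delta> \<noteq> [] \<Longrightarrow>
    path_edges (\<gamma> @ \<delta>) = path_edges \<gamma> \<union> insert {last \<gamma>, hd \<delta>} (path_edges \<delta>)"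
  by (induction \<gamma>) (auto simp: path_edges_Cons)

lemma path_edges_rev: "path_edges (rev \<gamma>) = path_edges \<gamma>"
proof (induction \<gamma>)
  case (Cons v \<gamma>)
  show ?case
  proof (cases "\<gamma> = []")
    case False
    then have "path_edges (rev (v # \<gamma>)) = path_edges (rev \<gamma>) \<union> {{last (rev \<gamma>), v}}"
      by (simp add: path_edges_append)
    then show ?thesis using Cons False by (simp add: path_edges_Cons last_rev insert_commute)
  qed simp
qed simp

lemma path_edges_map: "path_edges (map f \<gamma>) = (`) f ` path_edges \<gamma>"
proof (induction \<gamma>)
  case (Cons v \<gamma>)
  then show ?case by (simp add: path_edges_Cons hd_map)
qed (simp add: path_edges_def)

lemma path_edges_in_lattice: "successively nearest_neighbors \<gamma> \<Longrightarrow> path_edges \<gamma> \<subseteq> lattice_edges"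
  unfolding path_edges_def using successively_nth[of nearest_neighbors \<gamma>]
  by (auto intro!: lattice_edgesI)

lemma lattice_paths_edges: "\<gamma> \<in> lattice_paths v w \<Longrightarrow> path_edges \<gamma> \<subseteq> lattice_edges"
  unfolding lattice_paths_def using path_edges_in_lattice by auto

lemma lattice_paths_Cons:
  "nearest_neighbors v u \<Longrightarrow> \<gamma> \<in> lattice_paths u w \<Longrightarrow> v # \<gamma> \<in> lattice_paths v w"
  unfolding lattice_paths_def by (auto simp: successively_Cons)

lemma lattice_paths_append:
  assumes "\<gamma> \<in> lattice_paths v u" "\<delta> \<in> lattice_paths u w"
  shows "\<gamma> @ tl \<delta> \<in> lattice_paths v w" "path_edges (\<gamma> @ tl \<delta>) = path_edges \<gamma> \<union> path_edges \<delta>"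
proof -
  obtain \<delta>' where \<delta>: "\<delta> = u # \<delta>'"
    using assms(2) unfolding lattice_paths_def by (cases \<delta>) auto
  show "\<gamma> @ tl \<delta> \<in> lattice_paths v w"
    using assms \<delta> unfolding lattice_paths_def
    by (auto simp: successively_append_iff successively_Cons)
  show "path_edges (\<gamma> @ tl \<delta>) = path_edges \<gamma> \<union> path_edges \<delta>"
  proof (cases "\<delta>' = []")
    case False
    then show ?thesis
      using assms \<delta> path_edges_append[of \<gamma> \<delta>'] unfolding lattice_paths_def
      by (auto simp: path_edges_Cons)
  qed (simp add: \<delta>)
qed

lemma lattice_paths_rev: "\<gamma> \<in> lattice_paths v w \<Longrightarrow> rev \<gamma> \<in> lattice_paths w v"
  unfolding lattice_paths_def
  by (auto simp: hd_rev last_rev nearest_neighbors_sym cong: successively_cong)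

lemma lattice_paths_shift:
  "\<gamma> \<in> lattice_paths v w \<Longrightarrow> map ((+) a) \<gamma> \<in> lattice_paths (a + v) (a + w)"
  unfolding lattice_paths_def
  by (auto simp: hd_map last_map successively_map nearest_neighbors_add cong: successively_cong)

text \<open>Moving one wrong coordinate towards its target lowers the l1 distance by one. The exact
  length is what makes the moments of passage times grow linearly with the distance.\<close>

lemma short_lattice_path:
  fixes v w :: "'d::finite vertex"
  shows "\<exists>\<gamma>\<in>lattice_paths v w. length \<gamma> = Suc (nat (l1_norm (w - v)))"
proof (induction "nat (l1_norm (w - v))" arbitrary: v)
  case 0
  then have "w - v = 0" using l1_norm_nonneg[of "w - v"] l1_norm_0_iff[of "w - v"] by simp
  then have "[v] \<in> lattice_paths v w" "l1_norm (w - v) = 0"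
    by (auto simp: lattice_paths_def l1_norm_0_iff)
  then show ?case by force
next
  case (Suc n)
  then have "w - v \<noteq> 0" using l1_norm_0_iff[of "w - v"] by auto
  then obtain i where i: "(w - v) $ i \<noteq> 0" by (auto simp: vec_eq_iff)
  define c where "c = sgn ((w - v) $ i)"
  have c: "\<bar>c\<bar> = 1" using i by (auto simp: c_def sgn_if)
  define u where "u = v + axis i c"
  have "l1_norm (w - u) = (\<Sum>j\<in>UNIV. \<bar>(w - v) $ j\<bar> - (if j = i then 1 else 0))"
    unfolding l1_norm_def u_def using i
    by (intro sum.cong) (auto simp: axis_def c_def sgn_if)
  also have "\<dots> = l1_norm (w - v) - 1"
    by (simp add: sum_subtractf l1_norm_def)
  finally have u: "l1_norm (w - u) = l1_norm (w - v) - 1" .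
  then have "n = nat (l1_norm (w - u))" using Suc(2) by simp
  from Suc(1)[OF this] obtain \<gamma> where \<gamma>: "\<gamma> \<in> lattice_paths u w"
    "length \<gamma> = Suc (nat (l1_norm (w - u)))" by auto
  have "v # \<gamma> \<in> lattice_paths v w"
    using lattice_paths_Cons[OF _ \<gamma>(1)] nearest_neighbors_axis[OF c] unfolding u_def by auto
  moreover have "length (v # \<gamma>) = Suc (nat (l1_norm (w - v)))"
    using \<gamma>(2) u Suc(2) by simp
  ultimately show ?case by blast
qed

lemma lattice_paths_nonempty: "lattice_paths v w \<noteq> {}"
  using short_lattice_path by blast

text \<open>The sup norm changes by at most one per step, so a path cannot jump over a sphere. The
  prefix ends at the first visit and thus stays in the ball; this confinement lets
  \<open>trapped_energy\<close> compare weights inside a box only.\<close>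

lemma path_prefix_to_sphere:
  assumes "\<gamma> \<in> lattice_paths v w" "linf_norm (v - z) \<le> k" "k \<le> linf_norm (w - z)"
  shows "\<exists>u \<delta>. \<delta> \<in> lattice_paths v u \<and> linf_norm (u - z) = k \<and> path_edges \<delta> \<subseteq> path_edges \<gamma>
     \<and> (\<forall>y\<in>set \<delta>. linf_norm (y - z) \<le> k)"
  using assms
proof (induction \<gamma> arbitrary: v)
  case Nil
  then show ?case by (auto simp: lattice_paths_def)
next
  case (Cons a \<gamma>)
  have a: "a = v" using Cons.prems by (auto simp: lattice_paths_def)
  show ?case
  proof (cases "linf_norm (v - z) = k")
    case True
    then show ?thesis by (intro exI[of _ v] exI[of _ "[v]"]) (auto simp: lattice_paths_def)
  next
    case False
    then have ne: "\<gamma> \<noteq> []" using Cons.prems by (auto simp: lattice_paths_def)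
    define u where "u = hd \<gamma>"
    have nn: "nearest_neighbors v u" and \<gamma>: "\<gamma> \<in> lattice_paths u w"
      using Cons.prems ne a by (auto simp: lattice_paths_def successively_Cons u_def)
    have "nearest_neighbors (v - z) (u - z)" using nn by (simp add: nearest_neighbors_def)
    then have "linf_norm (u - z) \<le> k" using linf_norm_neighbor False Cons.prems(2) by fastforce
    from Cons.IH[OF \<gamma> this Cons.prems(3)] obtain y \<delta> where y: "\<delta> \<in> lattice_paths u y"
      "linf_norm (y - z) = k" "path_edges \<delta> \<subseteq> path_edges \<gamma>" "\<forall>y\<in>set \<delta>. linf_norm (y - z) \<le> k" by blast
    have "hd \<delta> = u" "\<delta> \<noteq> []" using y(1) by (auto simp: lattice_paths_def)
    then have "path_edges (v # \<delta>) \<subseteq> path_edges (a # \<gamma>)"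
      using y(3) ne a by (auto simp: path_edges_Cons u_def)
    then show ?thesis using y lattice_paths_Cons[OF nn y(1)] Cons.prems(2)
      by (intro exI[of _ y] exI[of _ "v # \<delta>"]) auto
  qed
qed

text \<open>Lattice endpoints make translation exact, which the floors in
  \<open>first_passage_time\<close> would spoil.\<close>

definition passage :: "('d::finite edge \<Rightarrow> real) \<Rightarrow> 'd vertex \<Rightarrow> 'd vertex \<Rightarrow> real" where
  "passage t v w = (INF \<gamma>\<in>lattice_paths v w. path_time t \<gamma>)"

lemma first_passage_time_passage:
  "first_passage_time t x y = passage t (floor_vec x) (floor_vec y)"
  unfolding first_passage_time_def passage_def ..

text \<open>Nonnegativity is asked on lattice edges only, matching the hypothesis on \<tau>; other
  sets of vertices may carry any value.\<close>

definition weights :: "('d::finite edge \<Rightarrow> real) \<Rightarrow> bool" where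
  "weights t \<longleftrightarrow> (\<forall>e\<in>lattice_edges. 0 \<le> t e)"

lemma path_time_nonneg: "weights t \<Longrightarrow> \<gamma> \<in> lattice_paths v w \<Longrightarrow> 0 \<le> path_time t \<gamma>"
  unfolding path_time_def weights_def using lattice_paths_edges by (fastforce intro: sum_nonneg)

lemma passage_le: "weights t \<Longrightarrow> \<gamma> \<in> lattice_paths v w \<Longrightarrow> passage t v w \<le> path_time t \<gamma>"
  unfolding passage_def by (rule cINF_lower) (auto intro!: bdd_belowI[of _ 0] path_time_nonneg)

lemma passage_ge: "(\<And>\<gamma>. \<gamma> \<in> lattice_paths v w \<Longrightarrow> c \<le> path_time t \<gamma>) \<Longrightarrow> c \<le> passage t v w"
  unfolding passage_def by (rule cINF_greatest) (auto simp: lattice_paths_nonempty)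

lemma passage_nonneg: "weights t \<Longrightarrow> 0 \<le> passage t v w"
  by (intro passage_ge path_time_nonneg)

lemma passage_near:
  assumes "weights t" "\<epsilon> > 0"
  shows "\<exists>\<gamma>\<in>lattice_paths v w. path_time t \<gamma> < passage t v w + \<epsilon>"
proof (rule ccontr)
  assume "\<not> ?thesis"
  then have "passage t v w + \<epsilon> \<le> passage t v w" by (intro passage_ge) auto
  then show False using assms by simp
qed

lemma passage_triangle:
  assumes t: "weights t"
  shows "passage t v w \<le> passage t v u + passage t u w"
proof (rule field_le_epsilon)
  fix \<epsilon> :: real assume "\<epsilon> > 0"
  then have "\<epsilon> / 2 > 0" by simp
  from passage_near[OF t this] obtain \<gamma> where \<gamma>: "\<gamma> \<in> lattice_paths v u"
    "path_time t \<gamma> < passage t v u + \<epsilon> / 2" by blast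
  from passage_near[OF t \<open>\<epsilon> / 2 > 0\<close>] obtain \<delta> where \<delta>: "\<delta> \<in> lattice_paths u w"
    "path_time t \<delta> < passage t u w + \<epsilon> / 2" by blast
  have "passage t v w \<le> path_time t (\<gamma> @ tl \<delta>)"
    using lattice_paths_append[OF \<gamma>(1) \<delta>(1)] by (intro passage_le t) auto
  also have "\<dots> = sum t (path_edges \<gamma> \<union> path_edges \<delta>)"
    unfolding path_time_def lattice_paths_append[OF \<gamma>(1) \<delta>(1)] ..
  \<comment> \<open>An edge shared by both paths counts once in the union, so what is dropped here
    is the nonnegative weight of the intersection.\<close>
  also have "\<dots> \<le> sum t (path_edges \<gamma>) + sum t (path_edges \<delta>)"
    unfolding sum_Un[OF finite_path_edges finite_path_edges]
    using lattice_paths_edges[OF \<gamma>(1)] t by (auto simp: weights_def intro!: sum_nonneg)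
  also have "\<dots> \<le> passage t v u + passage t u w + \<epsilon>"
    using \<gamma>(2) \<delta>(2) by (simp add: path_time_def)
  finally show "passage t v w \<le> passage t v u + passage t u w + \<epsilon>" .
qed

lemma passage_refl: "weights t \<Longrightarrow> passage t v v = 0"
  using passage_le[of t "[v]" v v] passage_nonneg[of t v v]
  by (auto simp: lattice_paths_def path_time_def)

lemma passage_edge: "weights t \<Longrightarrow> nearest_neighbors v w \<Longrightarrow> passage t v w \<le> t {v, w}"
  using passage_le[of t "[v, w]" v w] by (auto simp: lattice_paths_def path_time_def path_edges_Cons)

lemma passage_sym: "passage t v w = passage t w v"
proof -
  have "lattice_paths w v = rev ` lattice_paths v w"
    using lattice_paths_rev by (force intro: image_eqI[of _ _ "rev _"])
  then show ?thesis unfolding passage_def by (simp add: image_image path_time_def path_edges_rev)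
qed

lemma passage_shift: "passage t (a + v) (a + w) = passage (\<lambda>e. t ((+) a ` e)) v w"
proof -
  have "lattice_paths (a + v) (a + w) = map ((+) a) ` lattice_paths v w"
  proof safe
    fix \<gamma> assume "\<gamma> \<in> lattice_paths (a + v) (a + w)"
    from lattice_paths_shift[OF this, of "- a"]
    show "\<gamma> \<in> map ((+) a) ` lattice_paths v w"
      by (intro image_eqI[of _ _ "map ((+) (- a)) \<gamma>"]) (auto simp: o_def)
  qed (rule lattice_paths_shift)
  moreover have "inj ((`) ((+) a))" by (intro inj_onI) (simp add: inj_image_eq_iff)
  then have "path_time t (map ((+) a) \<gamma>) = path_time (\<lambda>e. t ((+) a ` e)) \<gamma>" for \<gamma>
    unfolding path_time_def path_edges_map
    by (subst sum.reindex) (auto intro: inj_on_subset simp: o_def)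
  ultimately show ?thesis unfolding passage_def by (simp only: image_image)
qed

text \<open>An infimum of sums is at least the sum of the infima. This adds up the contributions of
  the two traps and of the space between them.\<close>

lemma passage_superadd:
  assumes "weights s" "weights t" "\<And>e. e \<in> lattice_edges \<Longrightarrow> s e + t e \<le> u e"
  shows "passage s v w + passage t v w \<le> passage u v w"
proof (rule passage_ge)
  fix \<gamma> assume \<gamma>: "\<gamma> \<in> lattice_paths v w"
  have "passage s v w + passage t v w \<le> path_time s \<gamma> + path_time t \<gamma>"
    by (intro add_mono passage_le assms \<gamma>)
  also have "\<dots> = (\<Sum>e\<in>path_edges \<gamma>. s e + t e)" by (simp add: path_time_def sum.distrib)
  also have "\<dots> \<le> path_time u \<gamma>"
    unfolding path_time_def using assms(3) lattice_paths_edges[OF \<gamma>] by (intro sum_mono) auto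
  finally show "passage s v w + passage t v w \<le> path_time u \<gamma>" .
qed

lemma passage_mono:
  assumes "weights s" "\<And>e. e \<in> lattice_edges \<Longrightarrow> s e \<le> t e"
  shows "passage s v w \<le> passage t v w"
proof (rule passage_ge)
  fix \<gamma> assume \<gamma>: "\<gamma> \<in> lattice_paths v w"
  have "passage s v w \<le> path_time s \<gamma>" by (intro passage_le assms \<gamma>)
  also have "\<dots> \<le> path_time t \<gamma>"
    unfolding path_time_def using assms(2) lattice_paths_edges[OF \<gamma>] by (intro sum_mono) auto
  finally show "passage s v w \<le> path_time t \<gamma>" .
qed

lemma passage_scale_ge:
  assumes "weights f" "c \<ge> 0"
  shows "c * passage f v w \<le> passage (\<lambda>e. c * f e) v w"
proof (rule passage_ge)
  fix \<gamma> assume \<gamma>: "\<gamma> \<in> lattice_paths v w"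
  show "c * passage f v w \<le> path_time (\<lambda>e. c * f e) \<gamma>"
    using mult_left_mono[OF passage_le[OF assms(1) \<gamma>] assms(2)]
    by (simp add: path_time_def sum_distrib_left)
qed

lemma passage_cong:
  assumes "\<And>e. e \<in> lattice_edges \<Longrightarrow> s e = t e"
  shows "passage s v w = passage t v w"
proof -
  have "path_time s \<gamma> = path_time t \<gamma>" if "\<gamma> \<in> lattice_paths v w" for \<gamma>
    unfolding path_time_def using lattice_paths_edges[OF that] assms by (intro sum.cong) auto
  then have "path_time s ` lattice_paths v w = path_time t ` lattice_paths v w"
    by (intro image_cong refl)
  then show ?thesis unfolding passage_def by simp
qed

section \<open>The uniform flow on simplices\<close>

definition nat_simplex :: "nat \<Rightarrow> ('d::finite \<Rightarrow> nat) set" where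
  "nat_simplex k = {y. sum y UNIV = k}"

lemma finite_simplex: "finite (nat_simplex k :: ('d::finite \<Rightarrow> nat) set)"
proof (rule finite_subset)
  show "nat_simplex k \<subseteq> PiE UNIV (\<lambda>_::'d. {..k})"
    unfolding nat_simplex_def by (auto intro: member_le_sum)
  show "finite (PiE UNIV (\<lambda>_::'d. {..k}))" by (intro finite_PiE) auto
qed

lemma simplex_update:
  "sum (y(i := Suc (y i))) (UNIV :: 'd::finite set) = Suc (sum y UNIV)"
  by (subst (1 2) sum.remove[of _ i]) auto

text \<open>A configuration z of the upper simplex is reached from z minus one ball of colour i with
  weight z i, and these weights add up to Suc k. Probabilistically, this says that the urn maps the
  uniform law on one simplex to the uniform law on the next.\<close>

lemma simplex_double_count:
  fixes h :: "('d::finite \<Rightarrow> nat) \<Rightarrow> real"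
  shows "(\<Sum>y\<in>nat_simplex k. \<Sum>i\<in>UNIV. real (Suc (y i)) * h (y(i := Suc (y i))))
       = real (Suc k) * (\<Sum>z\<in>nat_simplex (Suc k). h z)"
proof -
  let ?S = "{(z, i). z \<in> nat_simplex (Suc k) \<and> z i > 0} :: (('d \<Rightarrow> nat) \<times> 'd) set"
  have "(\<Sum>y\<in>nat_simplex k. \<Sum>i\<in>UNIV. real (Suc (y i)) * h (y(i := Suc (y i))))
      = (\<Sum>(y, i)\<in>nat_simplex k \<times> UNIV. real (Suc (y i)) * h (y(i := Suc (y i))))"
    by (simp add: sum.cartesian_product)
  also have "\<dots> = (\<Sum>(z, i)\<in>?S. real (z i) * h z)"
  proof (rule sum.reindex_bij_witness[where
        i = "\<lambda>(z, i). (z(i := z i - 1), i)" and j = "\<lambda>(y, i). (y(i := Suc (y i)), i)"])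
    fix a assume a: "a \<in> ?S"
    obtain z i where zi: "a = (z, i)" by (cases a)
    have eq: "(z(i := z i - 1))(i := Suc ((z(i := z i - 1)) i)) = z" using a zi by auto
    have "Suc (sum (z(i := z i - 1)) UNIV) = sum z UNIV"
      using simplex_update[of "z(i := z i - 1)" i, unfolded eq] by (rule sym)
    then show "(case a of (z, i) \<Rightarrow> (z(i := z i - 1), i)) \<in> nat_simplex k \<times> UNIV"
      using a zi by (simp add: nat_simplex_def del: fun_upd_apply)
  qed (auto simp: nat_simplex_def simplex_update[unfolded fun_upd_def])
  also have "\<dots> = (\<Sum>(z, i)\<in>nat_simplex (Suc k) \<times> UNIV. real (z i) * h z)"
    by (rule sum.mono_neutral_left) (auto simp: finite_simplex)
  also have "\<dots> = (\<Sum>z\<in>nat_simplex (Suc k). \<Sum>i\<in>UNIV. real (z i) * h z)"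
    by (simp add: sum.cartesian_product)
  also have "\<dots> = (\<Sum>z\<in>nat_simplex (Suc k). real (Suc k) * h z)"
    by (intro sum.cong refl)
      (simp add: sum_distrib_right[symmetric] of_nat_sum[symmetric] nat_simplex_def del: of_nat_sum)
  finally show ?thesis by (simp add: sum_distrib_left)
qed

definition simplex_card :: "'d::finite itself \<Rightarrow> nat \<Rightarrow> real" where
  "simplex_card _ k = real (card (nat_simplex k :: ('d \<Rightarrow> nat) set))"

lemma sum_simplex_Suc:
  "y \<in> nat_simplex k \<Longrightarrow> (\<Sum>i\<in>(UNIV::'d::finite set). real (Suc (y i))) = real (k + CARD('d))"
  unfolding nat_simplex_def by (simp add: sum.distrib of_nat_sum[symmetric] del: of_nat_sum)

lemma simplex_card_Suc:
  "simplex_card TYPE('d::finite) k * real (k + CARD('d)) = real (Suc k) * simplex_card TYPE('d) (Suc k)"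
proof -
  have "(\<Sum>y\<in>(nat_simplex k :: ('d \<Rightarrow> nat) set). \<Sum>i\<in>UNIV. real (Suc (y i)))
      = simplex_card TYPE('d) k * real (k + CARD('d))"
    by (simp add: sum_simplex_Suc simplex_card_def del: of_nat_Suc)
  with simplex_double_count[of "\<lambda>_ :: 'd \<Rightarrow> nat. 1" k] show ?thesis
    by (simp add: simplex_card_def)
qed

lemma simplex_card_0: "simplex_card TYPE('d::finite) 0 = 1"
proof -
  have "nat_simplex 0 = {\<lambda>_::'d. 0}" unfolding nat_simplex_def by (auto simp: fun_eq_iff)
  then show ?thesis by (simp add: simplex_card_def)
qed

lemma simplex_card_binomial:
  "simplex_card TYPE('d::finite) k = real ((k + CARD('d) - 1) choose (CARD('d) - 1))"
proof (induction k)
  case (Suc k)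
  have d: "k + CARD('d) - (CARD('d) - 1) = Suc k"
    using zero_less_card_finite[where 'a = 'd] by linarith
  have "real (Suc k) * simplex_card TYPE('d) (Suc k)
      = real ((k + CARD('d)) * ((k + CARD('d) - 1) choose (CARD('d) - 1)))"
    using simplex_card_Suc[where 'd = 'd, of k] Suc by (simp add: mult_ac)
  also have "\<dots> = real (Suc k) * real ((k + CARD('d)) choose (CARD('d) - 1))"
    using binomial_absorb_comp[of "k + CARD('d)" "CARD('d) - 1"]
    unfolding d of_nat_mult[symmetric] by simp
  finally show ?case by simp
qed (simp add: simplex_card_0)

text \<open>Only the order k^(d-1) matters. It dilutes the flow at level k, and it counts the
  parallel chains available to the bulk estimate.\<close>

lemma simplex_card_ge:
  "simplex_card TYPE('d::finite) k \<ge> (real (Suc k) / real CARD('d)) ^ (CARD('d) - 1)"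
proof (cases "CARD('d) = 1")
  case False
  have "CARD('d) > 0" by simp
  with False have d: "CARD('d) \<ge> 2" by linarith
  have "real (Suc k) / real CARD('d) \<le> real (k + CARD('d) - 1) / real (CARD('d) - 1)"
    using d by (intro frac_le) auto
  then have "(real (Suc k) / real CARD('d)) ^ (CARD('d) - 1)
      \<le> (real (k + CARD('d) - 1) / real (CARD('d) - 1)) ^ (CARD('d) - 1)"
    by (intro power_mono) auto
  also have "\<dots> \<le> simplex_card TYPE('d) k"
    unfolding simplex_card_binomial by (rule binomial_ge_n_over_k_pow_k) simp
  finally show ?thesis .
qed (simp add: simplex_card_binomial)

lemma simplex_card_pos: "simplex_card TYPE('d::finite) k > 0"
  by (rule less_le_trans[OF _ simplex_card_ge]) simp

text \<open>Polya's urn started from one ball of each colour adds a ball of colour \<open>i\<close> to the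
  configuration \<open>y\<close> with probability \<open>(y i + 1) / (k + d)\<close>, and is uniform on the simplex at
  every time \<open>k\<close>.\<close>

definition flow :: "('d::finite \<Rightarrow> nat) \<Rightarrow> 'd \<Rightarrow> real" where
  "flow y i = real (Suc (y i)) / (real (sum y UNIV + CARD('d)) * simplex_card TYPE('d) (sum y UNIV))"

lemma flow_pos: "flow y i > 0"
  unfolding flow_def
  by (intro divide_pos_pos mult_pos_pos simplex_card_pos) (simp_all del: of_nat_add of_nat_sum)

lemma flow_le:
  fixes y :: "'d::finite \<Rightarrow> nat"
  assumes "y \<in> nat_simplex k"
  shows "flow y i \<le> 1 / simplex_card TYPE('d) k"
proof -
  have "y i \<le> sum y UNIV" by (rule member_le_sum) auto
  then have "y i \<le> k" using assms by (simp add: nat_simplex_def)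
  then have "Suc (y i) \<le> k + CARD('d)" using zero_less_card_finite[where 'a = 'd] by linarith
  then have "real (Suc (y i)) \<le> real (k + CARD('d))" by (simp only: of_nat_le_iff)
  then have "real (Suc (y i)) / real (k + CARD('d)) \<le> 1" by (simp add: divide_le_eq_1)
  then have "real (Suc (y i)) / real (k + CARD('d)) / simplex_card TYPE('d) k \<le> 1 / simplex_card TYPE('d) k"
    using simplex_card_pos[where 'd = 'd, of k] by (intro divide_right_mono) auto
  then show ?thesis using assms by (simp add: flow_def nat_simplex_def)
qed

lemma flow_total:
  "(\<Sum>y\<in>(nat_simplex k :: ('d::finite \<Rightarrow> nat) set). \<Sum>i\<in>UNIV. flow y i) = 1"
proof -
  have "(\<Sum>y\<in>(nat_simplex k :: ('d \<Rightarrow> nat) set). \<Sum>i\<in>UNIV. flow y i)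
      = (\<Sum>y\<in>(nat_simplex k :: ('d \<Rightarrow> nat) set). 1 / simplex_card TYPE('d) k)"
  proof (intro sum.cong refl)
    fix y :: "'d \<Rightarrow> nat" assume y: "y \<in> nat_simplex k"
    have "(\<Sum>i\<in>UNIV. flow y i) = (\<Sum>i\<in>UNIV. real (Suc (y i))) / (real (k + CARD('d)) * simplex_card TYPE('d) k)"
      using y unfolding flow_def nat_simplex_def sum_divide_distrib by simp
    also have "\<dots> = 1 / simplex_card TYPE('d) k"
      unfolding sum_simplex_Suc[OF y] by (simp add: add_nonneg_eq_0_iff)
    finally show "(\<Sum>i\<in>UNIV. flow y i) = 1 / simplex_card TYPE('d) k" .
  qed
  then show ?thesis using simplex_card_pos[where 'd = 'd, of k]
    by (simp add: simplex_card_def)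
qed

text \<open>The signs select the closed orthant that contains the direction x, so that the simplices
  and the chains of blocks increase in the same linear functional \<open>level\<close>.\<close>

definition orthant :: "('d \<Rightarrow> int) \<Rightarrow> ('d::finite \<Rightarrow> nat) \<Rightarrow> 'd vertex" where
  "orthant \<sigma> y = (\<chi> i. \<sigma> i * int (y i))"

definition flow_edge :: "('d \<Rightarrow> int) \<Rightarrow> 'd vertex \<Rightarrow> ('d::finite \<Rightarrow> nat) \<Rightarrow> 'd \<Rightarrow> 'd edge" where
  "flow_edge \<sigma> v y i = {v + orthant \<sigma> y, v + orthant \<sigma> (y(i := Suc (y i)))}"

locale signs =
  fixes \<sigma> :: "'d::finite \<Rightarrow> int"
  assumes abs_sign: "\<And>i. \<bar>\<sigma> i\<bar> = 1"
begin

lemma sign_square: "\<sigma> i * \<sigma> i = 1"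
  using abs_sign[of i] by (simp add: abs_if split: if_splits)

text \<open>On the chosen orthant this linear functional is the l1 norm. Each simplex lies in one of
  its level sets, so translates of a simplex by vectors of different level are disjoint.\<close>

definition level :: "'d vertex \<Rightarrow> int" where
  "level v = (\<Sum>i\<in>UNIV. \<sigma> i * v $ i)"

lemma level_add: "level (v + w) = level v + level w"
  unfolding level_def by (simp add: algebra_simps sum.distrib)

lemma level_orthant: "level (orthant \<sigma> y) = int (sum y UNIV)"
  unfolding level_def orthant_def by (simp add: mult.assoc[symmetric] sign_square)

lemma inj_orthant: "inj (orthant \<sigma>)"
proof (rule injI)
  fix y z assume "orthant \<sigma> y = orthant \<sigma> z"
  then have "\<sigma> i * (\<sigma> i * int (y i)) = \<sigma> i * (\<sigma> i * int (z i))" for i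
    by (auto simp: orthant_def vec_eq_iff)
  then show "y = z" by (auto simp: mult.assoc[symmetric] sign_square)
qed

lemma orthant_update: "orthant \<sigma> (y(i := Suc (y i))) = orthant \<sigma> y + axis i (\<sigma> i)"
  unfolding orthant_def by (auto simp: vec_eq_iff axis_def algebra_simps)

lemma flow_edge_nn: "nearest_neighbors (v + orthant \<sigma> y) (v + orthant \<sigma> (y(i := Suc (y i))))"
  unfolding orthant_update add.assoc[symmetric] by (rule nearest_neighbors_axis[OF abs_sign])

lemma flow_edge_lattice: "flow_edge \<sigma> v y i \<in> lattice_edges"
  unfolding flow_edge_def by (intro lattice_edgesI flow_edge_nn)

text \<open>Distinct indices give distinct edges, hence independent weights in the Laplace transform
  of the flow. Equality with swapped endpoints is impossible, because the level would have to
  increase in both directions.\<close>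

lemma flow_edge_inj:
  assumes "flow_edge \<sigma> v y i = flow_edge \<sigma> v z j"
  shows "y = z \<and> i = j"
proof -
  let ?y = "y(i := Suc (y i))" and ?z = "z(j := Suc (z j))"
  have *: "{v + orthant \<sigma> y, v + orthant \<sigma> ?y} = {v + orthant \<sigma> z, v + orthant \<sigma> ?z}"
    using assms by (simp add: flow_edge_def)
  have "sum y UNIV = sum z UNIV \<and> orthant \<sigma> y = orthant \<sigma> z \<and> orthant \<sigma> ?y = orthant \<sigma> ?z"
  proof (cases "v + orthant \<sigma> y = v + orthant \<sigma> z")
    case True
    then have "v + orthant \<sigma> ?y = v + orthant \<sigma> ?z" using * by (auto simp: doubleton_eq_iff)
    then show ?thesis using True injD[OF inj_orthant] by auto
  next
    case False
    then have "orthant \<sigma> y = orthant \<sigma> ?z" "orthant \<sigma> ?y = orthant \<sigma> z"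
      using * by (auto simp: doubleton_eq_iff)
    then have "y = ?z" "?y = z" using injD[OF inj_orthant] by auto
    then have "sum y UNIV = Suc (sum z UNIV)" "sum z UNIV = Suc (sum y UNIV)"
      by (metis simplex_update)+
    then show ?thesis by simp
  qed
  then have yz: "y = z" "?y = ?z" using injD[OF inj_orthant] by auto
  have "i = j"
  proof (rule ccontr)
    assume "i \<noteq> j"
    then have "?z i = z i" "?y i = Suc (z i)" using yz(1) by simp_all
    then show False using yz(2) by simp
  qed
  with yz show ?thesis by simp
qed

lemma flow_edge_shift: "flow_edge \<sigma> v y i = (+) v ` flow_edge \<sigma> 0 y i"
  unfolding flow_edge_def by simp

text \<open>The inequality \<open>k < R\<close> is strict because an edge leaving level k ends at
  level k + 1.\<close>

lemma flow_edge_in_box: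
  assumes "y \<in> nat_simplex k" "k < R"
  shows "flow_edge \<sigma> 0 y i \<in> box_edges (real R)"
proof -
  have *: "linf_norm (orthant \<sigma> z) \<le> int R" if "sum z UNIV \<le> R" for z
  proof -
    have "\<bar>orthant \<sigma> z $ j\<bar> \<le> int R" for j
    proof -
      have "z j \<le> sum z UNIV" by (rule member_le_sum) auto
      then show ?thesis using that by (simp add: orthant_def abs_mult abs_sign)
    qed
    then show ?thesis by (simp add: linf_norm_le_iff)
  qed
  have "sum y UNIV \<le> R" "sum (y(i := Suc (y i))) UNIV \<le> R"
    using assms unfolding simplex_update by (auto simp: nat_simplex_def)
  from this[THEN *] have "orthant \<sigma> y \<in> lattice_box (real R)"
    "orthant \<sigma> (y(i := Suc (y i))) \<in> lattice_box (real R)"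
    unfolding lattice_box_def by (simp_all add: of_int_le_iff[symmetric] del: of_int_le_iff)
  then show ?thesis
    using flow_edge_nn[of 0 y i] unfolding flow_edge_def box_edges_def by force
qed

text \<open>The flow is conserved, so averaging a potential over consecutive simplices telescopes.\<close>

lemma simplex_average_le:
  fixes p :: "'d vertex \<Rightarrow> real"
  assumes p0: "p v \<le> 0" and p: "\<And>a b. nearest_neighbors a b \<Longrightarrow> p b \<le> p a + t {a, b}"
  shows "(\<Sum>y\<in>nat_simplex N. p (v + orthant \<sigma> y)) / simplex_card TYPE('d) N
    \<le> (\<Sum>k<N. \<Sum>y\<in>nat_simplex k. \<Sum>i\<in>UNIV. flow y i * t (flow_edge \<sigma> v y i))"
proof (induction N)
  case 0
  have "nat_simplex 0 = {\<lambda>_::'d. 0}" unfolding nat_simplex_def by (auto simp: fun_eq_iff)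
  moreover have "orthant \<sigma> (\<lambda>_. 0) = 0" by (simp add: orthant_def vec_eq_iff)
  ultimately show ?case using p0 by (simp add: simplex_card_0)
next
  case (Suc N)
  define D where "D = simplex_card TYPE('d)"
  define h where "h y = p (v + orthant \<sigma> y)" for y
  have D: "D k > 0" for k unfolding D_def by (rule simplex_card_pos)
  \<comment> \<open>The factor \<open>Suc N\<close> prepares the double counts of the numerator and
    of the denominator. Together they turn the average over level N + 1 into the flow average of the
    heads of the edges that leave level N.\<close>
  have "(\<Sum>z\<in>nat_simplex (Suc N). h z) / D (Suc N)
      = real (Suc N) * (\<Sum>z\<in>nat_simplex (Suc N). h z) / (real (Suc N) * D (Suc N))"
    by simp
  also have "\<dots> = (\<Sum>y\<in>nat_simplex N. \<Sum>i\<in>UNIV. real (Suc (y i)) * h (y(i := Suc (y i)))) / (D N * real (N + CARD('d)))"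
    unfolding simplex_double_count D_def simplex_card_Suc ..
  also have "\<dots> = (\<Sum>y\<in>nat_simplex N. \<Sum>i\<in>UNIV. flow y i * h (y(i := Suc (y i))))"
    unfolding sum_divide_distrib by (intro sum.cong refl) (simp add: flow_def nat_simplex_def D_def mult_ac)
  also have "\<dots> \<le> (\<Sum>y\<in>nat_simplex N. \<Sum>i\<in>UNIV. flow y i * (h y + t (flow_edge \<sigma> v y i)))"
    using p[OF flow_edge_nn]
    by (intro sum_mono mult_left_mono) (auto simp: h_def flow_edge_def intro: less_imp_le[OF flow_pos])
  also have "\<dots> = (\<Sum>y\<in>nat_simplex N. h y * (\<Sum>i\<in>UNIV. flow y i))
      + (\<Sum>y\<in>nat_simplex N. \<Sum>i\<in>UNIV. flow y i * t (flow_edge \<sigma> v y i))"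
    by (simp add: algebra_simps sum.distrib sum_distrib_left)
  also have "(\<Sum>y\<in>nat_simplex N. h y * (\<Sum>i\<in>UNIV. flow y i)) = (\<Sum>y\<in>nat_simplex N. h y) / D N"
    unfolding sum_divide_distrib
  proof (intro sum.cong refl)
    fix y :: "'d \<Rightarrow> nat" assume y: "y \<in> nat_simplex N"
    have "(\<Sum>i\<in>UNIV. flow y i) = (\<Sum>i\<in>UNIV. real (Suc (y i))) / (real (N + CARD('d)) * D N)"
      using y unfolding flow_def nat_simplex_def sum_divide_distrib D_def by simp
    also have "\<dots> = 1 / D N" unfolding sum_simplex_Suc[OF y] by (simp add: add_nonneg_eq_0_iff)
    finally show "h y * (\<Sum>i\<in>UNIV. flow y i) = h y / D N" by simp
  qed
  finally show ?case using Suc by (simp add: h_def D_def)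
qed

end

section \<open>A subadditive limit along the reals\<close>

text \<open>This is Fekete's argument for f + c, which is truly subadditive. The linear bound
  controls f on the remainder interval [0, s0), in place of any regularity of f.\<close>

lemma subadditive_limit_real:
  fixes f :: "real \<Rightarrow> real"
  assumes f0: "\<And>s. s \<ge> 0 \<Longrightarrow> f s \<ge> 0"
    and sub: "\<And>s t. s \<ge> 0 \<Longrightarrow> t \<ge> 0 \<Longrightarrow> f (s + t) \<le> f s + f t + c"
    and lin: "\<And>s. s \<ge> 0 \<Longrightarrow> f s \<le> c * (s + 1)"
  shows "\<exists>L. ((\<lambda>s. f s / s) \<longlongrightarrow> L) at_top"
proof -
  have c: "c \<ge> 0" using f0[of 0] lin[of 0] by simp
  define q where "q s = (f s + c) / s" for s
  define L where "L = (INF s\<in>{1..}. q s)"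
  have bdd: "bdd_below (q ` {1..})"
    by (intro bdd_belowI[of _ 0])
      (auto simp: q_def c intro!: divide_nonneg_nonneg add_nonneg_nonneg f0)
  \<comment> \<open>The slack \<open>c * 2\<close> serves the case k = 0, where only f 0 + c \<le> 2
    c is available.\<close>
  have mult: "f (real k * s) + c \<le> real k * (f s + c) + c * 2" if "s \<ge> 0" for k s
  proof (induction k)
    case 0 then show ?case using lin[of 0] by simp
  next
    case (Suc k)
    have "f (real (Suc k) * s) \<le> f (real k * s) + f s + c"
      using sub[of "real k * s" s] that by (simp add: algebra_simps)
    then show ?case using Suc by (simp add: algebra_simps)
  qed
  have "((\<lambda>s. f s / s) \<longlongrightarrow> L) at_top"
  proof (rule tendstoI)
    fix e :: real assume e: "e > 0"
    have "\<exists>s0\<in>{1..}. q s0 < L + e / 2"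
      using cINF_less_iff[OF _ bdd, of "L + e / 2"] e unfolding L_def by auto
    then obtain s0 where s0: "s0 \<ge> 1" "q s0 < L + e / 2" by auto
    \<comment> \<open>The first summand bounds f on the remainder after division by s0, the second
      is the slack of \<open>mult\<close>.\<close>
    define C where "C = c * (s0 + 1) + 2 * c"
    have C: "C \<ge> 0" using c s0 by (simp add: C_def)
    have up: "f s / s < L + e" if s: "s \<ge> 1" "s > 2 * (C + 1) / e" for s
    proof -
      define k where "k = nat \<lfloor>s / s0\<rfloor>"
      have k: "real k = of_int \<lfloor>s / s0\<rfloor>" using s s0 by (simp add: k_def)
      have k1: "real k * s0 \<le> s" using s0 unfolding k by (simp add: pos_le_divide_eq[symmetric])
      have "s / s0 < real k + 1" unfolding k by linarith
      then have k2: "s - real k * s0 < s0" using s0 by (simp add: field_simps)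
      have "f s \<le> f (real k * s0) + f (s - real k * s0) + c"
        using sub[of "real k * s0" "s - real k * s0"] k1 s0 by simp
      also have "f (s - real k * s0) \<le> c * (s - real k * s0 + 1)" using lin k1 by simp
      also have "\<dots> \<le> c * (s0 + 1)" using k2 c by (intro mult_left_mono) auto
      also have "f (real k * s0) + c * (s0 + 1) + c \<le> real k * (f s0 + c) + C"
        using mult[of s0 k] s0 by (simp add: C_def)
      also have "real k * (f s0 + c) = (real k * s0) * q s0" using s0 by (simp add: q_def)
      also have "\<dots> \<le> s * q s0"
        using k1 s0 f0[of s0] c by (intro mult_right_mono) (auto simp: q_def)
      also have "\<dots> \<le> s * (L + e / 2)" using s s0 by (intro mult_left_mono) auto
      finally have "f s \<le> s * (L + e / 2) + C" by simp
      also have "C < s * (e / 2)"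
        using s(2) e C by (simp add: field_simps)
      finally show ?thesis using s by (simp add: field_simps)
    qed
    have low: "f s / s > L - e" if s: "s \<ge> 1" "s > 2 * (C + 1) / e" for s
    proof -
      have "L \<le> q s" unfolding L_def using s by (intro cINF_lower bdd) auto
      also have "q s = f s / s + c / s" by (simp add: q_def add_divide_distrib)
      also have "c / s < e"
      proof -
        have "c \<le> C" using c s0 by (simp add: C_def algebra_simps)
        also have "C < s * e / 2" using s(2) e C by (simp add: field_simps)
        also have "\<dots> \<le> s * e" using s e by simp
        finally show ?thesis using s by (simp add: field_simps)
      qed
      finally show ?thesis by simp
    qed
    show "\<forall>\<^sub>F s in at_top. dist (f s / s) L < e"
      using eventually_gt_at_top[of "2 * (C + 1) / e"] eventually_ge_at_top[of 1]
    proof eventually_elim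
      case (elim s)
      with up[of s] low[of s] show ?case by (simp add: dist_real_def abs_less_iff)
    qed
  qed
  then show ?thesis ..
qed

section \<open>Energies of blocking configurations\<close>

text \<open>A trap of depth one around the origin; multiplication by s gives depth s. Vanishing
  outside the box ensures that \<open>energy\<close> accounts for the whole configuration.\<close>

definition blocking :: "nat \<Rightarrow> ('d::finite edge \<Rightarrow> real) \<Rightarrow> bool" where
  "blocking K f \<longleftrightarrow> (\<forall>e. 0 \<le> f e) \<and> (\<forall>e. e \<notin> box_edges (real K) \<longrightarrow> f e = 0)
     \<and> (\<forall>w. linf_norm w > int K \<longrightarrow> passage f 0 w \<ge> 1)"

definition energy :: "real \<Rightarrow> nat \<Rightarrow> ('d::finite edge \<Rightarrow> real) \<Rightarrow> real" where
  "energy r K f = (\<Sum>e\<in>box_edges (real K). f e powr r)"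

text \<open>The c(1) of the overview for one fixed box size, taken as an infimum so that no
  minimiser has to be constructed.\<close>

definition capacity :: "'d::finite itself \<Rightarrow> real \<Rightarrow> nat \<Rightarrow> real" where
  "capacity _ r K = (INF f\<in>{f :: 'd edge \<Rightarrow> real. blocking K f}. energy r K f)"

lemma blocking_weights: "blocking K f \<Longrightarrow> weights f"
  unfolding blocking_def weights_def by auto

lemma energy_nonneg: "energy r K f \<ge> 0"
  unfolding energy_def by (intro sum_nonneg) auto

lemma bdd_below_energy: "bdd_below (energy r K ` A)"
  by (intro bdd_belowI[of _ 0]) (auto simp: energy_nonneg)

lemma capacity_le: "blocking K (f :: 'd::finite edge \<Rightarrow> real) \<Longrightarrow> capacity TYPE('d) r K \<le> energy r K f"
  unfolding capacity_def by (intro cINF_lower bdd_below_energy) auto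

lemma path_first_edge:
  assumes "\<gamma> \<in> lattice_paths v w" "v \<noteq> w"
  shows "\<exists>u. nearest_neighbors v u \<and> {v, u} \<in> path_edges \<gamma>"
proof -
  obtain \<gamma>' where \<gamma>: "\<gamma> = v # \<gamma>'" using assms(1) by (cases \<gamma>) (auto simp: lattice_paths_def)
  with assms have "\<gamma>' \<noteq> []" by (auto simp: lattice_paths_def)
  with \<gamma> assms show ?thesis
    by (intro exI[of _ "hd \<gamma>'"]) (auto simp: lattice_paths_def path_edges_Cons successively_Cons)
qed

lemma unit_blocking:
  assumes "K \<ge> 1"
  shows "blocking K (\<lambda>e :: 'd::finite edge. if e \<in> box_edges 1 then 1 else 0)" (is "blocking K ?f")
  unfolding blocking_def
proof (intro conjI allI impI)
  fix e :: "'d edge" assume "e \<notin> box_edges (real K)"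
  then show "?f e = 0" using box_edges_mono[of 1 "real K"] assms by auto
next
  fix w :: "'d vertex" assume w: "int K < linf_norm w"
  show "1 \<le> passage ?f 0 w"
  proof (rule passage_ge)
    fix \<gamma> assume \<gamma>: "\<gamma> \<in> lattice_paths 0 w"
    have "w \<noteq> 0" using w by auto
    from path_first_edge[OF \<gamma>] this obtain u where u: "nearest_neighbors 0 u" "{0, u} \<in> path_edges \<gamma>"
      by auto
    have "linf_norm u \<le> 1" using linf_norm_neighbor[OF u(1)] by simp
    then have "{0, u} \<in> box_edges 1" using u unfolding box_edges_def lattice_box_def by force
    then have "1 = ?f {0, u}" by simp
    also have "\<dots> \<le> path_time ?f \<gamma>"
      unfolding path_time_def by (rule member_le_sum) (auto simp: u finite_path_edges)
    finally show "1 \<le> path_time ?f \<gamma>" .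
  qed
qed auto

text \<open>Unit weights on the edges around the origin already form a trap. The point is that the
  bound is the same for all K, since the exponent B of the typical estimate has to be chosen before
  the box size is known.\<close>

lemma capacity_le_unit:
  assumes "K \<ge> 1"
  shows "capacity TYPE('d::finite) r K \<le> real (card (box_edges 1 :: 'd edge set))"
proof -
  let ?f = "\<lambda>e :: 'd edge. if e \<in> box_edges 1 then 1 else 0 :: real"
  have "capacity TYPE('d) r K \<le> energy r K ?f"
    by (rule capacity_le[OF unit_blocking[OF assms]])
  also have "\<dots> = (\<Sum>e\<in>(box_edges (real K) :: 'd edge set). if e \<in> box_edges 1 then 1 else 0)"
    unfolding energy_def by (intro sum.cong) auto
  also have "\<dots> = (\<Sum>e\<in>(box_edges 1 :: 'd edge set). 1)"
    using box_edges_mono[of 1 "real K"] assms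
    by (intro sum.mono_neutral_cong_right finite_box_edges) auto
  finally show ?thesis by simp
qed

lemma capacity_near:
  assumes "K \<ge> 1" "\<eta> > 0"
  shows "\<exists>f :: 'd::finite edge \<Rightarrow> real. blocking K f \<and> energy r K f < capacity TYPE('d) r K + \<eta>"
proof -
  have "{f :: 'd edge \<Rightarrow> real. blocking K f} \<noteq> {}" using unit_blocking[OF assms(1)] by blast
  from cINF_less_iff[OF this bdd_below_energy, of r K "capacity TYPE('d) r K + \<eta>"] assms(2)
  show ?thesis unfolding capacity_def by auto
qed

lemma exists_linf_norm: "\<exists>w :: 'd::finite vertex. linf_norm w = int k"
proof
  show "linf_norm (\<chi> i::'d. int k) = int k"
    unfolding linf_norm_def by simp
qed

text \<open>Pigeonhole on one fixed path out of the box: whatever the trap, some edge of this path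
  carries at least the reciprocal of its number of edges.\<close>

lemma capacity_pos:
  assumes "K \<ge> 1" "r > 0"
  shows "capacity TYPE('d::finite) r K > 0"
proof -
  obtain w :: "'d vertex" where w: "linf_norm w = int (Suc K)" using exists_linf_norm by blast
  obtain \<gamma> where \<gamma>: "\<gamma> \<in> lattice_paths 0 w" using lattice_paths_nonempty by blast
  define l where "l = real (card (path_edges \<gamma>))"
  have "w \<noteq> 0" using w by auto
  with path_first_edge[OF \<gamma>] have "path_edges \<gamma> \<noteq> {}" by auto
  then have l: "l > 0" unfolding l_def by (simp add: card_gt_0_iff finite_path_edges)
  have "(1 / l) powr r \<le> energy r K f" if f: "blocking K f" for f :: "'d edge \<Rightarrow> real"
  proof -
    have "1 \<le> passage f 0 w" using f w unfolding blocking_def by auto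
    also have "\<dots> \<le> path_time f \<gamma>" by (rule passage_le[OF blocking_weights[OF f] \<gamma>])
    finally have *: "1 \<le> (\<Sum>e\<in>path_edges \<gamma>. f e)" unfolding path_time_def .
    have "\<exists>e\<in>path_edges \<gamma>. f e \<ge> 1 / l"
    proof (rule ccontr)
      assume "\<not> ?thesis"
      then have "(\<Sum>e\<in>path_edges \<gamma>. f e) < (\<Sum>e\<in>path_edges \<gamma>. 1 / l)"
        using \<open>path_edges \<gamma> \<noteq> {}\<close> by (intro sum_strict_mono finite_path_edges) auto
      also have "\<dots> = 1" using l by (simp add: l_def)
      finally show False using * by simp
    qed
    then obtain e where e: "f e \<ge> 1 / l" by blast
    then have "f e > 0" using l by (meson divide_pos_pos less_le_trans zero_less_one)
    then have "e \<in> box_edges (real K)" using f unfolding blocking_def by (metis less_irrefl)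
    then have "f e powr r \<le> energy r K f"
      unfolding energy_def by (intro member_le_sum) (auto simp: finite_box_edges)
    moreover have "(1 / l) powr r \<le> f e powr r" using e l assms by (intro powr_mono2) auto
    ultimately show ?thesis by simp
  qed
  then have "(1 / l) powr r \<le> capacity TYPE('d) r K"
    unfolding capacity_def using unit_blocking[OF assms(1)] by (intro cINF_greatest) blast+
  moreover have "(1 / l) powr r > 0" using l by simp
  ultimately show ?thesis by linarith
qed

lemma blocking_passage_ge:
  assumes f: "blocking K f" and t: "weights t" and s: "s \<ge> 0"
    and ge: "\<And>e. e \<in> box_edges (real K) \<Longrightarrow> t e \<ge> s * f e" and w: "linf_norm w > int K"
  shows "passage t 0 w \<ge> s"
proof -
  have "s * 1 \<le> s * passage f 0 w"
    using f w s unfolding blocking_def by (intro mult_left_mono) auto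
  also have "\<dots> \<le> passage (\<lambda>e. s * f e) 0 w"
    by (intro passage_scale_ge blocking_weights[OF f] s)
  also have "\<dots> \<le> passage t 0 w"
  proof (rule passage_mono)
    show "weights (\<lambda>e. s * f e)" using blocking_weights[OF f] s by (auto simp: weights_def)
    fix e assume "e \<in> (lattice_edges :: 'a edge set)"
    then show "s * f e \<le> t e"
      using ge t f by (cases "e \<in> box_edges (real K)") (auto simp: weights_def blocking_def)
  qed
  finally show ?thesis by simp
qed

lemma weights_shift: "weights t \<Longrightarrow> weights (\<lambda>e. t ((+) a ` e))"
proof -
  have "(+) a ` e \<in> lattice_edges" if "e \<in> lattice_edges" for e :: "'a edge"
    using that unfolding lattice_edges_def by (auto simp: nearest_neighbors_add) (metis nearest_neighbors_add)
  then show "weights t \<Longrightarrow> weights (\<lambda>e. t ((+) a ` e))" by (auto simp: weights_def)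
qed

text \<open>Reversing the paths and translating by -z turns a trap around the endpoint z into a trap
  around the origin for paths to -z.\<close>

lemma blocking_passage_ge':
  assumes f: "blocking K f" and t: "weights t" and s: "s \<ge> 0"
    and ge: "\<And>e. e \<in> box_edges (real K) \<Longrightarrow> t ((+) z ` e) \<ge> s * f e" and w: "linf_norm z > int K"
  shows "passage t 0 z \<ge> s"
proof -
  have "passage t 0 z = passage t (z + 0) (z + (- z))"
    by (simp add: passage_sym)
  also have "\<dots> = passage (\<lambda>e. t ((+) z ` e)) 0 (- z)" by (rule passage_shift)
  also have "\<dots> \<ge> s"
    using w by (intro blocking_passage_ge[OF f weights_shift[OF t] s ge]) (auto simp: linf_norm_minus)
  finally show ?thesis .
qed

text \<open>Division by s produces a competitor in the infimum that defines the capacity.\<close>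

lemma energy_ge_capacity:
  fixes t :: "'d::finite edge \<Rightarrow> real"
  assumes t: "\<And>e. t e \<ge> 0" and s: "s > 0"
    and ge: "\<And>w. linf_norm w > int K \<Longrightarrow>
        passage (\<lambda>e. if e \<in> box_edges (real K) then t e else 0) 0 w \<ge> s"
  shows "(\<Sum>e\<in>box_edges (real K). t e powr r) \<ge> capacity TYPE('d) r K * s powr r"
proof -
  let ?t = "\<lambda>e. if e \<in> box_edges (real K) then t e else 0"
  let ?f = "\<lambda>e. 1 / s * ?t e"
  have w: "weights ?t" using t by (auto simp: weights_def)
  have "blocking K ?f"
    unfolding blocking_def
  proof (intro conjI allI impI)
    fix w :: "'d vertex" assume "int K < linf_norm w"
    from ge[OF this] s have "1 \<le> 1 / s * passage ?t 0 w" by (simp add: field_simps)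
    also have "\<dots> \<le> passage ?f 0 w" using s by (intro passage_scale_ge w) auto
    finally show "1 \<le> passage ?f 0 w" .
  qed (use t s in auto)
  from capacity_le[OF this, of r] have "capacity TYPE('d) r K \<le> (\<Sum>e\<in>box_edges (real K). t e powr r / s powr r)"
    unfolding energy_def using t s by (simp add: powr_divide)
  also have "\<dots> = (\<Sum>e\<in>box_edges (real K). t e powr r) / s powr r" by (simp add: sum_divide_distrib)
  finally show ?thesis using s by (simp add: field_simps)
qed

section \<open>Cheap blocking configurations above the critical exponent\<close>

definition layer_edges :: "nat \<Rightarrow> 'd::finite edge set" where
  "layer_edges k = {{v, w} | v w. nearest_neighbors v w \<and> linf_norm v = int k \<and> linf_norm w = int (Suc k)}"

lemma layer_edges_disjoint: "e \<in> layer_edges k \<Longrightarrow> e \<in> layer_edges l \<Longrightarrow> k = l"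
  unfolding layer_edges_def by (auto simp: doubleton_eq_iff)

lemma layer_edges_in_box: "k < K \<Longrightarrow> layer_edges k \<subseteq> box_edges (real K)"
  unfolding layer_edges_def box_edges_def lattice_box_def by fastforce

lemma finite_layer_edges: "finite (layer_edges k)"
  using layer_edges_in_box[of k "Suc k"] finite_box_edges finite_subset by blast

lemma card_sphere_le:
  "card {w :: 'd::finite vertex. linf_norm w = int k} \<le> 2 * CARD('d) * (2 * k + 1) ^ (CARD('d) - 1)"
proof -
  \<comment> \<open>A face of the cube: coordinate i is frozen at c and the others range freely. The
    sphere is covered by the 2d faces with c = k or c = -k.\<close>
  define F where "F = (\<lambda>(i :: 'd, c). (\<lambda>f. \<chi> j. f j) ` (PiE UNIV (\<lambda>j. if j = i then {c} else {- int k..int k})))"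
  have card: "card (F (i, c)) \<le> (2 * k + 1) ^ (CARD('d) - 1)" for i c
  proof -
    have "card (F (i, c)) \<le> card (PiE UNIV (\<lambda>j. if j = i then {c} else {- int k..int k}))"
      unfolding F_def by (auto intro!: card_image_le finite_PiE)
    also have "\<dots> = (\<Prod>j\<in>(UNIV::'d set). card (if j = i then {c} else {- int k..int k}))"
      by (rule card_PiE) simp
    also have "\<dots> = (\<Prod>j\<in>(UNIV::'d set) - {i}. 2 * k + 1)"
      by (subst prod.remove[of _ i]) (auto intro!: prod.cong simp: nat_add_distrib nat_mult_distrib)
    also have "\<dots> = (2 * k + 1) ^ (CARD('d) - 1)" by (simp add: card_Diff_singleton)
    finally show ?thesis .
  qed
  have "{w :: 'd vertex. linf_norm w = int k} \<subseteq> (\<Union>p\<in>UNIV \<times> {int k, - int k}. F p)"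
  proof
    fix w :: "'d vertex" assume "w \<in> {w. linf_norm w = int k}"
    then have w: "linf_norm w = int k" by simp
    have "linf_norm w \<in> range (\<lambda>i. \<bar>w $ i\<bar>)" unfolding linf_norm_def by (rule Max_in) auto
    then obtain i where i: "\<bar>w $ i\<bar> = int k" using w by auto
    have le: "\<bar>w $ j\<bar> \<le> int k" for j using linf_norm_ge[of w j] w by simp
    have "w \<in> F (i, w $ i)"
      unfolding F_def using le by (auto intro!: image_eqI[of _ _ "\<lambda>j. w $ j"] simp: abs_le_iff PiE_def) (metis minus_le_iff)
    moreover have "w $ i \<in> {int k, - int k}" using i by auto
    ultimately show "w \<in> (\<Union>p\<in>UNIV \<times> {int k, - int k}. F p)" by blast
  qed
  moreover have fin: "finite (F p)" for p
    unfolding F_def by (cases p) (auto intro!: finite_imageI finite_PiE)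
  ultimately have "card {w :: 'd vertex. linf_norm w = int k} \<le> card (\<Union>p\<in>UNIV \<times> {int k, - int k}. F p)"
    by (intro card_mono finite_UN_I) auto
  also have "\<dots> \<le> (\<Sum>p\<in>UNIV \<times> {int k, - int k}. card (F p))" by (rule card_UN_le) simp
  also have "\<dots> \<le> (\<Sum>p\<in>(UNIV :: 'd set) \<times> {int k, - int k}. (2 * k + 1) ^ (CARD('d) - 1))"
    by (intro sum_mono) (use card in auto)
  also have "\<dots> = card ((UNIV :: 'd set) \<times> {int k, - int k}) * (2 * k + 1) ^ (CARD('d) - 1)" by simp
  also have "\<dots> \<le> 2 * CARD('d) * (2 * k + 1) ^ (CARD('d) - 1)"
    by (intro mult_right_mono) (auto simp: card_cartesian_product card_insert_if)
  finally show ?thesis .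
qed

lemma card_layer_edges:
  "\<exists>C. \<forall>k. real (card (layer_edges k :: 'd::finite edge set)) \<le> C * real (Suc k) ^ (CARD('d) - 1)"
proof -
  define B where "B = (lattice_box 1 :: 'd vertex set)"
  define C where "C = real (2 * CARD('d) * 3 ^ (CARD('d) - 1) * card B)"
  have "real (card (layer_edges k :: 'd edge set)) \<le> C * real (Suc k) ^ (CARD('d) - 1)" for k
  proof -
    let ?S = "{w :: 'd vertex. linf_norm w = int (Suc k)}"
    have finS: "finite ?S"
      by (rule finite_subset[OF _ finite_lattice_box[of "real (Suc k)"]]) (auto simp: lattice_box_def)
    \<comment> \<open>An edge is encoded by its outer endpoint and a displacement of sup norm at
      most one, so the edge count is a constant times the size of the sphere.\<close>
    have "layer_edges k \<subseteq> (\<lambda>(w, a). {w + a, w}) ` (?S \<times> B)"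
    proof
      fix e :: "'d edge" assume "e \<in> layer_edges k"
      then obtain v w where e: "e = {v, w}" "nearest_neighbors v w" "linf_norm w = int (Suc k)"
        unfolding layer_edges_def by blast
      have "linf_norm (v - w) \<le> 1" using linf_le_l1_norm[of "v - w"] e(2) by (simp add: nearest_neighbors_def)
      then have "v - w \<in> B" by (simp add: B_def lattice_box_def)
      then show "e \<in> (\<lambda>(w, a). {w + a, w}) ` (?S \<times> B)"
        using e by (intro image_eqI[of _ _ "(w, v - w)"]) auto
    qed
    then have "card (layer_edges k :: 'd edge set) \<le> card (?S \<times> B)"
      using finS finite_lattice_box unfolding B_def
      by (intro surj_card_le[of "?S \<times> lattice_box 1"]) auto
    also have "\<dots> = card ?S * card B" by (simp add: card_cartesian_product)
    also have "\<dots> \<le> 2 * CARD('d) * (2 * Suc k + 1) ^ (CARD('d) - 1) * card B"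
      by (intro mult_right_mono card_sphere_le) auto
    also have "\<dots> \<le> 2 * CARD('d) * (3 * Suc k) ^ (CARD('d) - 1) * card B"
      by (intro mult_right_mono mult_left_mono power_mono) auto
    finally have "real (card (layer_edges k :: 'd edge set))
        \<le> real (2 * CARD('d) * (3 * Suc k) ^ (CARD('d) - 1) * card B)" by (simp only: of_nat_le_iff)
    also have "\<dots> = C * real (Suc k) ^ (CARD('d) - 1)"
      by (simp add: C_def power_mult_distrib del: mult_Suc_right of_nat_Suc)
    finally show ?thesis .
  qed
  then show ?thesis by blast
qed

lemma path_crosses_layer:
  assumes "\<gamma> \<in> lattice_paths v w" "linf_norm v \<le> int k" "linf_norm w > int k"
  shows "\<exists>e\<in>path_edges \<gamma>. e \<in> layer_edges k"
  using assms
proof (induction \<gamma> arbitrary: v)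
  case (Cons a \<gamma>)
  have a: "a = v" and ne: "\<gamma> \<noteq> []" using Cons.prems by (auto simp: lattice_paths_def split: if_splits)
  define u where "u = hd \<gamma>"
  have nn: "nearest_neighbors v u" and \<gamma>: "\<gamma> \<in> lattice_paths u w"
    using Cons.prems ne a by (auto simp: lattice_paths_def successively_Cons u_def)
  show ?case
  proof (cases "linf_norm u \<le> int k")
    case True
    from Cons.IH[OF \<gamma> this Cons.prems(3)] show ?thesis using ne by (auto simp: path_edges_Cons)
  next
    case False
    then have "linf_norm u = int (Suc k)" "linf_norm v = int k"
      using linf_norm_neighbor[OF nn] Cons.prems(2) by auto
    then have "{v, u} \<in> layer_edges k" using nn unfolding layer_edges_def by blast
    then show ?thesis using ne a by (auto simp: path_edges_Cons u_def)
  qed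
qed (auto simp: lattice_paths_def)

text \<open>Layer k has of order k^(d-1) edges of weight 1/(k H), so for r \<ge> d it contributes at
  most C H^(-r) / k. Summing over k produces one factor H. The total C H^(1-r) is at most C/H
  because r \<ge> 2, and it is small because the harmonic numbers diverge.\<close>

lemma cheap_blocking:
  assumes d: "CARD('d::finite) \<ge> 2" and r: "r \<ge> real CARD('d)" and \<eta>: "\<eta> > 0"
  shows "\<exists>K \<ge> 1. \<exists>f :: 'd edge \<Rightarrow> real. blocking K f \<and> energy r K f < \<eta>"
proof -
  obtain C where C: "\<And>k. real (card (layer_edges k :: 'd edge set)) \<le> C * real (Suc k) ^ (CARD('d) - 1)"
    using card_layer_edges by blast
  have C0: "C \<ge> 0" using C[of 0] by simp
  have r2: "r \<ge> 2" using d r by linarith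
  have "filterlim (harm :: nat \<Rightarrow> real) at_top sequentially" by (rule harm_at_top)
  then have "\<forall>\<^sub>F K in sequentially. harm K > max 1 (C / \<eta>)"
    unfolding filterlim_at_top_dense by (rule spec)
  then have "\<forall>\<^sub>F K in sequentially. harm K > max 1 (C / \<eta>) \<and> K \<ge> 1"
    using eventually_ge_at_top[of 1] by eventually_elim simp
  then obtain K where K: "harm K > max 1 (C / \<eta>)" "K \<ge> 1"
    by (auto simp: eventually_sequentially)
  define H where "H = (harm K :: real)"
  have H: "H > 1" "C / \<eta> < H" using K by (auto simp: H_def)
  define f where "f e = (\<Sum>k<K. if e \<in> layer_edges k then 1 / (real (Suc k) * H) else 0)" for e :: "'d edge"
  have f0: "f e \<ge> 0" for e unfolding f_def using H by (intro sum_nonneg) auto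
  have fk: "f e = 1 / (real (Suc k) * H)" if "e \<in> layer_edges k" "k < K" for e k
  proof -
    have "f e = (\<Sum>l<K. if l = k then 1 / (real (Suc k) * H) else 0)"
      unfolding f_def
    proof (intro sum.cong refl)
      fix l
      show "(if e \<in> layer_edges l then 1 / (real (Suc l) * H) else 0)
          = (if l = k then 1 / (real (Suc k) * H) else 0)"
        using that(1) layer_edges_disjoint[OF that(1), of l] by (cases "l = k") auto
    qed
    then show ?thesis using that by simp
  qed
  have out: "f e = 0" if "\<And>k. k < K \<Longrightarrow> e \<notin> layer_edges k" for e
    unfolding f_def using that by (intro sum.neutral) auto
  have "blocking K f"
    unfolding blocking_def
  proof (intro conjI allI impI f0)
    fix e :: "'d edge" assume "e \<notin> box_edges (real K)"
    then show "f e = 0" using layer_edges_in_box by (intro out) blast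
  next
    fix w :: "'d vertex" assume w: "int K < linf_norm w"
    show "1 \<le> passage f 0 w"
    proof (rule passage_ge)
      fix \<gamma> :: "'d vertex list" assume \<gamma>: "\<gamma> \<in> lattice_paths 0 w"
      have "1 = (\<Sum>k<K. 1 / (real (Suc k) * H))"
        using H by (simp add: H_def harm_altdef sum_divide_distrib[symmetric] inverse_eq_divide
            divide_divide_eq_left[symmetric] del: of_nat_Suc divide_divide_eq_left)
      also have "\<dots> \<le> (\<Sum>k<K. \<Sum>e\<in>path_edges \<gamma>. if e \<in> layer_edges k then 1 / (real (Suc k) * H) else 0)"
      proof (rule sum_mono)
        fix k assume k: "k \<in> {..<K}"
        obtain e where e: "e \<in> path_edges \<gamma>" "e \<in> layer_edges k"
          using path_crosses_layer[OF \<gamma>, of k] w k by auto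
        have "1 / (real (Suc k) * H) = (if e \<in> layer_edges k then 1 / (real (Suc k) * H) else 0)"
          using e by simp
        also have "\<dots> \<le> (\<Sum>e\<in>path_edges \<gamma>. if e \<in> layer_edges k then 1 / (real (Suc k) * H) else 0)"
          using H e by (intro member_le_sum) (auto simp: finite_path_edges)
        finally show "1 / (real (Suc k) * H)
          \<le> (\<Sum>e\<in>path_edges \<gamma>. if e \<in> layer_edges k then 1 / (real (Suc k) * H) else 0)" .
      qed
      also have "\<dots> = path_time f \<gamma>"
        unfolding path_time_def f_def by (rule sum.swap)
      finally show "1 \<le> path_time f \<gamma>" .
    qed
  qed
  moreover have "energy r K f < \<eta>"
  proof -
    have scale: "(1 / (a * H)) powr r = a powr (- r) * H powr - r" if "a > 0" for a
      using that H by (simp add: powr_divide powr_mult powr_minus_divide)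
    have merge: "C * a powr p * (a powr (- r) * h) = C * a powr (p - r) * h" for a p h :: real
    proof -
      have "a powr (p - r) = a powr p * a powr (- r)" by (simp add: powr_add[symmetric])
      then show ?thesis by simp
    qed
    have "energy r K f = (\<Sum>e\<in>(\<Union>k<K. layer_edges k). f e powr r)"
      unfolding energy_def
    proof (intro sum.mono_neutral_right finite_box_edges ballI)
      show "(\<Union>k<K. layer_edges k) \<subseteq> (box_edges (real K) :: 'd edge set)"
        using layer_edges_in_box by blast
      fix e :: "'d edge" assume "e \<in> box_edges (real K) - (\<Union>k<K. layer_edges k)"
      then have "f e = 0" by (intro out) auto
      then show "f e powr r = 0" by simp
    qed
    also have "\<dots> = (\<Sum>k<K. \<Sum>e\<in>layer_edges k. f e powr r)"
      by (intro sum.UNION_disjoint) (auto simp: finite_layer_edges dest: layer_edges_disjoint)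
    also have "\<dots> = (\<Sum>k<K. real (card (layer_edges k :: 'd edge set)) * (1 / (real (Suc k) * H)) powr r)"
      by (intro sum.cong) (auto simp: fk)
    also have "\<dots> \<le> (\<Sum>k<K. C * inverse (real (Suc k)) * (H powr - r))"
    proof (rule sum_mono)
      fix k assume "k \<in> {..<K}"
      have "real (card (layer_edges k :: 'd edge set)) * (1 / (real (Suc k) * H)) powr r
         \<le> C * real (Suc k) ^ (CARD('d) - 1) * (1 / (real (Suc k) * H)) powr r"
        by (intro mult_right_mono C) auto
      also have "\<dots> = C * real (Suc k) powr (real CARD('d) - 1) * (real (Suc k) powr (- r) * H powr - r)"
        using d by (simp only: scale of_nat_0_less_iff zero_less_Suc)
          (subst powr_realpow[symmetric], auto simp: of_nat_diff)
      also have "\<dots> = C * real (Suc k) powr (real CARD('d) - 1 - r) * H powr - r"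
        by (rule merge)
      also have "\<dots> \<le> C * real (Suc k) powr (- 1) * H powr - r"
        using r C0 by (intro mult_right_mono mult_left_mono powr_mono) auto
      finally show "real (card (layer_edges k :: 'd edge set)) * (1 / (real (Suc k) * H)) powr r
         \<le> C * inverse (real (Suc k)) * (H powr - r)"
        by (simp only: powr_minus_divide powr_one inverse_eq_divide of_nat_0_le_iff)
    qed
    also have "\<dots> = C * H * H powr - r"
      unfolding H_def harm_altdef by (simp add: sum_distrib_left sum_distrib_right)
    also have "\<dots> \<le> C * H * H powr - 2"
      using C0 H r2 by (intro mult_left_mono powr_mono) auto
    also have "\<dots> = C / H" using H by (simp add: powr_minus powr_numeral power2_eq_square field_simps)
    also have "\<dots> < \<eta>" using H \<eta> by (simp add: field_simps)
    finally show ?thesis .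
  qed
  ultimately show ?thesis using K by blast
qed

text \<open>If every point at radius k around z is reached within time m, then each way from z to
  that sphere must cost at least s. The weights in the box around z therefore form a trap of depth
  s, and their energy is bounded below by the capacity.\<close>

lemma trapped_energy:
  fixes t :: "'d::finite edge \<Rightarrow> real"
  assumes t: "weights t" and k: "k \<le> K" and s: "s > 0"
    and esc: "\<And>y. linf_norm y = int k \<Longrightarrow> passage t 0 (z + y) \<le> m"
    and ge: "passage t 0 z \<ge> m + s"
  shows "(\<Sum>e\<in>box_edges (real K). t ((+) z ` e) powr r) \<ge> capacity TYPE('d) r K * s powr r"
proof -
  let ?t = "\<lambda>e. t ((+) z ` e)"
  let ?u = "\<lambda>e. if e \<in> box_edges (real K) then ?t e else 0"
  have wt: "weights ?t" by (rule weights_shift[OF t])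
  have wu: "weights ?u" using wt by (auto simp: weights_def)
  have "passage ?u 0 w \<ge> s" if w: "linf_norm w > int K" for w
  proof (rule passage_ge)
    fix \<gamma> assume \<gamma>: "\<gamma> \<in> lattice_paths 0 w"
    obtain y \<delta> where \<delta>: "\<delta> \<in> lattice_paths 0 y" "linf_norm y = int k" "path_edges \<delta> \<subseteq> path_edges \<gamma>"
      \<comment> \<open>The prefix stays within radius k, hence inside the box, where the truncated
        weights agree with the original ones.\<close>
      "\<forall>y\<in>set \<delta>. linf_norm y \<le> int k"
      using path_prefix_to_sphere[OF \<gamma>, of 0 "int k"] w k by auto
    have box: "path_edges \<delta> \<subseteq> box_edges (real K)"
    proof
      fix e assume "e \<in> path_edges \<delta>"
      then obtain i where i: "e = {\<delta> ! i, \<delta> ! Suc i}" "Suc i < length \<delta>" unfolding path_edges_def by blast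
      have "nearest_neighbors (\<delta> ! i) (\<delta> ! Suc i)"
        using \<delta>(1) i(2) successively_nth unfolding lattice_paths_def by blast
      moreover have "linf_norm (\<delta> ! i) \<le> int K" "linf_norm (\<delta> ! Suc i) \<le> int K"
        using \<delta>(4) i(2) k by (meson Suc_lessD nth_mem of_nat_le_iff order_trans)+
      ultimately show "e \<in> box_edges (real K)"
        unfolding i box_edges_def lattice_box_def by fastforce
    qed
    have "m + s \<le> passage t 0 z" by (rule ge)
    also have "\<dots> \<le> passage t 0 (z + y) + passage t (z + y) z" by (rule passage_triangle[OF t])
    also have "\<dots> \<le> m + passage t (z + 0) (z + y)" using esc[OF \<delta>(2)] by (simp add: passage_sym)
    also have "passage t (z + 0) (z + y) = passage ?t 0 y" by (rule passage_shift)
    finally have "s \<le> passage ?t 0 y" by simp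
    also have "\<dots> \<le> path_time ?t \<delta>" by (rule passage_le[OF wt \<delta>(1)])
    also have "\<dots> = path_time ?u \<delta>" unfolding path_time_def using box by (intro sum.cong) auto
    also have "\<dots> \<le> path_time ?u \<gamma>"
      unfolding path_time_def
    proof (rule sum_mono2[OF finite_path_edges \<delta>(3)])
      show "0 \<le> ?u b" if "b \<in> path_edges \<gamma> - path_edges \<delta>" for b
        using that wu lattice_paths_edges[OF \<gamma>] unfolding weights_def by blast
    qed
    finally show "s \<le> path_time ?u \<gamma>" .
  qed
  moreover have "?u e \<ge> 0" for e
    using wt box_edges_lattice by (auto simp: weights_def)
  moreover have "?u = (\<lambda>e. if e \<in> box_edges (real K) then ?u e else 0)" by auto
  ultimately have "capacity TYPE('d) r K * s powr r \<le> (\<Sum>e\<in>box_edges (real K). ?u e powr r)"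
    using s by (intro energy_ge_capacity) auto
  also have "\<dots> = (\<Sum>e\<in>box_edges (real K). ?t e powr r)" by (intro sum.cong) auto
  finally show ?thesis .
qed

section \<open>Independent weights with stretched exponential tails\<close>

lemma (in prob_space) exp_Markov:
  assumes X: "X \<in> borel_measurable M" and c: "c \<ge> 0"
    and le: "(\<integral>\<^sup>+\<omega>. ennreal (exp (X \<omega>)) \<partial>M) \<le> ennreal c"
  shows "prob {\<omega>\<in>space M. X \<omega> \<ge> s} \<le> exp (- s) * c"
proof -
  note X[measurable]
  let ?A = "{\<omega>\<in>space M. X \<omega> \<ge> s}"
  have "ennreal (exp s) * emeasure M ?A = (\<integral>\<^sup>+\<omega>. ennreal (exp s) * indicator ?A \<omega> \<partial>M)"
    by (simp add: nn_integral_cmult_indicator)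
  also have "\<dots> \<le> (\<integral>\<^sup>+\<omega>. ennreal (exp (X \<omega>)) \<partial>M)"
    by (intro nn_integral_mono) (auto split: split_indicator)
  also have "\<dots> \<le> ennreal c" by (rule le)
  finally have "ennreal (exp s * prob ?A) \<le> ennreal c"
    by (simp add: emeasure_eq_measure ennreal_mult')
  then have "exp s * prob ?A \<le> c" using c by simp
  then have "exp (- s) * (exp s * prob ?A) \<le> exp (- s) * c" by (intro mult_left_mono) auto
  then show ?thesis by (simp add: mult.assoc[symmetric] exp_add[symmetric])
qed

locale percolation = prob_space M for M :: "'a measure" +
  fixes \<tau> :: "'d::finite edge \<Rightarrow> 'a \<Rightarrow> real" and \<beta>\<^sub>1 \<beta>\<^sub>2 \<alpha> r :: real
  assumes indep: "indep_vars (\<lambda>_. borel) \<tau> lattice_edges"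
    and ident: "\<And>e e'. e \<in> lattice_edges \<Longrightarrow> e' \<in> lattice_edges \<Longrightarrow>
          distr M borel (\<tau> e) = distr M borel (\<tau> e')"
    and nonneg: "\<And>e \<omega>. e \<in> lattice_edges \<Longrightarrow> \<omega> \<in> space M \<Longrightarrow> \<tau> e \<omega> \<ge> 0"
    and \<beta>\<^sub>1: "\<beta>\<^sub>1 > 0" and \<beta>\<^sub>2: "\<beta>\<^sub>2 > 0" and \<alpha>: "\<alpha> > 0" and r: "r > 0"
    and tail: "\<And>e t. e \<in> lattice_edges \<Longrightarrow> t \<ge> 0 \<Longrightarrow>
          \<beta>\<^sub>1 * exp (- \<alpha> * t powr r) \<le> \<P>(\<omega> in M. \<tau> e \<omega> > t) \<and>
          \<P>(\<omega> in M. \<tau> e \<omega> > t) \<le> \<beta>\<^sub>2 * exp (- \<alpha> * t powr r)"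
begin

lemma \<tau>_measurable [measurable]: "e \<in> lattice_edges \<Longrightarrow> \<tau> e \<in> borel_measurable M"
  using indep unfolding indep_vars_def by auto

lemma weights_\<tau>: "\<omega> \<in> space M \<Longrightarrow> weights (\<lambda>e. \<tau> e \<omega>)"
  unfolding weights_def using nonneg by auto

section \<open>Independence over disjoint blocks and relabelling of edges\<close>

lemma nn_integral_blocks:
  fixes g :: "'j \<Rightarrow> ('d edge \<Rightarrow> real) \<Rightarrow> ennreal"
  assumes J: "finite J" and K: "\<And>j. j \<in> J \<Longrightarrow> K j \<subseteq> lattice_edges" "disjoint_family_on K J"
    and g: "\<And>j. j \<in> J \<Longrightarrow> g j \<in> borel_measurable (PiM (K j) (\<lambda>_. borel))"
  shows "(\<integral>\<^sup>+\<omega>. (\<Prod>j\<in>J. g j (\<lambda>e\<in>K j. \<tau> e \<omega>)) \<partial>M) = (\<Prod>j\<in>J. \<integral>\<^sup>+\<omega>. g j (\<lambda>e\<in>K j. \<tau> e \<omega>) \<partial>M)"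
proof (rule indep_vars_nn_integral[OF J])
  show "indep_vars (\<lambda>_. borel) (\<lambda>j \<omega>. g j (\<lambda>e\<in>K j. \<tau> e \<omega>)) J"
    by (rule indep_vars_compose2[OF indep_vars_restrict[OF indep K]]) (use g in auto)
qed auto

lemma nn_integral_edges:
  fixes g :: "'d edge \<Rightarrow> real \<Rightarrow> ennreal"
  assumes J: "finite J" "J \<subseteq> lattice_edges" and g: "\<And>j. j \<in> J \<Longrightarrow> g j \<in> borel_measurable borel"
  shows "(\<integral>\<^sup>+\<omega>. (\<Prod>j\<in>J. g j (\<tau> j \<omega>)) \<partial>M) = (\<Prod>j\<in>J. \<integral>\<^sup>+\<omega>. g j (\<tau> j \<omega>) \<partial>M)"
proof (rule indep_vars_nn_integral[OF J(1)])
  show "indep_vars (\<lambda>_. borel) (\<lambda>j \<omega>. g j (\<tau> j \<omega>)) J"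
    by (rule indep_vars_compose2[OF indep_vars_subset[OF indep J(2)] g])
qed auto

lemma distr_reindex:
  assumes F: "F \<subseteq> lattice_edges" "F \<noteq> {}" and h: "inj_on h F" "h ` F \<subseteq> lattice_edges"
  shows "distr M (PiM F (\<lambda>_. borel)) (\<lambda>\<omega>. \<lambda>e\<in>F. \<tau> (h e) \<omega>)
       = distr M (PiM F (\<lambda>_. borel)) (\<lambda>\<omega>. \<lambda>e\<in>F. \<tau> e \<omega>)"
proof -
  \<comment> \<open>Independence of the relabelled family is read off from the singleton blocks {h
    e}, which are disjoint since h is injective.\<close>
  have "disjoint_family_on (\<lambda>e. {h e}) F" using h(1) by (auto simp: disjoint_family_on_def inj_on_def)
  then have "indep_vars (\<lambda>e. PiM {h e} (\<lambda>_. borel)) (\<lambda>e \<omega>. \<lambda>i\<in>{h e}. \<tau> i \<omega>) F"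
    using h(2) by (intro indep_vars_restrict[OF indep]) auto
  then have "indep_vars (\<lambda>_. borel) (\<lambda>e \<omega>. (\<lambda>f. f (h e)) (\<lambda>i\<in>{h e}. \<tau> i \<omega>)) F"
    by (rule indep_vars_compose2) (rule measurable_component_singleton, simp)
  then have 1: "indep_vars (\<lambda>_. borel) (\<lambda>e. \<tau> (h e)) F" by simp
  have 2: "indep_vars (\<lambda>_. borel) \<tau> F" by (rule indep_vars_subset[OF indep F(1)])
  have "distr M (PiM F (\<lambda>_. borel)) (\<lambda>\<omega>. \<lambda>e\<in>F. \<tau> (h e) \<omega>) = PiM F (\<lambda>e. distr M borel (\<tau> (h e)))"
    using 1 h F by (subst (asm) indep_vars_iff_distr_eq_PiM') auto
  also have "\<dots> = PiM F (\<lambda>e. distr M borel (\<tau> e))"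
    using h F by (intro PiM_cong refl ident) auto
  also have "\<dots> = distr M (PiM F (\<lambda>_. borel)) (\<lambda>\<omega>. \<lambda>e\<in>F. \<tau> e \<omega>)"
    using 2 F by (subst (asm) indep_vars_iff_distr_eq_PiM') auto
  finally show ?thesis .
qed

section \<open>Exponential moments and Laplace transforms of single weights\<close>

lemma exp_moment:
  assumes \<gamma>: "0 \<le> \<gamma>" "\<gamma> < \<alpha>"
  shows "\<exists>C\<ge>1. \<forall>e\<in>lattice_edges. (\<integral>\<^sup>+\<omega>. ennreal (exp (\<gamma> * \<tau> e \<omega> powr r)) \<partial>M) \<le> ennreal C"
proof -
  define q where "q = exp (\<gamma> - \<alpha>)"
  define c where "c = exp \<gamma> * ((\<beta>\<^sub>2 + 1) * exp \<alpha>)"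
  have q: "0 < q" "q < 1" using \<gamma> by (auto simp: q_def)
  have c: "c > 0" using \<beta>\<^sub>2 by (simp add: c_def)
  have "(\<integral>\<^sup>+\<omega>. ennreal (exp (\<gamma> * \<tau> e \<omega> powr r)) \<partial>M) \<le> ennreal (c / (1 - q))"
    if e: "e \<in> lattice_edges" for e
  proof -
    note [measurable] = \<tau>_measurable[OF e]
    define A where "A k = {\<omega>\<in>space M. \<tau> e \<omega> powr r \<ge> real k}" for k :: nat
    have [measurable]: "A k \<in> sets M" for k unfolding A_def by measurable
    have PA: "prob (A k) \<le> (\<beta>\<^sub>2 + 1) * exp \<alpha> * exp (- \<alpha> * real k)" for k
    proof (cases k)
      case 0
      have "prob (A k) \<le> 1 * 1" by simp
      also have "\<dots> \<le> (\<beta>\<^sub>2 + 1) * exp \<alpha>" using \<beta>\<^sub>2 \<alpha> by (intro mult_mono) auto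
      finally show ?thesis using 0 by simp
    next
      case (Suc j)
      have "prob (A k) \<le> \<P>(\<omega> in M. \<tau> e \<omega> > real j powr (1 / r))"
      proof (rule finite_measure_mono)
        show "A k \<subseteq> {\<omega>\<in>space M. \<tau> e \<omega> > real j powr (1 / r)}"
        proof
          fix \<omega> assume w: "\<omega> \<in> A k"
          then have *: "\<tau> e \<omega> powr r \<ge> real (Suc j)" "\<omega> \<in> space M" unfolding A_def Suc by auto
          have "\<tau> e \<omega> > real j powr (1 / r)"
          proof (rule ccontr)
            assume "\<not> ?thesis"
            then have "\<tau> e \<omega> powr r \<le> (real j powr (1 / r)) powr r"
              using r nonneg[OF e *(2)] by (intro powr_mono2) auto
            also have "\<dots> = real j" using r by (simp add: powr_powr)
            finally show False using * by simp
          qed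
          then show "\<omega> \<in> {\<omega>\<in>space M. \<tau> e \<omega> > real j powr (1 / r)}" using * by simp
        qed
      qed measurable
      also have "\<dots> \<le> \<beta>\<^sub>2 * exp (- \<alpha> * (real j powr (1 / r)) powr r)"
        using tail[OF e, of "real j powr (1 / r)"] by auto
      also have "(real j powr (1 / r)) powr r = real j" using r by (simp add: powr_powr)
      also have "\<beta>\<^sub>2 * exp (- \<alpha> * real j) \<le> (\<beta>\<^sub>2 + 1) * exp (- \<alpha> * real j)" by simp
      also have "\<dots> = (\<beta>\<^sub>2 + 1) * exp \<alpha> * exp (- \<alpha> * real k)"
        by (simp add: Suc exp_add[symmetric] algebra_simps mult_exp_exp)
      finally show ?thesis .
    qed
    have term_le: "f k \<le> suminf f" for f :: "nat \<Rightarrow> ennreal" and k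
      using sum_le_suminf[of f "{k}"] by simp
    have "(\<integral>\<^sup>+\<omega>. ennreal (exp (\<gamma> * \<tau> e \<omega> powr r)) \<partial>M)
       \<le> (\<integral>\<^sup>+\<omega>. (\<Sum>k. ennreal (exp (\<gamma> * (real k + 1))) * indicator (A k) \<omega>) \<partial>M)"
    proof (rule nn_integral_mono)
      fix \<omega> assume w: "\<omega> \<in> space M"
      define k where "k = nat \<lfloor>\<tau> e \<omega> powr r\<rfloor>"
      have "real k = of_int \<lfloor>\<tau> e \<omega> powr r\<rfloor>" unfolding k_def by simp
      then have k: "real k \<le> \<tau> e \<omega> powr r" "\<tau> e \<omega> powr r \<le> real k + 1" by linarith+
      have "exp (\<gamma> * \<tau> e \<omega> powr r) \<le> exp (\<gamma> * (real k + 1))" using k \<gamma> by (simp add: mult_left_mono)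
      then have "ennreal (exp (\<gamma> * \<tau> e \<omega> powr r)) \<le> ennreal (exp (\<gamma> * (real k + 1))) * indicator (A k) \<omega>"
        using k w by (simp add: A_def ennreal_leI)
      also have "\<dots> \<le> (\<Sum>k. ennreal (exp (\<gamma> * (real k + 1))) * indicator (A k) \<omega>)"
        by (rule term_le)
      finally show "ennreal (exp (\<gamma> * \<tau> e \<omega> powr r)) \<le> (\<Sum>k. ennreal (exp (\<gamma> * (real k + 1))) * indicator (A k) \<omega>)" .
    qed
    also have "\<dots> = (\<Sum>k. ennreal (exp (\<gamma> * (real k + 1))) * emeasure M (A k))"
      by (subst nn_integral_suminf) (auto simp: nn_integral_cmult_indicator)
    also have "\<dots> \<le> (\<Sum>k. ennreal (c * q ^ k))"
    proof (intro suminf_le summableI)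
      fix k
      have "ennreal (exp (\<gamma> * (real k + 1))) * emeasure M (A k) = ennreal (exp (\<gamma> * (real k + 1)) * prob (A k))"
        by (simp add: emeasure_eq_measure ennreal_mult')
      also have "\<dots> \<le> ennreal (exp (\<gamma> * (real k + 1)) * ((\<beta>\<^sub>2 + 1) * exp \<alpha> * exp (- \<alpha> * real k)))"
        by (intro ennreal_leI mult_left_mono PA) auto
      also have "exp (\<gamma> * (real k + 1)) * ((\<beta>\<^sub>2 + 1) * exp \<alpha> * exp (- \<alpha> * real k)) = c * q ^ k"
        unfolding c_def q_def exp_of_nat_mult[symmetric]
        by (simp add: algebra_simps exp_add[symmetric] mult_exp_exp exp_diff add_divide_distrib)
      finally show "ennreal (exp (\<gamma> * (real k + 1))) * emeasure M (A k) \<le> ennreal (c * q ^ k)" .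
    qed
    also have "\<dots> = ennreal (c / (1 - q))"
    proof (rule suminf_ennreal_eq)
      show "(\<lambda>k. c * q ^ k) sums (c / (1 - q))"
        using sums_mult[OF geometric_sums[of q], of c] q by simp
    qed (use c q in auto)
    finally show ?thesis .
  qed
  moreover have "ennreal (c / (1 - q)) \<le> ennreal (max 1 (c / (1 - q)))" by (intro ennreal_leI) simp
  ultimately show ?thesis
    by (intro exI[of _ "max 1 (c / (1 - q))"]) (meson max.cobounded1 order_trans)
qed

text \<open>The energy of finitely many weights has exponential tails at every rate below \<alpha>.
  This matches \<open>product_lower_bound\<close> up to the factor \<open>C ^ card F\<close>, which
  is harmless because F will have a fixed number of edges.\<close>

lemma sum_powr_tail:
  assumes \<gamma>: "0 \<le> \<gamma>" "\<gamma> < \<alpha>"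
  shows "\<exists>C\<ge>1. \<forall>F u. finite F \<longrightarrow> F \<subseteq> lattice_edges \<longrightarrow>
     prob {\<omega>\<in>space M. (\<Sum>e\<in>F. \<tau> e \<omega> powr r) \<ge> u} \<le> C ^ card F * exp (- \<gamma> * u)"
proof -
  obtain C where C: "C \<ge> 1"
    "\<And>e. e \<in> lattice_edges \<Longrightarrow> (\<integral>\<^sup>+\<omega>. ennreal (exp (\<gamma> * \<tau> e \<omega> powr r)) \<partial>M) \<le> ennreal C"
    using exp_moment[OF \<gamma>] by blast
  have "prob {\<omega>\<in>space M. (\<Sum>e\<in>F. \<tau> e \<omega> powr r) \<ge> u} \<le> C ^ card F * exp (- \<gamma> * u)"
    if F: "finite F" "F \<subseteq> lattice_edges" for F u
  proof (cases "\<gamma> = 0")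
    case True
    have "prob {\<omega>\<in>space M. (\<Sum>e\<in>F. \<tau> e \<omega> powr r) \<ge> u} \<le> 1" by simp
    also have "1 \<le> C ^ card F" using C by simp
    finally show ?thesis using True by simp
  next
    case False
    then have \<gamma>0: "\<gamma> > 0" using \<gamma> by simp
    have [measurable]: "e \<in> F \<Longrightarrow> \<tau> e \<in> borel_measurable M" for e using F by auto
    have "(\<integral>\<^sup>+\<omega>. ennreal (exp (\<gamma> * (\<Sum>e\<in>F. \<tau> e \<omega> powr r))) \<partial>M)
        = (\<integral>\<^sup>+\<omega>. (\<Prod>e\<in>F. ennreal (exp (\<gamma> * \<tau> e \<omega> powr r))) \<partial>M)"
      by (simp add: sum_distrib_left exp_sum F prod_ennreal)
    also have "\<dots> = (\<Prod>e\<in>F. \<integral>\<^sup>+\<omega>. ennreal (exp (\<gamma> * \<tau> e \<omega> powr r)) \<partial>M)"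
      by (rule nn_integral_edges[OF F, of "\<lambda>_ x. ennreal (exp (\<gamma> * x powr r))"]) measurable
    also have "\<dots> \<le> (\<Prod>e\<in>F. ennreal C)" using F by (intro prod_mono_ennreal C(2)) auto
    also have "\<dots> = ennreal (C ^ card F)" using C by (simp add: ennreal_power)
    finally have "prob {\<omega>\<in>space M. \<gamma> * (\<Sum>e\<in>F. \<tau> e \<omega> powr r) \<ge> \<gamma> * u} \<le> exp (- (\<gamma> * u)) * C ^ card F"
      using C by (intro exp_Markov) auto
    moreover have "{\<omega>\<in>space M. \<gamma> * (\<Sum>e\<in>F. \<tau> e \<omega> powr r) \<ge> \<gamma> * u} = {\<omega>\<in>space M. (\<Sum>e\<in>F. \<tau> e \<omega> powr r) \<ge> u}"
      using \<gamma>0 by auto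
    ultimately show ?thesis by (simp add: mult.commute)
  qed
  with C(1) show ?thesis by blast
qed

text \<open>Young's inequality handles large \<open>s\<close> and convexity small \<open>s\<close>; the bound must vanish
  as \<open>s \<rightarrow> 0\<close> because it is multiplied over a growing number of edges.\<close>

lemma laplace_bound:
  assumes r1: "r > 1"
  shows "\<exists>C\<ge>0. \<forall>e\<in>lattice_edges. \<forall>s\<ge>0.
    (\<integral>\<^sup>+\<omega>. ennreal (exp (s * \<tau> e \<omega>)) \<partial>M) \<le> ennreal (exp (C * (s + s powr (r / (r - 1)))))"
proof -
  define r' where "r' = r / (r - 1)"
  \<comment> \<open>The point where s equals \<alpha>/2 times x^(r-1), solved for x, gives this
    constant. Below it the product s x is charged to the conjugate power of s, above it to
    x^r.\<close>
  define c where "c = (2 / \<alpha>) powr (1 / (r - 1))"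
  have c: "c \<ge> 0" by (simp add: c_def)
  obtain C0 where C0: "C0 \<ge> 1"
    "\<And>e. e \<in> lattice_edges \<Longrightarrow> (\<integral>\<^sup>+\<omega>. ennreal (exp (\<alpha> / 2 * \<tau> e \<omega> powr r)) \<partial>M) \<le> ennreal C0"
    using exp_moment[of "\<alpha> / 2"] \<alpha> by auto
  have young: "s * x \<le> \<alpha> / 2 * x powr r + c * s powr r'" if "s \<ge> 0" "x \<ge> 0" for s x
  proof (cases "s \<le> \<alpha> / 2 * x powr (r - 1)")
    case True
    then have "s * x \<le> \<alpha> / 2 * (x powr (r - 1) * x)" using that by (metis mult.assoc mult_right_mono)
    also have "x powr (r - 1) * x = x powr r"
      using that r1 by (cases "x = 0") (auto simp: powr_diff)
    finally show ?thesis using c by (smt (verit) mult_nonneg_nonneg powr_ge_zero)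
  next
    case False
    then have s: "s > 0" using that \<alpha> by (smt (verit) divide_pos_pos mult_nonneg_nonneg powr_ge_zero)
    have "x powr (r - 1) \<le> 2 / \<alpha> * s" using False \<alpha> by (simp add: field_simps)
    then have "(x powr (r - 1)) powr (1 / (r - 1)) \<le> (2 / \<alpha> * s) powr (1 / (r - 1))"
      using r1 by (intro powr_mono2) auto
    moreover have "(2 / \<alpha> * s) powr (1 / (r - 1)) = c * s powr (1 / (r - 1))"
      unfolding c_def using s \<alpha> by (subst powr_mult[symmetric]) auto
    moreover have "(x powr (r - 1)) powr (1 / (r - 1)) = x"
      using r1 that by (cases "x = 0") (auto simp: powr_powr)
    ultimately have "x \<le> c * s powr (1 / (r - 1))" by simp
    then have "s * x \<le> s * (c * s powr (1 / (r - 1)))" using that by (intro mult_left_mono)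
    also have "\<dots> = c * s powr (1 + 1 / (r - 1))" using s by (simp add: powr_add)
    also have "1 + 1 / (r - 1) = r'" using r1 by (simp add: r'_def field_simps)
    finally show ?thesis using \<alpha> by (smt (verit) mult_nonneg_nonneg powr_ge_zero divide_pos_pos)
  qed
  have big: "(\<integral>\<^sup>+\<omega>. ennreal (exp (s * \<tau> e \<omega>)) \<partial>M) \<le> ennreal (exp (c * s powr r') * C0)"
    if e: "e \<in> lattice_edges" and s: "s \<ge> 0" for e s
  proof -
    note [measurable] = \<tau>_measurable[OF e]
    have "(\<integral>\<^sup>+\<omega>. ennreal (exp (s * \<tau> e \<omega>)) \<partial>M)
       \<le> (\<integral>\<^sup>+\<omega>. ennreal (exp (c * s powr r')) * ennreal (exp (\<alpha> / 2 * \<tau> e \<omega> powr r)) \<partial>M)"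
    proof (intro nn_integral_mono)
      fix \<omega> assume w: "\<omega> \<in> space M"
      have "exp (s * \<tau> e \<omega>) \<le> exp (c * s powr r') * exp (\<alpha> / 2 * \<tau> e \<omega> powr r)"
        using young[OF s nonneg[OF e w]] by (simp add: exp_add[symmetric] add.commute)
      then show "ennreal (exp (s * \<tau> e \<omega>)) \<le> ennreal (exp (c * s powr r')) * ennreal (exp (\<alpha> / 2 * \<tau> e \<omega> powr r))"
        by (simp add: ennreal_mult'[symmetric] ennreal_leI)
    qed
    also have "\<dots> = ennreal (exp (c * s powr r')) * (\<integral>\<^sup>+\<omega>. ennreal (exp (\<alpha> / 2 * \<tau> e \<omega> powr r)) \<partial>M)"
      by (rule nn_integral_cmult) measurable
    also have "\<dots> \<le> ennreal (exp (c * s powr r')) * ennreal C0" by (intro mult_left_mono C0(2) e) simp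
    finally show ?thesis using C0 by (simp add: ennreal_mult)
  qed
  define C where "C = exp c * C0 + c + ln C0"
  have lnC0: "ln C0 \<ge> 0" using C0 by simp
  have C: "C \<ge> 0" unfolding C_def using c C0(1) lnC0 by (intro add_nonneg_nonneg mult_nonneg_nonneg) auto
  have "(\<integral>\<^sup>+\<omega>. ennreal (exp (s * \<tau> e \<omega>)) \<partial>M) \<le> ennreal (exp (C * (s + s powr r')))"
    if e: "e \<in> lattice_edges" and s: "s \<ge> 0" for e s
  proof (cases "s \<ge> 1")
    case True
    have "s powr r' \<ge> 1" using True r1 by (simp add: r'_def ge_one_powr_ge_zero)
    have "exp (c * s powr r') * C0 = exp (c * s powr r' + ln C0)" using C0 by (simp add: exp_add)
    also have "\<dots> \<le> exp (C * (s + s powr r'))"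
    proof -
      have "c * s powr r' + ln C0 \<le> c * s powr r' + ln C0 * s powr r'"
        using \<open>s powr r' \<ge> 1\<close> lnC0 by (simp add: mult_left_le mult_le_cancel_left1)
      also have "\<dots> = (c + ln C0) * s powr r'" by (simp add: algebra_simps)
      also have "\<dots> \<le> C * s powr r'" using C0 by (intro mult_right_mono) (auto simp: C_def)
      also have "\<dots> \<le> C * (s + s powr r')" using s C by (intro mult_left_mono) auto
      finally show ?thesis by simp
    qed
    finally show ?thesis using big[OF e s] by (meson ennreal_leI order_trans)
  next
    case False
    note [measurable] = \<tau>_measurable[OF e]
    have "(\<integral>\<^sup>+\<omega>. ennreal (exp (s * \<tau> e \<omega>)) \<partial>M) \<le> (\<integral>\<^sup>+\<omega>. 1 + ennreal s * ennreal (exp (1 * \<tau> e \<omega>)) \<partial>M)"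
    proof (intro nn_integral_mono)
      fix \<omega> assume w: "\<omega> \<in> space M"
      have "exp ((1 - s) *\<^sub>R 0 + s *\<^sub>R \<tau> e \<omega>) \<le> (1 - s) * exp 0 + s * exp (\<tau> e \<omega>)"
        using False s by (intro convex_onD[OF exp_convex]) auto
      also have "\<dots> \<le> 1 + s * exp (\<tau> e \<omega>)" using s by simp
      finally have "exp (s * \<tau> e \<omega>) \<le> 1 + s * exp (\<tau> e \<omega>)" by simp
      then have "ennreal (exp (s * \<tau> e \<omega>)) \<le> ennreal (1 + s * exp (\<tau> e \<omega>))" by (rule ennreal_leI)
      also have "\<dots> = 1 + ennreal s * ennreal (exp (1 * \<tau> e \<omega>))"
        using s by (simp add: ennreal_plus ennreal_mult)
      finally show "ennreal (exp (s * \<tau> e \<omega>)) \<le> 1 + ennreal s * ennreal (exp (1 * \<tau> e \<omega>))" .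
    qed
    also have "\<dots> = 1 + ennreal s * (\<integral>\<^sup>+\<omega>. ennreal (exp (1 * \<tau> e \<omega>)) \<partial>M)"
      by (simp add: nn_integral_add nn_integral_cmult emeasure_space_1)
    also have "\<dots> \<le> 1 + ennreal s * ennreal (exp (c * 1 powr r') * C0)"
      by (intro add_mono mult_left_mono big e) auto
    also have "\<dots> = ennreal (1 + s * (exp c * C0))" using s C0 by (simp add: ennreal_plus ennreal_mult)
    also have "\<dots> \<le> ennreal (exp (C * (s + s powr r')))"
    proof (rule ennreal_leI)
      have "1 + s * (exp c * C0) \<le> exp (s * (exp c * C0))" by (rule exp_ge_add_one_self)
      also have "s * (exp c * C0) \<le> s * C" using s c lnC0 by (intro mult_left_mono) (auto simp: C_def)
      also have "\<dots> \<le> C * (s + s powr r')" using s C by (simp add: algebra_simps)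
      finally show "1 + s * (exp c * C0) \<le> exp (C * (s + s powr r'))" by simp
    qed
    finally show ?thesis .
  qed
  then show ?thesis using C unfolding r'_def by blast
qed

end

section \<open>Expected passage times and the time constant\<close>

lemma path_time_measurable:
  assumes "\<And>e. e \<in> lattice_edges \<Longrightarrow> X e \<in> borel_measurable N" "\<gamma> \<in> lattice_paths v w"
  shows "(\<lambda>\<omega>. path_time (\<lambda>e. X e \<omega>) \<gamma>) \<in> borel_measurable N"
  unfolding path_time_def using assms lattice_paths_edges by (intro borel_measurable_sum) blast

text \<open>Finite lists of lattice points form a countable set, so the infimum over paths is a
  countable one.\<close>

lemma passage_measurable:
  assumes "\<And>e. e \<in> lattice_edges \<Longrightarrow> X e \<in> borel_measurable N"
  shows "(\<lambda>\<omega>. passage (\<lambda>e. X e \<omega>) v w) \<in> borel_measurable N"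
  unfolding passage_def
  by (intro borel_measurable_cINF_real path_time_measurable[where v = v and w = w] assms) auto

lemma floor_vec_zero [simp]: "floor_vec 0 = 0"
  by (simp add: floor_vec_def vec_eq_iff)

lemma l1_floor_vec_add:
  "l1_norm (floor_vec (x + y) - floor_vec x - floor_vec y :: int ^ 'd::finite) \<le> int CARD('d)"
proof -
  have "l1_norm (floor_vec (x + y) - floor_vec x - floor_vec y :: int ^ 'd) \<le> (\<Sum>i\<in>(UNIV::'d set). 1)"
    unfolding l1_norm_def
  proof (rule sum_mono)
    fix i
    have "\<bar>\<lfloor>x $ i + y $ i\<rfloor> - \<lfloor>x $ i\<rfloor> - \<lfloor>y $ i\<rfloor>\<bar> \<le> 1" by linarith
    then show "\<bar>(floor_vec (x + y) - floor_vec x - floor_vec y) $ i\<bar> \<le> 1"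
      by (simp add: floor_vec_def)
  qed
  then show ?thesis by simp
qed

lemma l1_floor_vec_le:
  fixes x :: "real ^ 'd::finite"
  assumes "s \<ge> 0"
  shows "real_of_int (l1_norm (floor_vec (s *\<^sub>R x))) \<le> ((\<Sum>i\<in>UNIV. \<bar>x $ i\<bar>) + real CARD('d)) * (s + 1)"
proof -
  have "real_of_int (l1_norm (floor_vec (s *\<^sub>R x))) = (\<Sum>i\<in>UNIV. real_of_int \<bar>\<lfloor>s * x $ i\<rfloor>\<bar>)"
    by (simp add: l1_norm_def floor_vec_def)
  also have "\<dots> \<le> (\<Sum>i\<in>UNIV. s * \<bar>x $ i\<bar> + 1)"
  proof (rule sum_mono)
    fix i
    have "real_of_int \<bar>\<lfloor>s * x $ i\<rfloor>\<bar> \<le> \<bar>s * x $ i\<bar> + 1" by linarith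
    then show "real_of_int \<bar>\<lfloor>s * x $ i\<rfloor>\<bar> \<le> s * \<bar>x $ i\<bar> + 1" using assms by (simp add: abs_mult)
  qed
  also have "\<dots> = s * (\<Sum>i\<in>UNIV. \<bar>x $ i\<bar>) + real CARD('d)" by (simp add: sum.distrib sum_distrib_left)
  also have "\<dots> \<le> ((\<Sum>i\<in>UNIV. \<bar>x $ i\<bar>) + real CARD('d)) * (s + 1)"
    using assms by (simp add: algebra_simps sum_nonneg)
  finally show ?thesis .
qed

lemma floor_vec_far:
  fixes x :: "real ^ 'd::finite"
  assumes "x \<noteq> 0"
  shows "\<forall>\<^sub>F n in sequentially. linf_norm (floor_vec (real n *\<^sub>R x)) > int k"
proof -
  obtain i where i: "x $ i \<noteq> 0" using assms by (auto simp: vec_eq_iff)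
  have "\<forall>\<^sub>F n in sequentially. real n \<ge> (real k + 2) / \<bar>x $ i\<bar>"
    by (rule eventually_sequentiallyI[of "nat \<lceil>(real k + 2) / \<bar>x $ i\<bar>\<rceil>"]) linarith
  then show ?thesis
  proof eventually_elim
    case (elim n)
    then have "real k + 2 \<le> \<bar>real n * x $ i\<bar>" using i by (simp add: field_simps abs_mult)
    then have "int k < \<bar>\<lfloor>real n * x $ i\<rfloor>\<bar>" by linarith
    also have "\<dots> = \<bar>floor_vec (real n *\<^sub>R x) $ i\<bar>" by (simp add: floor_vec_def)
    also have "\<dots> \<le> linf_norm (floor_vec (real n *\<^sub>R x))" by (rule linf_norm_ge)
    finally show ?case .
  qed
qed

lemma inj_image_add: "inj ((`) ((+) (a :: 'b::group_add)))"
  by (intro injI) (simp add: inj_image_eq_iff)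

lemma shift_lattice_edges: "e \<in> lattice_edges \<Longrightarrow> (+) a ` e \<in> lattice_edges"
  unfolding lattice_edges_def by (auto, metis nearest_neighbors_add)

context percolation
begin

section \<open>Translation invariance and insertion of prescribed large weights\<close>

lemma restrict_\<tau>_measurable:
  "(\<lambda>\<omega>. \<lambda>e\<in>lattice_edges. \<tau> e \<omega>) \<in> measurable M (PiM lattice_edges (\<lambda>_. borel))"
  by (intro measurable_restrict \<tau>_measurable)

lemma restrict_shift_measurable:
  "(\<lambda>\<omega>. \<lambda>e\<in>lattice_edges. \<tau> ((+) a ` e) \<omega>) \<in> measurable M (PiM lattice_edges (\<lambda>_. borel))"
  by (intro measurable_restrict \<tau>_measurable shift_lattice_edges)

lemma distr_shift:
  "distr M (PiM lattice_edges (\<lambda>_. borel)) (\<lambda>\<omega>. \<lambda>e\<in>lattice_edges. \<tau> ((+) a ` e) \<omega>)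
   = distr M (PiM lattice_edges (\<lambda>_. borel)) (\<lambda>\<omega>. \<lambda>e\<in>lattice_edges. \<tau> e \<omega>)"
proof (rule distr_reindex[OF subset_refl])
  show "(lattice_edges :: 'd edge set) \<noteq> {}"
    using lattice_edgesI[OF nearest_neighbors_axis[of 1 0 undefined]] by auto
qed (auto intro: inj_on_subset[OF inj_image_add] shift_lattice_edges)

definition T :: "'d vertex \<Rightarrow> 'd vertex \<Rightarrow> 'a \<Rightarrow> real" where
  "T v w \<omega> = passage (\<lambda>e. \<tau> e \<omega>) v w"

lemma T_measurable [measurable]: "T v w \<in> borel_measurable M"
  unfolding T_def[abs_def] by (rule passage_measurable) measurable

lemma T_nonneg: "\<omega> \<in> space M \<Longrightarrow> 0 \<le> T v w \<omega>"
  unfolding T_def by (intro passage_nonneg weights_\<tau>)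

lemma T_triangle: "\<omega> \<in> space M \<Longrightarrow> T v w \<omega> \<le> T v u \<omega> + T u w \<omega>"
  unfolding T_def by (intro passage_triangle weights_\<tau>)

lemma first_passage_T: "first_passage_time (\<lambda>e. \<tau> e \<omega>) 0 y = T 0 (floor_vec y) \<omega>"
  by (simp add: first_passage_time_passage T_def)

text \<open>Forcing large values on finitely many edges costs the product of the lower tail bounds,
  whose exponent is the energy. Independence keeps this cost separate from any event G that looks
  only at the remaining edges.\<close>

lemma product_lower_bound:
  assumes F: "finite F" "F \<subseteq> lattice_edges" and a: "\<And>e. e \<in> F \<Longrightarrow> a e \<ge> 0"
    and G [measurable]: "Measurable.pred (PiM (lattice_edges - F) (\<lambda>_. borel)) G"
  shows "prob {\<omega>\<in>space M. (\<forall>e\<in>F. \<tau> e \<omega> > a e) \<and> G (\<lambda>e\<in>lattice_edges - F. \<tau> e \<omega>)}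
    \<ge> \<beta>\<^sub>1 ^ card F * exp (- \<alpha> * (\<Sum>e\<in>F. a e powr r))
       * prob {\<omega>\<in>space M. G (\<lambda>e\<in>lattice_edges - F. \<tau> e \<omega>)}"
proof -
  \<comment> \<open>\<open>None\<close> indexes the infinite block of edges outside F, and
    \<open>Some e\<close> the single edge e, so that one product formula treats both.\<close>
  define J where "J = insert None (Some ` F)"
  define B where "B j = (case j of None \<Rightarrow> lattice_edges - F | Some e \<Rightarrow> {e})" for j
  define g where "g j t = (case j of None \<Rightarrow> (if G t then 1 else (0 :: ennreal))
     | Some e \<Rightarrow> (if t e > a e then 1 else 0))" for j and t :: "'d edge \<Rightarrow> real"
  have [measurable]: "e \<in> F \<Longrightarrow> \<tau> e \<in> borel_measurable M" for e using F by auto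
  have restr [measurable]: "(\<lambda>\<omega>. \<lambda>e\<in>lattice_edges - F. \<tau> e \<omega>) \<in> measurable M (PiM (lattice_edges - F) (\<lambda>_. borel))"
    by (rule measurable_restrict) auto
  have evF: "{\<omega>\<in>space M. \<forall>e\<in>F. \<tau> e \<omega> > a e} \<in> sets M"
    using F(1) by measurable
  have GM [measurable]: "Measurable.pred M (\<lambda>\<omega>. G (\<lambda>e\<in>lattice_edges - F. \<tau> e \<omega>))"
    by (rule measurable_compose[OF restr G])
  have g: "g j \<in> borel_measurable (PiM (B j) (\<lambda>_. borel))" if "j \<in> J" for j
  proof (cases j)
    case None
    then show ?thesis unfolding g_def[abs_def] B_def by simp
  next
    case (Some e)
    have "(\<lambda>t. t e) \<in> borel_measurable (PiM {e} (\<lambda>_. borel :: real measure))"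
      by (rule measurable_component_singleton) simp
    then show ?thesis unfolding g_def[abs_def] B_def Some by simp
  qed
  have ennreal_product: "A = B * C"
    if "ennreal A = ennreal B * ennreal C" "0 \<le> A" "0 \<le> B" "0 \<le> C" for A B C
    using that by (simp add: ennreal_mult'[symmetric])
  have "ennreal (prob {\<omega>\<in>space M. (\<forall>e\<in>F. \<tau> e \<omega> > a e) \<and> G (\<lambda>e\<in>lattice_edges - F. \<tau> e \<omega>)})
     = (\<integral>\<^sup>+\<omega>. indicator {\<omega>\<in>space M. (\<forall>e\<in>F. \<tau> e \<omega> > a e) \<and> G (\<lambda>e\<in>lattice_edges - F. \<tau> e \<omega>)} \<omega> \<partial>M)"
    using evF GM by (subst nn_integral_indicator) (auto simp: emeasure_eq_measure)
  also have "\<dots> = (\<integral>\<^sup>+\<omega>. (\<Prod>j\<in>J. g j (\<lambda>e\<in>B j. \<tau> e \<omega>)) \<partial>M)"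
  proof (rule nn_integral_cong)
    fix \<omega> assume w: "\<omega> \<in> space M"
    have "(\<Prod>j\<in>J. g j (\<lambda>e\<in>B j. \<tau> e \<omega>)) = (if G (\<lambda>e\<in>lattice_edges - F. \<tau> e \<omega>) then 1 else 0)
        * (\<Prod>e\<in>F. if \<tau> e \<omega> > a e then 1 else 0)"
      unfolding J_def using F(1) by (simp add: prod.reindex g_def B_def)
    also have "(\<Prod>e\<in>F. if \<tau> e \<omega> > a e then 1 else (0::ennreal)) = (if \<forall>e\<in>F. \<tau> e \<omega> > a e then 1 else 0)"
      using F(1) by (auto simp: prod_zero_iff)
    finally have eqP: "(\<Prod>j\<in>J. g j (\<lambda>e\<in>B j. \<tau> e \<omega>)) = (if G (\<lambda>e\<in>lattice_edges - F. \<tau> e \<omega>) then 1 else 0)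
        * (if \<forall>e\<in>F. \<tau> e \<omega> > a e then 1 else 0)" .
    show "indicator {\<omega>\<in>space M. (\<forall>e\<in>F. \<tau> e \<omega> > a e) \<and> G (\<lambda>e\<in>lattice_edges - F. \<tau> e \<omega>)} \<omega>
      = (\<Prod>j\<in>J. g j (\<lambda>e\<in>B j. \<tau> e \<omega>))"
      unfolding eqP using w by (auto simp: indicator_def)
  qed
  also have "\<dots> = (\<Prod>j\<in>J. \<integral>\<^sup>+\<omega>. g j (\<lambda>e\<in>B j. \<tau> e \<omega>) \<partial>M)"
    by (rule nn_integral_blocks[OF _ _ _ g])
      (use F in \<open>auto simp: J_def B_def disjoint_family_on_def\<close>)
  also have "\<dots> = (\<integral>\<^sup>+\<omega>. g None (\<lambda>e\<in>B None. \<tau> e \<omega>) \<partial>M)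
      * (\<Prod>e\<in>F. \<integral>\<^sup>+\<omega>. g (Some e) (\<lambda>i\<in>B (Some e). \<tau> i \<omega>) \<partial>M)"
    unfolding J_def using F(1) by (simp add: prod.reindex)
  also have "(\<integral>\<^sup>+\<omega>. g None (\<lambda>e\<in>B None. \<tau> e \<omega>) \<partial>M)
      = (\<integral>\<^sup>+\<omega>. indicator {\<omega>\<in>space M. G (\<lambda>e\<in>lattice_edges - F. \<tau> e \<omega>)} \<omega> \<partial>M)"
    by (intro nn_integral_cong) (auto simp: g_def B_def)
  also have "\<dots> = ennreal (prob {\<omega>\<in>space M. G (\<lambda>e\<in>lattice_edges - F. \<tau> e \<omega>)})"
    by (subst nn_integral_indicator) (auto simp: emeasure_eq_measure)
  also have "(\<Prod>e\<in>F. \<integral>\<^sup>+\<omega>. g (Some e) (\<lambda>i\<in>B (Some e). \<tau> i \<omega>) \<partial>M)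
      = (\<Prod>e\<in>F. ennreal (\<P>(\<omega> in M. \<tau> e \<omega> > a e)))"
  proof (intro prod.cong refl)
    fix e assume e: "e \<in> F"
    have "(\<integral>\<^sup>+\<omega>. g (Some e) (\<lambda>i\<in>B (Some e). \<tau> i \<omega>) \<partial>M) = (\<integral>\<^sup>+\<omega>. indicator {\<omega>\<in>space M. \<tau> e \<omega> > a e} \<omega> \<partial>M)"
      by (intro nn_integral_cong) (auto simp: g_def B_def)
    also have "\<dots> = ennreal (\<P>(\<omega> in M. \<tau> e \<omega> > a e))"
      using e by (subst nn_integral_indicator) (auto simp: emeasure_eq_measure)
    finally show "(\<integral>\<^sup>+\<omega>. g (Some e) (\<lambda>i\<in>B (Some e). \<tau> i \<omega>) \<partial>M) = ennreal (\<P>(\<omega> in M. \<tau> e \<omega> > a e))" .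
  qed
  also have "\<dots> = ennreal (\<Prod>e\<in>F. \<P>(\<omega> in M. \<tau> e \<omega> > a e))" by (simp add: prod_ennreal)
  finally have eq: "prob {\<omega>\<in>space M. (\<forall>e\<in>F. \<tau> e \<omega> > a e) \<and> G (\<lambda>e\<in>lattice_edges - F. \<tau> e \<omega>)}
     = prob {\<omega>\<in>space M. G (\<lambda>e\<in>lattice_edges - F. \<tau> e \<omega>)} * (\<Prod>e\<in>F. \<P>(\<omega> in M. \<tau> e \<omega> > a e))"
    by (rule ennreal_product) (auto intro: prod_nonneg)
  have "\<beta>\<^sub>1 ^ card F * exp (- \<alpha> * (\<Sum>e\<in>F. a e powr r)) = (\<Prod>e\<in>F. \<beta>\<^sub>1 * exp (- \<alpha> * a e powr r))"
    using F(1) by (simp add: prod.distrib exp_sum sum_distrib_left sum_negf[symmetric])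
  also have "\<dots> \<le> (\<Prod>e\<in>F. \<P>(\<omega> in M. \<tau> e \<omega> > a e))"
    using F(2) a tail \<beta>\<^sub>1 by (intro prod_mono) (auto intro: less_imp_le)
  finally show ?thesis unfolding eq by (subst mult.commute) (intro mult_left_mono, auto)
qed

end

section \<open>Moments of passage times and existence of the time constant\<close>

locale percolation_superlinear = percolation M \<tau> \<beta>\<^sub>1 \<beta>\<^sub>2 \<alpha> r
  for M :: "'a measure" and \<tau> :: "'d::finite edge \<Rightarrow> 'a \<Rightarrow> real" and \<beta>\<^sub>1 \<beta>\<^sub>2 \<alpha> r :: real +
  assumes r1: "r > 1"
begin

lemma moments:
  "\<exists>c\<ge>0. \<forall>e\<in>lattice_edges. integrable M (\<tau> e) \<and> integrable M (\<lambda>\<omega>. (\<tau> e \<omega>)\<^sup>2)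
     \<and> expectation (\<tau> e) \<le> c \<and> expectation (\<lambda>\<omega>. (\<tau> e \<omega>)\<^sup>2) \<le> c"
proof -
  obtain C where C: "C \<ge> 0" "\<And>e s. e \<in> lattice_edges \<Longrightarrow> s \<ge> 0 \<Longrightarrow>
    (\<integral>\<^sup>+\<omega>. ennreal (exp (s * \<tau> e \<omega>)) \<partial>M) \<le> ennreal (exp (C * (s + s powr (r / (r - 1)))))"
    using laplace_bound[OF r1] by blast
  define c where "c = exp (C * 2)"
  have "integrable M (\<tau> e) \<and> integrable M (\<lambda>\<omega>. (\<tau> e \<omega>)\<^sup>2)
     \<and> expectation (\<tau> e) \<le> 2 * c \<and> expectation (\<lambda>\<omega>. (\<tau> e \<omega>)\<^sup>2) \<le> 2 * c" if e: "e \<in> lattice_edges" for e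
  proof -
    note [measurable] = \<tau>_measurable[OF e]
    have le: "(\<integral>\<^sup>+\<omega>. ennreal (exp (\<tau> e \<omega>)) \<partial>M) \<le> ennreal c"
      using C(2)[OF e, of 1] by (simp add: c_def)
    then have fin: "(\<integral>\<^sup>+\<omega>. ennreal (exp (\<tau> e \<omega>)) \<partial>M) < \<infinity>" by (rule le_less_trans) simp
    then have int: "integrable M (\<lambda>\<omega>. exp (\<tau> e \<omega>))"
      by (intro integrableI_nonneg) auto
    have Ec: "expectation (\<lambda>\<omega>. exp (\<tau> e \<omega>)) \<le> c"
      using le by (subst (asm) nn_integral_eq_integral[OF int]) (auto simp: c_def)
    have bd: "\<tau> e \<omega> \<le> 2 * exp (\<tau> e \<omega>)" "(\<tau> e \<omega>)\<^sup>2 \<le> 2 * exp (\<tau> e \<omega>)" if "\<omega> \<in> space M" for \<omega>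
      using exp_lower_Taylor_quadratic[OF nonneg[OF e that]] nonneg[OF e that]
        zero_le_power2[of "\<tau> e \<omega>"] by linarith+
    have 1: "integrable M (\<tau> e)"
      by (rule Bochner_Integration.integrable_bound[of _ "\<lambda>\<omega>. 2 * exp (\<tau> e \<omega>)"])
        (use int bd nonneg[OF e] in auto)
    have 2: "integrable M (\<lambda>\<omega>. (\<tau> e \<omega>)\<^sup>2)"
      by (rule Bochner_Integration.integrable_bound[of _ "\<lambda>\<omega>. 2 * exp (\<tau> e \<omega>)"])
        (use int bd in auto)
    have "expectation (\<tau> e) \<le> expectation (\<lambda>\<omega>. 2 * exp (\<tau> e \<omega>))"
      using int bd by (intro integral_mono 1) auto
    moreover have "expectation (\<lambda>\<omega>. (\<tau> e \<omega>)\<^sup>2) \<le> expectation (\<lambda>\<omega>. 2 * exp (\<tau> e \<omega>))"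
      using int bd by (intro integral_mono 2) auto
    moreover have "expectation (\<lambda>\<omega>. 2 * exp (\<tau> e \<omega>)) \<le> 2 * c" using Ec by simp
    ultimately show ?thesis using 1 2 by auto
  qed
  then show ?thesis by (intro exI[of _ "2 * c"]) (auto simp: c_def)
qed

definition c1 :: real where
  "c1 = (SOME c. c \<ge> 0 \<and> (\<forall>e\<in>lattice_edges. integrable M (\<tau> e) \<and> integrable M (\<lambda>\<omega>. (\<tau> e \<omega>)\<^sup>2)
     \<and> expectation (\<tau> e) \<le> c \<and> expectation (\<lambda>\<omega>. (\<tau> e \<omega>)\<^sup>2) \<le> c))"

lemma c1: "c1 \<ge> 0" "e \<in> lattice_edges \<Longrightarrow> integrable M (\<tau> e)"
  "e \<in> lattice_edges \<Longrightarrow> integrable M (\<lambda>\<omega>. (\<tau> e \<omega>)\<^sup>2)"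
  "e \<in> lattice_edges \<Longrightarrow> expectation (\<tau> e) \<le> c1"
  "e \<in> lattice_edges \<Longrightarrow> expectation (\<lambda>\<omega>. (\<tau> e \<omega>)\<^sup>2) \<le> c1"
  using someI_ex[OF moments] unfolding c1_def[symmetric] by auto

text \<open>A shortest lattice path dominates the infimum; for the square, Cauchy-Schwarz along this
  path gives the quadratic growth.\<close>

lemma T_moments:
  "integrable M (T v w)" "expectation (T v w) \<le> c1 * real_of_int (l1_norm (w - v))"
  "integrable M (\<lambda>\<omega>. (T v w \<omega>)\<^sup>2)" "expectation (\<lambda>\<omega>. (T v w \<omega>)\<^sup>2) \<le> c1 * (real_of_int (l1_norm (w - v)))\<^sup>2"
proof -
  obtain \<gamma> where \<gamma>: "\<gamma> \<in> lattice_paths v w" "length \<gamma> = Suc (nat (l1_norm (w - v)))"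
    using short_lattice_path by blast
  define P where "P = path_edges \<gamma>"
  define l where "l = real_of_int (l1_norm (w - v))"
  have P: "finite P" "P \<subseteq> lattice_edges"
    unfolding P_def using finite_path_edges lattice_paths_edges[OF \<gamma>(1)] by auto
  have card: "real (card P) \<le> l"
    using card_path_edges[of \<gamma>] \<gamma>(2) l1_norm_nonneg[of "w - v"] unfolding P_def l_def by linarith
  have le: "T v w \<omega> \<le> (\<Sum>e\<in>P. \<tau> e \<omega>)" if "\<omega> \<in> space M" for \<omega>
    using passage_le[OF weights_\<tau>[OF that] \<gamma>(1)] unfolding T_def path_time_def P_def .
  have int1: "integrable M (\<lambda>\<omega>. \<Sum>e\<in>P. \<tau> e \<omega>)"
    using P by (intro Bochner_Integration.integrable_sum c1) auto
  have int2: "integrable M (\<lambda>\<omega>. real (card P) * (\<Sum>e\<in>P. (\<tau> e \<omega>)\<^sup>2))"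
    using P by (intro integrable_mult_right Bochner_Integration.integrable_sum c1) auto
  have le2: "(T v w \<omega>)\<^sup>2 \<le> real (card P) * (\<Sum>e\<in>P. (\<tau> e \<omega>)\<^sup>2)" if "\<omega> \<in> space M" for \<omega>
  proof -
    have "(T v w \<omega>)\<^sup>2 \<le> (\<Sum>e\<in>P. \<tau> e \<omega>)\<^sup>2" by (intro power_mono le that T_nonneg)
    also have "\<dots> \<le> real (card P) * (\<Sum>e\<in>P. (\<tau> e \<omega>)\<^sup>2)"
      using sum_squared_le_sum_of_squares[of "\<lambda>e. \<tau> e \<omega>" P] P by (simp add: mult.commute)
    finally show ?thesis .
  qed
  show 1: "integrable M (T v w)"
  proof (rule Bochner_Integration.integrable_bound[OF int1])
    show "AE \<omega> in M. norm (T v w \<omega>) \<le> norm (\<Sum>e\<in>P. \<tau> e \<omega>)"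
    proof (rule AE_I2)
      fix \<omega> assume "\<omega> \<in> space M"
      from le[OF this] T_nonneg[OF this, of v w] show "norm (T v w \<omega>) \<le> norm (\<Sum>e\<in>P. \<tau> e \<omega>)" by simp
    qed
  qed simp
  show 2: "integrable M (\<lambda>\<omega>. (T v w \<omega>)\<^sup>2)"
  proof (rule Bochner_Integration.integrable_bound[OF int2])
    show "AE \<omega> in M. norm ((T v w \<omega>)\<^sup>2) \<le> norm (real (card P) * (\<Sum>e\<in>P. (\<tau> e \<omega>)\<^sup>2))"
    proof (rule AE_I2)
      fix \<omega> assume "\<omega> \<in> space M"
      from le2[OF this] show "norm ((T v w \<omega>)\<^sup>2) \<le> norm (real (card P) * (\<Sum>e\<in>P. (\<tau> e \<omega>)\<^sup>2))"
        using zero_le_power2[of "T v w \<omega>"] by simp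
    qed
  qed simp
  have "expectation (T v w) \<le> expectation (\<lambda>\<omega>. \<Sum>e\<in>P. \<tau> e \<omega>)"
    by (intro integral_mono 1 int1 le)
  also have "\<dots> = (\<Sum>e\<in>P. expectation (\<tau> e))"
    using P by (intro Bochner_Integration.integral_sum c1) auto
  also have "\<dots> \<le> (\<Sum>e\<in>P. c1)" using P by (intro sum_mono c1) auto
  also have "\<dots> \<le> c1 * l" using mult_right_mono[OF card c1(1)] by (simp add: mult.commute)
  finally show "expectation (T v w) \<le> c1 * real_of_int (l1_norm (w - v))" by (simp add: l_def)
  have "expectation (\<lambda>\<omega>. (T v w \<omega>)\<^sup>2) \<le> expectation (\<lambda>\<omega>. real (card P) * (\<Sum>e\<in>P. (\<tau> e \<omega>)\<^sup>2))"
    by (intro integral_mono 2 int2 le2)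
  also have "\<dots> = real (card P) * (\<Sum>e\<in>P. expectation (\<lambda>\<omega>. (\<tau> e \<omega>)\<^sup>2))"
    using P by (subst integral_mult_right_zero, subst Bochner_Integration.integral_sum) (auto intro: c1)
  also have "\<dots> \<le> real (card P) * (\<Sum>e\<in>P. c1)" using P by (intro mult_left_mono sum_mono c1) auto
  also have "\<dots> = c1 * (real (card P))\<^sup>2" by (simp add: power2_eq_square)
  also have "\<dots> \<le> c1 * l\<^sup>2" using card c1(1) by (intro mult_left_mono power_mono) auto
  finally show "expectation (\<lambda>\<omega>. (T v w \<omega>)\<^sup>2) \<le> c1 * (real_of_int (l1_norm (w - v)))\<^sup>2" by (simp add: l_def)
qed

lemma shift_invariant_expectation:
  assumes [measurable]: "G \<in> borel_measurable (PiM lattice_edges (\<lambda>_. borel))"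
  shows "expectation (\<lambda>\<omega>. G (\<lambda>e\<in>lattice_edges. \<tau> ((+) a ` e) \<omega>))
     = (expectation (\<lambda>\<omega>. G (\<lambda>e\<in>lattice_edges. \<tau> e \<omega>)) :: real)"
  using arg_cong[OF distr_shift, of "\<lambda>N. integral\<^sup>L N G" a]
  by (simp add: integral_distr restrict_shift_measurable restrict_\<tau>_measurable)

lemma expectation_T_shift: "expectation (T a (a + z)) = expectation (T 0 z)"
proof -
  have m: "(\<lambda>t. passage t 0 z) \<in> borel_measurable (PiM lattice_edges (\<lambda>_. borel))"
    by (rule passage_measurable) (rule measurable_component_singleton)
  have "T a (a + z) \<omega> = passage (\<lambda>e\<in>lattice_edges. \<tau> ((+) a ` e) \<omega>) 0 z" for \<omega>
  proof -
    have "T a (a + z) \<omega> = passage (\<lambda>e. \<tau> ((+) a ` e) \<omega>) 0 z"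
      using passage_shift[of "\<lambda>e. \<tau> e \<omega>" a 0 z] by (simp add: T_def)
    also have "\<dots> = passage (\<lambda>e\<in>lattice_edges. \<tau> ((+) a ` e) \<omega>) 0 z" by (intro passage_cong) simp
    finally show ?thesis .
  qed
  moreover have "T 0 z \<omega> = passage (\<lambda>e\<in>lattice_edges. \<tau> e \<omega>) 0 z" for \<omega>
    unfolding T_def by (intro passage_cong) simp
  ultimately have "T a (a + z) = (\<lambda>\<omega>. passage (\<lambda>e\<in>lattice_edges. \<tau> ((+) a ` e) \<omega>) 0 z)"
    "T 0 z = (\<lambda>\<omega>. passage (\<lambda>e\<in>lattice_edges. \<tau> e \<omega>) 0 z)" by auto
  then show ?thesis using shift_invariant_expectation[OF m, of a] by (simp only:)
qed

definition mean_T :: "'d vertex \<Rightarrow> real" where "mean_T z = expectation (T 0 z)"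

lemma mean_T_nonneg: "mean_T z \<ge> 0"
  unfolding mean_T_def by (intro Bochner_Integration.integral_nonneg T_nonneg)

lemma mean_T_le: "mean_T z \<le> c1 * real_of_int (l1_norm z)"
  unfolding mean_T_def using T_moments(2)[of 0 z] by simp

lemma mean_T_add: "mean_T (a + z) \<le> mean_T a + mean_T z"
proof -
  have "mean_T (a + z) \<le> expectation (\<lambda>\<omega>. T 0 a \<omega> + T a (a + z) \<omega>)"
    unfolding mean_T_def
    by (intro integral_mono Bochner_Integration.integrable_add T_moments(1) T_triangle)
  also have "\<dots> = mean_T a + mean_T z"
    unfolding mean_T_def
    by (simp add: T_moments(1) expectation_T_shift)
  finally show ?thesis .
qed

lemma mean_T_diff: "mean_T w \<le> mean_T z + c1 * real_of_int (l1_norm (w - z))"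
  using mean_T_add[of z "w - z"] mean_T_le[of "w - z"] by simp

text \<open>\<open>Lim\<close> has the intended meaning only after a limit is shown to exist. Floors
  break additivity of the endpoints by at most one unit per coordinate, which is the additive error
  allowed in \<open>subadditive_limit_real\<close>.\<close>

lemma time_constant_limit:
  "((\<lambda>s::real. mean_T (floor_vec (s *\<^sub>R x)) / s) \<longlongrightarrow> time_constant M \<tau> x) at_top"
proof -
  define A where "A = (\<Sum>i\<in>UNIV. \<bar>x $ i\<bar>) + real CARD('d)"
  have A: "A \<ge> real CARD('d)" unfolding A_def by (simp add: sum_nonneg)
  have "\<exists>L. ((\<lambda>s::real. mean_T (floor_vec (s *\<^sub>R x)) / s) \<longlongrightarrow> L) at_top"
  proof (rule subadditive_limit_real[where c = "c1 * A"])
    fix s t :: real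
    let ?a = "floor_vec (s *\<^sub>R x)" and ?b = "floor_vec (t *\<^sub>R x)" and ?c = "floor_vec ((s + t) *\<^sub>R x)"
    have "mean_T ?c \<le> mean_T (?a + ?b) + c1 * real_of_int (l1_norm (?c - (?a + ?b)))" by (rule mean_T_diff)
    also have "?c - (?a + ?b) = floor_vec (s *\<^sub>R x + t *\<^sub>R x) - ?a - ?b"
      by (simp add: scaleR_add_left algebra_simps)
    also have "c1 * real_of_int (l1_norm \<dots>) \<le> c1 * real CARD('d)"
      using l1_floor_vec_add[of "s *\<^sub>R x" "t *\<^sub>R x"] c1(1)
      by (intro mult_left_mono) (metis of_int_le_iff of_int_of_nat_eq, simp)
    also have "\<dots> \<le> c1 * A" using A c1(1) by (intro mult_left_mono)
    finally show "mean_T ?c \<le> mean_T ?a + mean_T ?b + c1 * A" using mean_T_add[of ?a ?b] by simp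
  next
    fix s :: real assume s: "s \<ge> 0"
    have "mean_T (floor_vec (s *\<^sub>R x)) \<le> c1 * real_of_int (l1_norm (floor_vec (s *\<^sub>R x)))" by (rule mean_T_le)
    also have "\<dots> \<le> c1 * (A * (s + 1))"
      using l1_floor_vec_le[OF s, of x] c1(1) unfolding A_def by (intro mult_left_mono)
    finally show "mean_T (floor_vec (s *\<^sub>R x)) \<le> c1 * A * (s + 1)" by simp
  qed (rule mean_T_nonneg)
  then obtain L where L: "((\<lambda>s::real. mean_T (floor_vec (s *\<^sub>R x)) / s) \<longlongrightarrow> L) at_top" ..
  have "time_constant M \<tau> x = L"
    unfolding time_constant_def first_passage_T mean_T_def[symmetric]
    by (rule tendsto_Lim[OF _ L]) simp
  with L show ?thesis by simp
qed

lemma time_constant_limit_nat: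
  "(\<lambda>n. mean_T (floor_vec (real n *\<^sub>R x)) / real n) \<longlonglongrightarrow> time_constant M \<tau> x"
  by (rule filterlim_compose[OF time_constant_limit filterlim_real_sequentially])

end

section \<open>Lower bounds for the upper tail\<close>

context percolation
begin

text \<open>Meant for r \<ge> d. There a trap may carry the whole passage time and not just the
  excess over the time constant, as its energy can be made small at every depth.\<close>

lemma lower_deviation_one_trap:
  fixes x :: "real ^ 'd" and f :: "'d edge \<Rightarrow> real"
  assumes f: "blocking K f" and s: "s > 0" and x: "x \<noteq> 0"
  shows "\<forall>\<^sub>F n in sequentially. prob {\<omega>\<in>space M. T 0 (floor_vec (real n *\<^sub>R x)) \<omega> \<ge> s * real n}
    \<ge> \<beta>\<^sub>1 ^ card (box_edges (real K) :: 'd edge set) * exp (- \<alpha> * (energy r K f * (s * real n) powr r))"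
  using floor_vec_far[OF x, of K]
proof eventually_elim
  case (elim n)
  let ?B = "box_edges (real K) :: 'd edge set"
  let ?A = "{\<omega>\<in>space M. (\<forall>e\<in>?B. \<tau> e \<omega> > s * real n * f e) \<and> True}"
  have f0: "f e \<ge> 0" for e using f by (auto simp: blocking_def)
  have "(\<Sum>e\<in>?B. (s * real n * f e) powr r) = energy r K f * (s * real n) powr r"
    unfolding energy_def sum_distrib_right using f0 s by (intro sum.cong) (auto simp: powr_mult)
  then have "\<beta>\<^sub>1 ^ card ?B * exp (- \<alpha> * (energy r K f * (s * real n) powr r)) \<le> prob ?A"
    using product_lower_bound[OF finite_box_edges box_edges_lattice, of "real K" "\<lambda>e. s * real n * f e" "\<lambda>_. True"]
      f0 s by (simp add: prob_space)
  also have "\<dots> \<le> prob {\<omega>\<in>space M. T 0 (floor_vec (real n *\<^sub>R x)) \<omega> \<ge> s * real n}"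
  proof (rule finite_measure_mono)
    show "?A \<subseteq> {\<omega>\<in>space M. T 0 (floor_vec (real n *\<^sub>R x)) \<omega> \<ge> s * real n}"
    proof
      fix \<omega> assume w: "\<omega> \<in> ?A"
      then have "T 0 (floor_vec (real n *\<^sub>R x)) \<omega> \<ge> s * real n"
        unfolding T_def using s elim
        by (intro blocking_passage_ge[OF f weights_\<tau>]) (auto intro: less_imp_le)
      with w show "\<omega> \<in> {\<omega>\<in>space M. T 0 (floor_vec (real n *\<^sub>R x)) \<omega> \<ge> s * real n}" by simp
    qed
  qed measurable
  finally show ?case .
qed

lemma nn_integral_reindexed_edges:
  fixes g :: "'j \<Rightarrow> real \<Rightarrow> ennreal"
  assumes J: "finite J" "inj_on \<phi> J" "\<phi> ` J \<subseteq> lattice_edges" and g: "\<And>j. j \<in> J \<Longrightarrow> g j \<in> borel_measurable borel"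
  shows "(\<integral>\<^sup>+\<omega>. (\<Prod>j\<in>J. g j (\<tau> (\<phi> j) \<omega>)) \<partial>M) = (\<Prod>j\<in>J. \<integral>\<^sup>+\<omega>. g j (\<tau> (\<phi> j) \<omega>) \<partial>M)"
proof -
  let ?h = "\<lambda>e. g (inv_into J \<phi> e)"
  have "(\<integral>\<^sup>+\<omega>. (\<Prod>e\<in>\<phi> ` J. ?h e (\<tau> e \<omega>)) \<partial>M) = (\<Prod>e\<in>\<phi> ` J. \<integral>\<^sup>+\<omega>. ?h e (\<tau> e \<omega>) \<partial>M)"
    using J g by (intro nn_integral_edges) (auto simp: inv_into_f_f)
  then show ?thesis
    using J(2) by (simp add: prod.reindex inv_into_f_f cong: prod.cong)
qed

end

context percolation_superlinear
begin

text \<open>A second moment argument for \<open>Y\<close>, based on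
  \<open>Y \<le> a + L n 1{Y \<ge> a} + Y\<^sup>2 / (L n)\<close>.\<close>

lemma outside_passage_time:
  fixes x :: "real ^ 'd" and K :: nat
  assumes \<delta>: "\<delta> > 0"
  defines "z \<equiv> \<lambda>n. floor_vec (real n *\<^sub>R x)"
  defines "F \<equiv> \<lambda>n. box_edges (real K) \<union> (`) ((+) (z n)) ` box_edges (real K)"
  shows "\<exists>c>0. \<forall>\<^sub>F n in sequentially. prob {\<omega>\<in>space M.
     passage (\<lambda>e. if e \<in> F n then 0 else \<tau> e \<omega>) 0 (z n) \<ge> (time_constant M \<tau> x - \<delta>) * real n} \<ge> c"
proof -
  define \<mu> where "\<mu> = time_constant M \<tau> x"
  define N where "N = real (card (box_edges (real K) :: 'd edge set))"
  define A where "A = ((\<Sum>i\<in>UNIV. \<bar>x $ i\<bar>) + real CARD('d)) * 2"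
  \<comment> \<open>Large enough that the second moment term, at most
    \<open>c1 * A\<^sup>2 / L\<close> times n, uses up only \<delta>/4 of n.\<close>
  define L where "L = 4 * (c1 * A\<^sup>2) / \<delta> + 1"
  have A0: "A \<ge> 0" unfolding A_def by (intro mult_nonneg_nonneg add_nonneg_nonneg sum_nonneg) auto
  have L: "L \<ge> 1" "c1 * A\<^sup>2 / L \<le> \<delta> / 4"
  proof -
    show L1: "L \<ge> 1" using c1(1) \<delta> by (simp add: L_def)
    have "c1 * A\<^sup>2 * 4 / \<delta> \<le> L" by (simp add: L_def mult.commute)
    then show "c1 * A\<^sup>2 / L \<le> \<delta> / 4" using L1 \<delta> by (simp add: field_simps)
  qed
  \<comment> \<open>The value 1 covers a nonpositive threshold, where the event is certain.\<close>
  define c where "c = min 1 (\<delta> / (8 * L))"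
  have c: "c > 0" using L \<delta> by (simp add: c_def)
  have "\<forall>\<^sub>F n in sequentially. mean_T (z n) / real n > \<mu> - \<delta> / 4"
    using time_constant_limit_nat[of x] \<delta> unfolding z_def \<mu>_def by (intro order_tendstoD) auto
  moreover have "\<forall>\<^sub>F n in sequentially. real n \<ge> 8 * N * c1 / \<delta> + 1"
    by (rule eventually_sequentiallyI[of "nat \<lceil>8 * N * c1 / \<delta> + 1\<rceil>"]) linarith
  ultimately have "\<forall>\<^sub>F n in sequentially. prob {\<omega>\<in>space M.
     passage (\<lambda>e. if e \<in> F n then 0 else \<tau> e \<omega>) 0 (z n) \<ge> (\<mu> - \<delta>) * real n} \<ge> c"
  proof eventually_elim
    case (elim n)
    define Y where "Y \<omega> = passage (\<lambda>e. if e \<in> F n then 0 else \<tau> e \<omega>) 0 (z n)" for \<omega>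
    define P where "P = {\<omega>\<in>space M. Y \<omega> \<ge> (\<mu> - \<delta>) * real n}"
    have N0: "N \<ge> 0" by (simp add: N_def)
    have n: "real n \<ge> 1" using elim(2) N0 c1(1) \<delta> by (smt (verit) divide_nonneg_pos mult_nonneg_nonneg)
    have F: "finite (F n)" "F n \<subseteq> lattice_edges"
      unfolding F_def using finite_box_edges
      by (auto intro!: shift_lattice_edges intro: subsetD[OF box_edges_lattice])
    have cardF: "real (card (F n)) \<le> 2 * N"
    proof -
      have "card (F n) \<le> card (box_edges (real K) :: 'd edge set) + card ((`) ((+) (z n)) ` box_edges (real K))"
        unfolding F_def by (rule card_Un_le)
      also have "\<dots> \<le> card (box_edges (real K) :: 'd edge set) + card (box_edges (real K) :: 'd edge set)"
        by (intro add_mono card_image_le finite_box_edges) auto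
      finally show ?thesis unfolding N_def by linarith
    qed
    have [measurable]: "Y \<in> borel_measurable M"
      unfolding Y_def[abs_def] by (rule passage_measurable) (auto intro: \<tau>_measurable)
    have [measurable]: "P \<in> sets M" unfolding P_def by measurable
    have wout: "weights (\<lambda>e. if e \<in> F n then 0 else \<tau> e \<omega>)" if "\<omega> \<in> space M" for \<omega>
      using weights_\<tau>[OF that] by (auto simp: weights_def)
    have Y0: "0 \<le> Y \<omega>" if "\<omega> \<in> space M" for \<omega>
      unfolding Y_def by (rule passage_nonneg[OF wout[OF that]])
    have YT: "Y \<omega> \<le> T 0 (z n) \<omega>" if "\<omega> \<in> space M" for \<omega>
      unfolding Y_def T_def using wout[OF that] weights_\<tau>[OF that]
      by (intro passage_mono) (auto simp: weights_def)
    \<comment> \<open>Erasing the weights near both endpoints lowers the expectation by a constant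
      only, since the number of erased edges does not grow with n.\<close>
    have TY: "T 0 (z n) \<omega> \<le> Y \<omega> + (\<Sum>e\<in>F n. \<tau> e \<omega>)" if w: "\<omega> \<in> space M" for \<omega>
    proof -
      have "T 0 (z n) \<omega> - (\<Sum>e\<in>F n. \<tau> e \<omega>) \<le> Y \<omega>"
        unfolding Y_def
      proof (rule passage_ge)
        fix \<gamma> assume \<gamma>: "\<gamma> \<in> lattice_paths 0 (z n)"
        have "T 0 (z n) \<omega> \<le> path_time (\<lambda>e. \<tau> e \<omega>) \<gamma>"
          unfolding T_def by (rule passage_le[OF weights_\<tau>[OF w] \<gamma>])
        also have "\<dots> = path_time (\<lambda>e. if e \<in> F n then 0 else \<tau> e \<omega>) \<gamma>
            + (\<Sum>e\<in>path_edges \<gamma>. if e \<in> F n then \<tau> e \<omega> else 0)"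
          unfolding path_time_def sum.distrib[symmetric] by (intro sum.cong) auto
        also have "(\<Sum>e\<in>path_edges \<gamma>. if e \<in> F n then \<tau> e \<omega> else 0) = (\<Sum>e\<in>path_edges \<gamma> \<inter> F n. \<tau> e \<omega>)"
          by (simp add: sum.inter_restrict finite_path_edges)
        also have "\<dots> \<le> (\<Sum>e\<in>F n. \<tau> e \<omega>)"
          using F nonneg w by (intro sum_mono2) auto
        finally show "T 0 (z n) \<omega> - (\<Sum>e\<in>F n. \<tau> e \<omega>) \<le> path_time (\<lambda>e. if e \<in> F n then 0 else \<tau> e \<omega>) \<gamma>"
          by simp
      qed
      then show ?thesis by simp
    qed
    have intY: "integrable M Y"
    proof (rule Bochner_Integration.integrable_bound[OF T_moments(1)[of 0 "z n"]])
      show "AE \<omega> in M. norm (Y \<omega>) \<le> norm (T 0 (z n) \<omega>)"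
      proof (rule AE_I2)
        fix \<omega> assume "\<omega> \<in> space M"
        from YT[OF this] Y0[OF this] show "norm (Y \<omega>) \<le> norm (T 0 (z n) \<omega>)" by simp
      qed
    qed simp
    have intF: "integrable M (\<lambda>\<omega>. \<Sum>e\<in>F n. \<tau> e \<omega>)"
      using F by (intro Bochner_Integration.integrable_sum c1) auto
    have "mean_T (z n) \<le> expectation (\<lambda>\<omega>. Y \<omega> + (\<Sum>e\<in>F n. \<tau> e \<omega>))"
      unfolding mean_T_def by (intro integral_mono T_moments Bochner_Integration.integrable_add intY intF TY)
    also have "\<dots> = expectation Y + (\<Sum>e\<in>F n. expectation (\<tau> e))"
      using F by (simp add: intY intF c1 subset_iff)
    also have "(\<Sum>e\<in>F n. expectation (\<tau> e)) \<le> (\<Sum>e\<in>F n. c1)" using F by (intro sum_mono c1) auto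
    also have "\<dots> \<le> 2 * N * c1" using mult_right_mono[OF cardF c1(1)] by simp
    also have "\<dots> \<le> \<delta> / 4 * real n"
    proof -
      have "8 * N * c1 / \<delta> \<le> real n" using elim(2) by simp
      then show ?thesis using \<delta> by (simp add: field_simps)
    qed
    finally have EY: "expectation Y \<ge> (\<mu> - \<delta> / 2) * real n"
      using elim(1) n by (simp add: field_simps)
    have l1z: "real_of_int (l1_norm (z n)) \<le> A * real n"
    proof -
      have "real_of_int (l1_norm (z n)) \<le> ((\<Sum>i\<in>UNIV. \<bar>x $ i\<bar>) + real CARD('d)) * (real n + 1)"
        unfolding z_def by (rule l1_floor_vec_le) simp
      also have "\<dots> \<le> ((\<Sum>i\<in>UNIV. \<bar>x $ i\<bar>) + real CARD('d)) * (2 * real n)"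
        using n by (intro mult_left_mono add_nonneg_nonneg sum_nonneg) auto
      finally show ?thesis by (simp only: A_def mult.assoc)
    qed
    show "c \<le> prob {\<omega>\<in>space M. passage (\<lambda>e. if e \<in> F n then 0 else \<tau> e \<omega>) 0 (z n) \<ge> (\<mu> - \<delta>) * real n}"
    proof (cases "(\<mu> - \<delta>) * real n \<le> 0")
      case True
      then have "P = space M" unfolding P_def using Y0 by (auto intro: order_trans)
      then have "prob P = 1" by (simp add: prob_space)
      then show ?thesis unfolding P_def Y_def c_def by simp
    next
      case False
      have le: "Y \<omega> \<le> (\<mu> - \<delta>) * real n + (L * real n * indicator P \<omega> + (T 0 (z n) \<omega>)\<^sup>2 / (L * real n))"
        if w: "\<omega> \<in> space M" for \<omega>
      proof (cases "\<omega> \<in> P")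
        case True
        have Ln: "L * real n > 0" using L n by (intro mult_pos_pos) auto
        have "Y \<omega> \<le> L * real n + (T 0 (z n) \<omega>)\<^sup>2 / (L * real n)"
        proof (cases "Y \<omega> \<le> L * real n")
          case True
          then show ?thesis using Ln by (smt (verit) divide_nonneg_pos zero_le_power2)
        next
          case False
          have "Y \<omega> * (L * real n) \<le> Y \<omega> * Y \<omega>" using False Y0[OF w] by (intro mult_left_mono) auto
          also have "\<dots> \<le> (T 0 (z n) \<omega>)\<^sup>2"
            unfolding power2_eq_square using YT[OF w] Y0[OF w] by (intro mult_mono) auto
          finally have "Y \<omega> \<le> (T 0 (z n) \<omega>)\<^sup>2 / (L * real n)" using Ln by (simp add: pos_le_divide_eq)
          then show ?thesis using Ln by linarith
        qed
        then show ?thesis using True False by simp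
      next
        case False
        then have "Y \<omega> \<le> (\<mu> - \<delta>) * real n" using w by (simp add: P_def)
        moreover have "0 \<le> (T 0 (z n) \<omega>)\<^sup>2 / (L * real n)"
          using L n by (intro divide_nonneg_nonneg) auto
        moreover have "indicator P \<omega> = (0 :: real)" using False by simp
        ultimately show ?thesis by simp
      qed
      have intP: "integrable M (\<lambda>\<omega>. L * real n * indicator P \<omega> :: real)"
        by (intro integrable_mult_right) (simp add: integrable_real_indicator emeasure_eq_measure)
      have intT2: "integrable M (\<lambda>\<omega>. (T 0 (z n) \<omega>)\<^sup>2 / (L * real n))"
        by (intro Bochner_Integration.integrable_divide T_moments(3))
      have "expectation Y \<le> expectation (\<lambda>\<omega>. (\<mu> - \<delta>) * real n + (L * real n * indicator P \<omega> + (T 0 (z n) \<omega>)\<^sup>2 / (L * real n)))"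
        by (intro integral_mono intY Bochner_Integration.integrable_add intP intT2 le) auto
      also have "\<dots> = (\<mu> - \<delta>) * real n + (L * real n * prob P + expectation (\<lambda>\<omega>. (T 0 (z n) \<omega>)\<^sup>2) / (L * real n))"
        using intP intT2 by (simp add: prob_space)
      also have "expectation (\<lambda>\<omega>. (T 0 (z n) \<omega>)\<^sup>2) / (L * real n) \<le> \<delta> / 4 * real n"
      proof -
        have "expectation (\<lambda>\<omega>. (T 0 (z n) \<omega>)\<^sup>2) \<le> c1 * (real_of_int (l1_norm (z n)))\<^sup>2"
          using T_moments(4)[of 0 "z n"] by simp
        also have "\<dots> \<le> c1 * (A * real n)\<^sup>2"
          using l1z c1(1) l1_norm_nonneg[of "z n"] by (intro mult_left_mono power_mono) auto
        finally have "expectation (\<lambda>\<omega>. (T 0 (z n) \<omega>)\<^sup>2) / (L * real n) \<le> c1 * (A * real n)\<^sup>2 / (L * real n)"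
          using L n by (intro divide_right_mono) auto
        also have "\<dots> = c1 * A\<^sup>2 / L * real n" using n L by (simp add: power2_eq_square field_simps)
        also have "\<dots> \<le> \<delta> / 4 * real n" using L n by (intro mult_right_mono) auto
        finally show ?thesis .
      qed
      finally have "\<delta> / 4 * real n \<le> L * prob P * real n" using EY by (simp add: algebra_simps)
      then have "\<delta> / 4 \<le> L * prob P" using n by simp
      then have "\<delta> / (4 * L) \<le> prob P" using L by (simp add: field_simps)
      moreover have "\<delta> / (8 * L) \<le> \<delta> / (4 * L)" using \<delta> L by (intro divide_left_mono) auto
      ultimately show ?thesis unfolding c_def P_def Y_def by simp
    qed
  qed
  then show ?thesis using c unfolding \<mu>_def by blast
qed

text \<open>Every path has to leave the trap at the origin, cross the space between, and enter the
  trap at the endpoint. These three costs come from disjoint sets of edges, so they add up by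
  \<open>passage_superadd\<close> and are controlled independently.\<close>

lemma lower_deviation_two_traps:
  fixes x :: "real ^ 'd" and f :: "'d edge \<Rightarrow> real"
  assumes f: "blocking K f" and s: "s > 0" and \<delta>: "\<delta> > 0" and x: "x \<noteq> 0"
  shows "\<exists>c>0. \<forall>\<^sub>F n in sequentially.
    prob {\<omega>\<in>space M. T 0 (floor_vec (real n *\<^sub>R x)) \<omega> \<ge> (time_constant M \<tau> x - \<delta> + 2 * s) * real n}
    \<ge> c * exp (- 2 * \<alpha> * (energy r K f * (s * real n) powr r))"
proof -
  define \<mu> where "\<mu> = time_constant M \<tau> x"
  define z where "z n = floor_vec (real n *\<^sub>R x)" for n
  define B where "B = (box_edges (real K) :: 'd edge set)"
  define B' where "B' n = (`) ((+) (z n)) ` B" for n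
  obtain c where c: "c > 0" "\<forall>\<^sub>F n in sequentially. prob {\<omega>\<in>space M.
     passage (\<lambda>e. if e \<in> B \<union> B' n then 0 else \<tau> e \<omega>) 0 (z n) \<ge> (\<mu> - \<delta>) * real n} \<ge> c"
    using outside_passage_time[OF \<delta>, of x K] unfolding \<mu>_def z_def B_def B'_def by blast
  have f0: "f e \<ge> 0" for e using f by (auto simp: blocking_def)
  have "\<forall>\<^sub>F n in sequentially. linf_norm (z n) > int (2 * K)"
    unfolding z_def by (rule floor_vec_far[OF x])
  with c(2) have "\<forall>\<^sub>F n in sequentially.
    prob {\<omega>\<in>space M. T 0 (z n) \<omega> \<ge> (\<mu> - \<delta> + 2 * s) * real n}
    \<ge> \<beta>\<^sub>1 ^ (2 * card B) * c * exp (- 2 * \<alpha> * (energy r K f * (s * real n) powr r))"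
  proof eventually_elim
    case (elim n)
    have finB: "finite B" "finite (B' n)" unfolding B'_def B_def using finite_box_edges by auto
    have lat: "B \<subseteq> lattice_edges" "B' n \<subseteq> lattice_edges"
      unfolding B'_def B_def
      by (auto intro!: shift_lattice_edges intro: subsetD[OF box_edges_lattice])
    \<comment> \<open>A common edge would place the endpoint within sup distance 2K of the origin,
      against the choice of n.\<close>
    have disj: "B \<inter> B' n = {}"
    proof (rule ccontr)
      assume "B \<inter> B' n \<noteq> {}"
      then obtain e e' where e: "e \<in> B" "e' \<in> B" "e = (+) (z n) ` e'" unfolding B'_def by blast
      obtain v where v: "v \<in> e'" "v \<in> lattice_box (real K)"
        using e(2) unfolding B_def box_edges_def by blast
      have "z n + v \<in> e" using v e by auto
      then have "z n + v \<in> lattice_box (real K)" using e(1) unfolding B_def box_edges_def by blast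
      then have "linf_norm (z n + v) \<le> int K" "linf_norm v \<le> int K"
        using v(2) unfolding lattice_box_def by auto
      then have "linf_norm ((z n + v) + (- v)) \<le> int K + int K"
        using linf_norm_triangle[of "z n + v" "- v"] by (simp add: linf_norm_minus)
      then show False using elim(2) by simp
    qed
    have inj: "inj_on ((`) ((+) (z n))) B" by (rule inj_on_subset[OF inj_image_add]) simp
    \<comment> \<open>The prescribed level is the scaled trap, pulled back to the origin on the
      translated box.\<close>
    define a where "a e = (if e \<in> B then s * real n * f e else s * real n * f ((+) (- z n) ` e))" for e
    have unshift: "(+) (- z n) ` (+) (z n) ` e = e" for e by (simp add: image_image)
    have a': "a ((+) (z n) ` e) = s * real n * f e" if "e \<in> B" for e
    proof -
      have "(+) (z n) ` e \<notin> B" using disj that unfolding B'_def by blast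
      then show ?thesis unfolding a_def unshift by simp
    qed
    have a0: "a e \<ge> 0" for e unfolding a_def using s f0 by auto
    have sumB: "(\<Sum>e\<in>B. (s * real n * f e) powr r) = energy r K f * (s * real n) powr r"
      unfolding energy_def sum_distrib_right B_def using f0 s by (intro sum.cong) (auto simp: powr_mult)
    have "(\<Sum>e\<in>B \<union> B' n. a e powr r) = (\<Sum>e\<in>B. a e powr r) + (\<Sum>e\<in>B' n. a e powr r)"
      by (rule sum.union_disjoint[OF finB disj])
    also have "(\<Sum>e\<in>B' n. a e powr r) = (\<Sum>e\<in>B. (s * real n * f e) powr r)"
      unfolding B'_def by (subst sum.reindex[OF inj]) (auto simp: a' intro!: sum.cong)
    also have "(\<Sum>e\<in>B. a e powr r) = (\<Sum>e\<in>B. (s * real n * f e) powr r)"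
      by (intro sum.cong) (auto simp: a_def)
    finally have suma: "(\<Sum>e\<in>B \<union> B' n. a e powr r) = 2 * (energy r K f * (s * real n) powr r)"
      unfolding sumB by simp
    have cardU: "card (B \<union> B' n) = 2 * card B"
      unfolding card_Un_disjoint[OF finB disj] by (simp add: B'_def card_image[OF inj])
    define G where "G t \<longleftrightarrow> passage (\<lambda>e. if e \<in> B \<union> B' n then 0 else t e) 0 (z n) \<ge> (\<mu> - \<delta>) * real n" for t
    have Gm: "Measurable.pred (PiM (lattice_edges - (B \<union> B' n)) (\<lambda>_. borel)) G"
    proof -
      have [measurable]: "(\<lambda>t. passage (\<lambda>e. if e \<in> B \<union> B' n then 0 else t e) 0 (z n))
        \<in> borel_measurable (PiM (lattice_edges - (B \<union> B' n)) (\<lambda>_. borel))"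
      proof (rule passage_measurable)
        fix e :: "'d edge" assume "e \<in> lattice_edges"
        then show "(\<lambda>t. if e \<in> B \<union> B' n then 0 else t e) \<in> borel_measurable (PiM (lattice_edges - (B \<union> B' n)) (\<lambda>_. borel))"
          by (cases "e \<in> B \<union> B' n") (auto intro!: measurable_component_singleton)
      qed
      show ?thesis unfolding G_def[abs_def] by measurable
    qed
    have Geq: "G (\<lambda>e\<in>lattice_edges - (B \<union> B' n). \<tau> e \<omega>)
       \<longleftrightarrow> passage (\<lambda>e. if e \<in> B \<union> B' n then 0 else \<tau> e \<omega>) 0 (z n) \<ge> (\<mu> - \<delta>) * real n" for \<omega>
    proof -
      have "passage (\<lambda>e. if e \<in> B \<union> B' n then 0 else (\<lambda>e\<in>lattice_edges - (B \<union> B' n). \<tau> e \<omega>) e) 0 (z n)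
        = passage (\<lambda>e. if e \<in> B \<union> B' n then 0 else \<tau> e \<omega>) 0 (z n)"
        by (rule passage_cong) auto
      then show ?thesis unfolding G_def by simp
    qed
    let ?A = "{\<omega>\<in>space M. (\<forall>e\<in>B \<union> B' n. \<tau> e \<omega> > a e) \<and> G (\<lambda>e\<in>lattice_edges - (B \<union> B' n). \<tau> e \<omega>)}"
    have "\<beta>\<^sub>1 ^ (2 * card B) * c * exp (- 2 * \<alpha> * (energy r K f * (s * real n) powr r))
      = (\<beta>\<^sub>1 ^ (2 * card B) * exp (- \<alpha> * (2 * (energy r K f * (s * real n) powr r)))) * c" by simp
    also have "\<dots> \<le> (\<beta>\<^sub>1 ^ (2 * card B) * exp (- \<alpha> * (2 * (energy r K f * (s * real n) powr r))))
        * prob {\<omega>\<in>space M. G (\<lambda>e\<in>lattice_edges - (B \<union> B' n). \<tau> e \<omega>)}"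
      using elim(1) \<beta>\<^sub>1 unfolding Geq by (intro mult_left_mono) auto
    also have "\<dots> \<le> prob ?A"
      using product_lower_bound[where a = a, OF _ _ _ Gm] finB lat a0 unfolding suma cardU by simp
    also have "\<dots> \<le> prob {\<omega>\<in>space M. T 0 (z n) \<omega> \<ge> (\<mu> - \<delta> + 2 * s) * real n}"
    proof (rule finite_measure_mono)
      show "?A \<subseteq> {\<omega>\<in>space M. T 0 (z n) \<omega> \<ge> (\<mu> - \<delta> + 2 * s) * real n}"
      proof
        fix \<omega> assume w: "\<omega> \<in> ?A"
        then have ws: "\<omega> \<in> space M" by simp
        have big: "\<tau> e \<omega> \<ge> a e" if "e \<in> B \<union> B' n" for e using w that by (auto intro: less_imp_le)
        let ?u = "\<lambda>e. if e \<in> B then \<tau> e \<omega> else 0" and ?u' = "\<lambda>e. if e \<in> B' n then \<tau> e \<omega> else 0"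
          and ?o = "\<lambda>e. if e \<in> B \<union> B' n then 0 else \<tau> e \<omega>"
        have wt: "weights ?u" "weights ?u'" "weights ?o"
          using weights_\<tau>[OF ws] by (auto simp: weights_def)
        have far: "linf_norm (z n) > int K" using elim(2) by simp
        have "passage ?u 0 (z n) \<ge> s * real n"
        proof (rule blocking_passage_ge[OF f wt(1) _ _ far])
          show "s * real n * f e \<le> ?u e" if "e \<in> box_edges (real K)" for e
            using big[of e] that unfolding B_def[symmetric] a_def by simp
        qed (use s in simp)
        moreover have "passage ?u' 0 (z n) \<ge> s * real n"
        proof (rule blocking_passage_ge'[OF f wt(2) _ _ far])
          show "s * real n * f e \<le> ?u' ((+) (z n) ` e)" if "e \<in> box_edges (real K)" for e
            using big[of "(+) (z n) ` e"] a'[of e] that unfolding B_def[symmetric] B'_def by simp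
        qed (use s in simp)
        moreover have "passage ?o 0 (z n) \<ge> (\<mu> - \<delta>) * real n" using w Geq by blast
        moreover have "passage ?u 0 (z n) + passage ?u' 0 (z n) \<le> passage (\<lambda>e. ?u e + ?u' e) 0 (z n)"
          by (rule passage_superadd[OF wt(1,2)]) simp
        moreover have "weights (\<lambda>e. ?u e + ?u' e)" using wt by (auto simp: weights_def)
        then have "passage (\<lambda>e. ?u e + ?u' e) 0 (z n) + passage ?o 0 (z n) \<le> T 0 (z n) \<omega>"
          unfolding T_def using disj by (intro passage_superadd wt) auto
        ultimately have "T 0 (z n) \<omega> \<ge> (\<mu> - \<delta> + 2 * s) * real n" by (simp add: algebra_simps)
        with ws show "\<omega> \<in> {\<omega>\<in>space M. T 0 (z n) \<omega> \<ge> (\<mu> - \<delta> + 2 * s) * real n}" by simp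
      qed
    qed measurable
    finally show ?case .
  qed
  moreover have "\<beta>\<^sub>1 ^ (2 * card B) * c > 0" using \<beta>\<^sub>1 c by simp
  ultimately show ?thesis unfolding z_def \<mu>_def by blast
qed

end

section \<open>Chernoff bounds for flows and for chains of blocks\<close>

text \<open>One of the places where r < d is decisive: the exponent (d-1)/(r-1) exceeds one, so the
  series converges and its tail beyond R is small.\<close>

lemma flow_sum_powr_small:
  fixes r :: real
  assumes r: "1 < r" "r < real CARD('d::finite)" and \<eta>: "\<eta> > 0"
  shows "\<exists>R\<ge>1. \<forall>N. (\<Sum>k=R..<N. (1 / simplex_card TYPE('d) k) powr (1 / (r - 1))) \<le> \<eta>"
proof -
  define p where "p = (real CARD('d) - 1) / (r - 1)"
  have p: "p > 1" using r by (simp add: p_def)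
  define b where "b k = (1 / simplex_card TYPE('d) k) powr (1 / (r - 1))" for k
  have le: "b k \<le> real CARD('d) powr p * real (Suc k) powr (- p)" for k
  proof -
    have pos: "(real (Suc k) / real CARD('d)) ^ (CARD('d) - 1) > 0" by simp
    have "1 / simplex_card TYPE('d) k \<le> 1 / (real (Suc k) / real CARD('d)) ^ (CARD('d) - 1)"
      using simplex_card_ge[where 'd = 'd, of k] pos by (intro divide_left_mono) (auto intro: mult_pos_pos simp: simplex_card_pos)
    also have "\<dots> = (real CARD('d) / real (Suc k)) powr (real CARD('d) - 1)"
    proof -
      have "real CARD('d) - 1 = real (CARD('d) - 1)" by (simp add: of_nat_diff)
      moreover have "real CARD('d) / real (Suc k) > 0" by simp
      ultimately show ?thesis by (simp only: powr_realpow) (simp add: power_divide)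
    qed
    finally have "b k \<le> ((real CARD('d) / real (Suc k)) powr (real CARD('d) - 1)) powr (1 / (r - 1))"
      unfolding b_def using r simplex_card_pos[where 'd = 'd, of k] by (intro powr_mono2) auto
    also have "\<dots> = (real CARD('d) / real (Suc k)) powr p" by (simp add: powr_powr p_def)
    also have "\<dots> = real CARD('d) powr p * real (Suc k) powr (- p)"
      by (subst powr_divide) (auto simp: powr_minus_divide)
    finally show ?thesis .
  qed
  have "summable (\<lambda>k. real k powr (- p))" using p by (subst summable_real_powr_iff) simp
  then have "summable (\<lambda>k. real (Suc k) powr (- p))" by (subst summable_Suc_iff)
  then have "summable (\<lambda>k. real CARD('d) powr p * real (Suc k) powr (- p))" by (rule summable_mult)
  then have "summable b"
    by (rule summable_comparison_test') (use le in \<open>auto simp: b_def\<close>)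
  then obtain R where R: "\<And>m n. m \<ge> R \<Longrightarrow> norm (sum b {m..<n}) < \<eta>"
    using \<eta> unfolding summable_Cauchy by blast
  have "sum b {max 1 R..<N} \<le> \<eta>" for N
    using R[of "max 1 R" N] by (simp add: abs_less_iff)
  then show ?thesis unfolding b_def by (intro exI[of _ "max 1 R"]) auto
qed

locale signed_percolation = percolation_superlinear M \<tau> \<beta>\<^sub>1 \<beta>\<^sub>2 \<alpha> r + signs \<sigma>
  for M :: "'a measure" and \<tau> :: "'d::finite edge \<Rightarrow> 'a \<Rightarrow> real" and \<beta>\<^sub>1 \<beta>\<^sub>2 \<alpha> r :: real
    and \<sigma> :: "'d \<Rightarrow> int"
begin

text \<open>Levels below R are left out because a single edge carries too much of the flow there;
  those weights are bounded by hypothesis instead.\<close>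

definition outer_flow :: "nat \<Rightarrow> nat \<Rightarrow> 'd vertex \<Rightarrow> 'a \<Rightarrow> real" where
  "outer_flow R N v \<omega> = (\<Sum>k=R..<N. \<Sum>y\<in>nat_simplex k. \<Sum>i\<in>UNIV. flow y i * \<tau> (flow_edge \<sigma> v y i) \<omega>)"

lemma outer_flow_measurable [measurable]: "outer_flow R N v \<in> borel_measurable M"
  unfolding outer_flow_def[abs_def] using flow_edge_lattice by measurable

text \<open>With \<theta> of order (\<delta> n)^(r-1), both the gain \<theta> \<delta> n and the
  conjugate power of \<theta> in the Laplace bound are of order (\<delta> n)^r. The latter is
  multiplied by the flow sum, which R makes small. By this homogeneity R depends on B but not on
  \<delta>; only the depth of the flow, through \<epsilon>, is adapted to \<delta>.\<close>

lemma outer_flow_tail: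
  assumes rd: "r < real CARD('d)" and B: "B > 0"
  shows "\<exists>R\<ge>1. \<forall>\<delta>>0. \<exists>\<epsilon>>0. \<forall>v N. \<forall>n>0. real N \<le> \<epsilon> * n \<longrightarrow>
    prob {\<omega>\<in>space M. outer_flow R N v \<omega> \<ge> \<delta> * n} \<le> exp (- (B * (\<delta> * n) powr r))"
proof -
  define r' where "r' = r / (r - 1)"
  have r': "r' = 1 + 1 / (r - 1)" "(r - 1) * r' = r" using r1 by (simp_all add: r'_def field_simps)
  obtain C where C: "C \<ge> 0" "\<And>e s. e \<in> lattice_edges \<Longrightarrow> s \<ge> 0 \<Longrightarrow>
    (\<integral>\<^sup>+\<omega>. ennreal (exp (s * \<tau> e \<omega>)) \<partial>M) \<le> ennreal (exp (C * (s + s powr r')))"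
    using laplace_bound[OF r1] unfolding r'_def by blast
  \<comment> \<open>In units of (\<delta> n)^r, the linear Laplace term uses up \<beta>/2 and the
    conjugate power term 1, which leaves exactly B.\<close>
  define \<beta> where "\<beta> = 2 * (B + 1)"
  have \<beta>: "\<beta> > 0" using B by (simp add: \<beta>_def)
  define \<eta> where "\<eta> = 1 / (C * \<beta> powr r' + 1)"
  have pos: "C * \<beta> powr r' + 1 > 0" using C(1) by (intro add_nonneg_pos mult_nonneg_nonneg) auto
  then have \<eta>: "\<eta> > 0" "C * \<beta> powr r' * \<eta> \<le> 1" by (auto simp: \<eta>_def divide_le_eq)
  obtain R where R: "R \<ge> 1"
    "\<And>N. (\<Sum>k=R..<N. (1 / simplex_card TYPE('d) k) powr (1 / (r - 1))) \<le> \<eta>"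
    using flow_sum_powr_small[OF r1 rd \<eta>(1)] by blast
  have "\<exists>\<epsilon>>0. \<forall>v N. \<forall>n>0. real N \<le> \<epsilon> * n \<longrightarrow>
    prob {\<omega>\<in>space M. outer_flow R N v \<omega> \<ge> \<delta> * n} \<le> exp (- (B * (\<delta> * n) powr r))" if \<delta>: "\<delta> > 0" for \<delta>
  proof -
    \<comment> \<open>The total flow over N levels is at most N, so N \<le> \<epsilon> n keeps the
      linear term below half of the gain.\<close>
    define \<epsilon> where "\<epsilon> = \<delta> / (2 * C + 1)"
    have \<epsilon>: "\<epsilon> > 0" using \<delta> C by (simp add: \<epsilon>_def)
    have C\<epsilon>: "C * \<epsilon> \<le> \<delta> / 2" using \<delta> C by (simp add: \<epsilon>_def field_simps)
    have "prob {\<omega>\<in>space M. outer_flow R N v \<omega> \<ge> \<delta> * n} \<le> exp (- (B * (\<delta> * n) powr r))"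
      if n: "n > 0" and N: "real N \<le> \<epsilon> * n" for v N and n :: real
    proof -
      define I where "I = (\<Union>k\<in>{R..<N}. nat_simplex k :: ('d \<Rightarrow> nat) set) \<times> (UNIV :: 'd set)"
      define \<phi> where "\<phi> = (\<lambda>(y, i). flow_edge \<sigma> v y i)"
      define w where "w = (\<lambda>(y :: 'd \<Rightarrow> nat, i :: 'd). flow y i)"
      define \<theta> where "\<theta> = \<beta> * (\<delta> * n) powr (r - 1)"
      have \<theta>: "\<theta> > 0" using \<beta> \<delta> n by (simp add: \<theta>_def)
      have finI: "finite I" unfolding I_def by (auto simp: finite_simplex)
      have inj: "inj_on \<phi> I" by (rule inj_onI) (auto simp: \<phi>_def dest: flow_edge_inj)
      have lat: "\<phi> ` I \<subseteq> lattice_edges" by (auto simp: \<phi>_def flow_edge_lattice)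
      have w0: "w j > 0" for j by (cases j) (simp add: w_def flow_pos)
      have sumI: "(\<Sum>j\<in>I. h j) = (\<Sum>k=R..<N. \<Sum>y\<in>nat_simplex k. \<Sum>i\<in>UNIV. h (y, i))" for h :: "_ \<Rightarrow> real"
      proof -
        have "(\<Sum>j\<in>I. h j) = (\<Sum>y\<in>(\<Union>k\<in>{R..<N}. nat_simplex k). \<Sum>i\<in>UNIV. h (y, i))"
          unfolding I_def by (simp add: sum.cartesian_product split_def)
        also have "\<dots> = (\<Sum>k=R..<N. \<Sum>y\<in>nat_simplex k. \<Sum>i\<in>UNIV. h (y, i))"
          by (intro sum.UNION_disjoint) (auto simp: finite_simplex, auto simp: nat_simplex_def)
        finally show ?thesis .
      qed
      have X: "outer_flow R N v \<omega> = (\<Sum>j\<in>I. w j * \<tau> (\<phi> j) \<omega>)" for \<omega>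
        unfolding outer_flow_def sumI by (simp add: w_def \<phi>_def)
      have sumw: "(\<Sum>j\<in>I. w j) \<le> real N"
        unfolding sumI w_def by (simp add: flow_total)
      have sumw': "(\<Sum>j\<in>I. w j powr r') \<le> \<eta>"
      proof -
        have "(\<Sum>j\<in>I. w j powr r') \<le>
           (\<Sum>k=R..<N. \<Sum>y\<in>(nat_simplex k :: ('d \<Rightarrow> nat) set). \<Sum>i\<in>UNIV. flow y i * (1 / simplex_card TYPE('d) k) powr (1 / (r - 1)))"
          unfolding sumI
        proof (intro sum_mono)
          fix k and y :: "'d \<Rightarrow> nat" and i :: 'd assume y: "y \<in> nat_simplex k"
          have "w (y, i) powr r' = flow y i * flow y i powr (1 / (r - 1))"
            using flow_pos[of y i] by (simp add: w_def r'(1) powr_add)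
          also have "\<dots> \<le> flow y i * (1 / simplex_card TYPE('d) k) powr (1 / (r - 1))"
            using flow_pos[of y i] flow_le[OF y] r1 by (intro mult_left_mono powr_mono2) auto
          finally show "w (y, i) powr r' \<le> flow y i * (1 / simplex_card TYPE('d) k) powr (1 / (r - 1))" .
        qed
        also have "\<dots> = (\<Sum>k=R..<N. (1 / simplex_card TYPE('d) k) powr (1 / (r - 1)))"
          by (simp add: sum_distrib_right[symmetric] flow_total)
        also have "\<dots> \<le> \<eta>" by (rule R(2))
        finally show ?thesis .
      qed
      have "(\<integral>\<^sup>+\<omega>. ennreal (exp (\<theta> * outer_flow R N v \<omega>)) \<partial>M)
        = (\<integral>\<^sup>+\<omega>. (\<Prod>j\<in>I. ennreal (exp (\<theta> * w j * \<tau> (\<phi> j) \<omega>))) \<partial>M)"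
        unfolding X by (simp add: sum_distrib_left exp_sum finI prod_ennreal mult.assoc)
      also have "\<dots> = (\<Prod>j\<in>I. \<integral>\<^sup>+\<omega>. ennreal (exp (\<theta> * w j * \<tau> (\<phi> j) \<omega>)) \<partial>M)"
        by (rule nn_integral_reindexed_edges[OF finI inj lat, of "\<lambda>j x. ennreal (exp (\<theta> * w j * x))"]) measurable
      also have "\<dots> \<le> (\<Prod>j\<in>I. ennreal (exp (C * (\<theta> * w j + (\<theta> * w j) powr r'))))"
        using lat w0 \<theta> by (intro prod_mono_ennreal C(2)) (auto intro: less_imp_le)
      also have "\<dots> = ennreal (exp (\<Sum>j\<in>I. C * (\<theta> * w j + (\<theta> * w j) powr r')))"
        by (simp add: exp_sum finI prod_ennreal)
      also have "(\<Sum>j\<in>I. C * (\<theta> * w j + (\<theta> * w j) powr r'))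
         = C * \<theta> * (\<Sum>j\<in>I. w j) + C * \<theta> powr r' * (\<Sum>j\<in>I. w j powr r')"
        using w0 \<theta> by (simp add: algebra_simps sum.distrib sum_distrib_left powr_mult less_imp_le)
      finally have "prob {\<omega>\<in>space M. \<theta> * outer_flow R N v \<omega> \<ge> \<theta> * (\<delta> * n)} \<le> exp (- (\<theta> * (\<delta> * n)))
         * exp (C * \<theta> * (\<Sum>j\<in>I. w j) + C * \<theta> powr r' * (\<Sum>j\<in>I. w j powr r'))"
        by (intro exp_Markov) auto
      also have "\<dots> = exp (C * \<theta> * (\<Sum>j\<in>I. w j) + C * \<theta> powr r' * (\<Sum>j\<in>I. w j powr r') - \<theta> * (\<delta> * n))"
        by (simp add: exp_diff exp_minus field_simps)
      also have "\<dots> \<le> exp (- (B * (\<delta> * n) powr r))"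
      proof -
        define D where "D = (\<delta> * n) powr r"
        have D0: "D \<ge> 0" by (simp add: D_def)
        have l1: "\<theta> * (\<delta> * n) = \<beta> * D"
          unfolding \<theta>_def D_def using \<delta> n by (simp add: powr_diff)
        have l2: "\<theta> powr r' = \<beta> powr r' * D"
          unfolding \<theta>_def D_def using \<beta> \<delta> n by (simp add: powr_mult powr_powr r'(2))
        have "C * \<theta> * (\<Sum>j\<in>I. w j) \<le> C * \<theta> * (\<epsilon> * n)"
          using sumw N C(1) \<theta> by (intro mult_left_mono) auto
        also have "\<dots> = (C * \<epsilon>) * (\<theta> * n)" by simp
        also have "\<dots> \<le> \<delta> / 2 * (\<theta> * n)" using C\<epsilon> \<theta> n by (intro mult_right_mono) auto
        also have "\<dots> = \<beta> * D / 2" using l1 by (simp add: field_simps)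
        finally have 1: "C * \<theta> * (\<Sum>j\<in>I. w j) \<le> \<beta> * D / 2" .
        have "C * \<theta> powr r' * (\<Sum>j\<in>I. w j powr r') \<le> C * \<theta> powr r' * \<eta>"
          using sumw' C(1) by (intro mult_left_mono) auto
        also have "\<dots> = (C * \<beta> powr r' * \<eta>) * D" unfolding l2 by simp
        also have "\<dots> \<le> 1 * D" using \<eta>(2) D0 by (intro mult_right_mono)
        finally have 2: "C * \<theta> powr r' * (\<Sum>j\<in>I. w j powr r') \<le> D" by simp
        have "C * \<theta> * (\<Sum>j\<in>I. w j) + C * \<theta> powr r' * (\<Sum>j\<in>I. w j powr r') - \<theta> * (\<delta> * n) \<le> - (B * D)"
          using 1 2 unfolding l1 by (simp add: \<beta>_def algebra_simps)
        then show ?thesis unfolding D_def by simp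
      qed
      finally show ?thesis using \<theta> by simp
    qed
    with \<epsilon> show ?thesis by blast
  qed
  with R(1) show ?thesis by blast
qed

end

context percolation
begin

text \<open>Blocks of one colour use disjoint edges and are independent. If the whole sum reaches s,
  some colour class reaches its share of s, so dependence of bounded range costs only factors given
  by the number of colours.\<close>

lemma coloured_Chernoff:
  fixes g :: "'i \<Rightarrow> ('d edge \<Rightarrow> real) \<Rightarrow> real" and col :: "'i \<Rightarrow> 'c"
  assumes I: "finite I" and Q: "finite Q" "col ` I \<subseteq> Q" "Q \<noteq> {}"
    and E: "\<And>i. i \<in> I \<Longrightarrow> E i \<subseteq> lattice_edges"
    and disj: "\<And>i j. i \<in> I \<Longrightarrow> j \<in> I \<Longrightarrow> col i = col j \<Longrightarrow> i \<noteq> j \<Longrightarrow> E i \<inter> E j = {}"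
    and g: "\<And>i. i \<in> I \<Longrightarrow> g i \<in> borel_measurable (PiM (E i) (\<lambda>_. borel))"
    and \<theta>: "\<theta> > 0"
    and le: "\<And>i. i \<in> I \<Longrightarrow> (\<integral>\<^sup>+\<omega>. ennreal (exp (\<theta> * (g i (\<lambda>e\<in>E i. \<tau> e \<omega>) - b i))) \<partial>M) \<le> 1"
  shows "prob {\<omega>\<in>space M. (\<Sum>i\<in>I. g i (\<lambda>e\<in>E i. \<tau> e \<omega>) - b i) \<ge> s} \<le> real (card Q) * exp (- (\<theta> * s / real (card Q)))"
proof -
  define X where "X i \<omega> = g i (\<lambda>e\<in>E i. \<tau> e \<omega>) - b i" for i \<omega>
  define J where "J q = {i\<in>I. col i = q}" for q
  define A where "A q = {\<omega>\<in>space M. (\<Sum>i\<in>J q. X i \<omega>) \<ge> s / real (card Q)}" for q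
  have X [measurable]: "X i \<in> borel_measurable M" if "i \<in> I" for i
  proof -
    have "(\<lambda>\<omega>. \<lambda>e\<in>E i. \<tau> e \<omega>) \<in> measurable M (PiM (E i) (\<lambda>_. borel))"
      using E[OF that] by (intro measurable_restrict \<tau>_measurable) auto
    from measurable_compose[OF this g[OF that]] show ?thesis unfolding X_def by measurable
  qed
  have finJ: "finite (J q)" "J q \<subseteq> I" for q unfolding J_def using I by auto
  have [measurable]: "A q \<in> sets M" for q
  proof -
    have [measurable]: "X i \<in> borel_measurable M" if "i \<in> J q" for i using that finJ(2) X by blast
    show ?thesis unfolding A_def by measurable
  qed
  have PA: "prob (A q) \<le> exp (- (\<theta> * s / real (card Q)))" for q
  proof -
    have "(\<integral>\<^sup>+\<omega>. ennreal (exp (\<theta> * (\<Sum>i\<in>J q. X i \<omega>))) \<partial>M)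
      = (\<integral>\<^sup>+\<omega>. (\<Prod>i\<in>J q. ennreal (exp (\<theta> * (g i (\<lambda>e\<in>E i. \<tau> e \<omega>) - b i)))) \<partial>M)"
      by (simp add: sum_distrib_left exp_sum finJ prod_ennreal X_def)
    also have "\<dots> = (\<Prod>i\<in>J q. \<integral>\<^sup>+\<omega>. ennreal (exp (\<theta> * (g i (\<lambda>e\<in>E i. \<tau> e \<omega>) - b i))) \<partial>M)"
    proof (rule nn_integral_blocks[OF finJ(1), of q E "\<lambda>i t. ennreal (exp (\<theta> * (g i t - b i)))"])
      show "disjoint_family_on E (J q)"
        unfolding disjoint_family_on_def J_def using disj by auto
      fix i assume "i \<in> J q"
      then have i: "i \<in> I" by (simp add: J_def)
      show "E i \<subseteq> lattice_edges" by (rule E[OF i])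
      note [measurable] = g[OF i]
      show "(\<lambda>t. ennreal (exp (\<theta> * (g i t - b i)))) \<in> borel_measurable (PiM (E i) (\<lambda>_. borel))" by measurable
    qed
    also have "\<dots> \<le> (\<Prod>i\<in>J q. 1)" using finJ(2)[of q] by (intro prod_mono_ennreal le) auto
    finally have "prob {\<omega>\<in>space M. \<theta> * (\<Sum>i\<in>J q. X i \<omega>) \<ge> \<theta> * (s / real (card Q))}
        \<le> exp (- (\<theta> * (s / real (card Q)))) * 1"
      using finJ(2)[of q] by (intro exp_Markov borel_measurable_times borel_measurable_sum X) auto
    moreover have "{\<omega>\<in>space M. \<theta> * (\<Sum>i\<in>J q. X i \<omega>) \<ge> \<theta> * (s / real (card Q))} = A q"
      unfolding A_def using \<theta> by (simp only: mult_le_cancel_left_pos)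
    ultimately show ?thesis by simp
  qed
  have cQ: "real (card Q) > 0" using Q by (simp add: card_gt_0_iff)
  have "{\<omega>\<in>space M. (\<Sum>i\<in>I. X i \<omega>) \<ge> s} \<subseteq> (\<Union>q\<in>Q. A q)"
  proof
    fix \<omega> assume w: "\<omega> \<in> {\<omega>\<in>space M. (\<Sum>i\<in>I. X i \<omega>) \<ge> s}"
    show "\<omega> \<in> (\<Union>q\<in>Q. A q)"
    proof (rule ccontr)
      assume "\<omega> \<notin> (\<Union>q\<in>Q. A q)"
      then have less: "(\<Sum>i\<in>J q. X i \<omega>) < s / real (card Q)" if "q \<in> Q" for q
        using w that unfolding A_def by force
      have "(\<Sum>i\<in>I. X i \<omega>) = (\<Sum>q\<in>Q. \<Sum>i\<in>J q. X i \<omega>)"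
        unfolding J_def by (rule sum.group[symmetric, OF I Q(1,2)])
      also have "\<dots> < (\<Sum>q\<in>Q. s / real (card Q))" using Q less by (intro sum_strict_mono) auto
      also have "\<dots> = s" using cQ by simp
      finally show False using w by simp
    qed
  qed
  then have "prob {\<omega>\<in>space M. (\<Sum>i\<in>I. X i \<omega>) \<ge> s} \<le> prob (\<Union>q\<in>Q. A q)"
    using Q by (intro finite_measure_mono sets.finite_UN) auto
  also have "\<dots> \<le> (\<Sum>q\<in>Q. prob (A q))"
    using Q by (intro finite_measure_subadditive_finite) auto
  also have "\<dots> \<le> (\<Sum>q\<in>Q. exp (- (\<theta> * s / real (card Q))))" by (intro sum_mono PA)
  finally show ?thesis unfolding X_def by simp
qed

end

section \<open>Passage times over finitely many paths\<close>

text \<open>Unlike \<open>passage\<close>, this depends on finitely many edges. Blocks built from it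
  have bounded range, which the independence argument requires.\<close>

definition finite_passage :: "('d::finite edge \<Rightarrow> real) \<Rightarrow> 'd vertex list set \<Rightarrow> real" where
  "finite_passage t \<Gamma> = Min (path_time t ` \<Gamma>)"

lemma passage_le_finite_passage:
  assumes "weights t" "finite \<Gamma>" "\<Gamma> \<noteq> {}" "\<Gamma> \<subseteq> lattice_paths v w"
  shows "passage t v w \<le> finite_passage t \<Gamma>"
  unfolding finite_passage_def using assms by (subst Min_ge_iff) (auto intro: passage_le)

lemma finite_passage_measurable:
  assumes "finite \<Gamma>" "\<Gamma> \<noteq> {}" "\<And>e \<gamma>. \<gamma> \<in> \<Gamma> \<Longrightarrow> e \<in> path_edges \<gamma> \<Longrightarrow> X e \<in> borel_measurable N"
  shows "(\<lambda>\<omega>. finite_passage (\<lambda>e. X e \<omega>) \<Gamma>) \<in> borel_measurable N"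
  unfolding finite_passage_def path_time_def image_image using assms
  by (intro borel_measurable_Min) auto

lemma finite_passage_cong:
  assumes "\<And>e \<gamma>. \<gamma> \<in> \<Gamma> \<Longrightarrow> e \<in> path_edges \<gamma> \<Longrightarrow> s e = t e"
  shows "finite_passage s \<Gamma> = finite_passage t \<Gamma>"
proof -
  have "path_time s \<gamma> = path_time t \<gamma>" if "\<gamma> \<in> \<Gamma>" for \<gamma>
    unfolding path_time_def using assms[OF that] by (intro sum.cong) auto
  then have "path_time s ` \<Gamma> = path_time t ` \<Gamma>" by (intro image_cong refl)
  then show ?thesis unfolding finite_passage_def by simp
qed

context percolation_superlinear
begin

text \<open>The minimum over the first n paths of an enumeration decreases to the passage time, and
  the time of the first path dominates, so the expectations converge.\<close>

lemma finite_passage_approx: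
  assumes "\<eta> > 0"
  shows "\<exists>\<Gamma>. finite \<Gamma> \<and> \<Gamma> \<noteq> {} \<and> \<Gamma> \<subseteq> lattice_paths 0 z \<and>
    integrable M (\<lambda>\<omega>. finite_passage (\<lambda>e. \<tau> e \<omega>) \<Gamma>) \<and>
    expectation (\<lambda>\<omega>. finite_passage (\<lambda>e. \<tau> e \<omega>) \<Gamma>) < mean_T z + \<eta>"
proof -
  define en where "en = from_nat_into (lattice_paths 0 z)"
  have ran: "range en = lattice_paths 0 z"
    unfolding en_def by (intro range_from_nat_into lattice_paths_nonempty) auto
  define W where "W n \<omega> = finite_passage (\<lambda>e. \<tau> e \<omega>) (en ` {..n})" for n \<omega>
  have sub: "en ` {..n} \<subseteq> lattice_paths 0 z" for n using ran by auto
  have Wm [measurable]: "W n \<in> borel_measurable M" for n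
    unfolding W_def[abs_def]
    by (rule finite_passage_measurable) (use sub lattice_paths_edges in \<open>auto intro!: \<tau>_measurable\<close>, blast)
  have TW: "T 0 z \<omega> \<le> W n \<omega>" if "\<omega> \<in> space M" for n \<omega>
    unfolding T_def W_def by (rule passage_le_finite_passage[OF weights_\<tau>[OF that]]) (use sub in auto)
  have Wle: "W n \<omega> \<le> path_time (\<lambda>e. \<tau> e \<omega>) (en k)" if "k \<le> n" for n k \<omega>
    unfolding W_def finite_passage_def using that by (intro Min_le) auto
  have P0: "finite (path_edges (en 0))" "path_edges (en 0) \<subseteq> lattice_edges"
    using finite_path_edges lattice_paths_edges[of "en 0" 0 z] sub[of 0] by auto
  have int0: "integrable M (\<lambda>\<omega>. path_time (\<lambda>e. \<tau> e \<omega>) (en 0))"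
    unfolding path_time_def using P0 by (intro Bochner_Integration.integrable_sum c1) auto
  have bound: "norm (W n \<omega>) \<le> path_time (\<lambda>e. \<tau> e \<omega>) (en 0)" if "\<omega> \<in> space M" for n \<omega>
    using TW[OF that, of n] T_nonneg[OF that, of 0 z] Wle[of 0 n \<omega>] by simp
  have conv: "(\<lambda>n. W n \<omega>) \<longlonglongrightarrow> T 0 z \<omega>" if w: "\<omega> \<in> space M" for \<omega>
  proof (rule LIMSEQ_I)
    fix e :: real assume "e > 0"
    then obtain \<gamma> where \<gamma>: "\<gamma> \<in> lattice_paths 0 z" "path_time (\<lambda>e. \<tau> e \<omega>) \<gamma> < T 0 z \<omega> + e"
      using passage_near[OF weights_\<tau>[OF w]] unfolding T_def by blast
    then obtain k where k: "\<gamma> = en k" using ran by (metis imageE)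
    have "norm (W n \<omega> - T 0 z \<omega>) < e" if "n \<ge> k" for n
      using Wle[OF that, of \<omega>] TW[OF w, of n] \<gamma>(2) k by simp
    then show "\<exists>no. \<forall>n\<ge>no. norm (W n \<omega> - T 0 z \<omega>) < e" by blast
  qed
  have "(\<lambda>n. expectation (W n)) \<longlonglongrightarrow> mean_T z"
    unfolding mean_T_def
    by (rule integral_dominated_convergence[OF _ _ int0]) (auto intro!: AE_I2 conv bound simp del: real_norm_def)
  moreover have "mean_T z < mean_T z + \<eta>" using assms by simp
  ultimately have "\<forall>\<^sub>F n in sequentially. expectation (W n) < mean_T z + \<eta>" by (rule order_tendstoD(2))
  then obtain n where n: "expectation (W n) < mean_T z + \<eta>" by (auto simp: eventually_sequentially)
  have "integrable M (W n)"
    by (rule Bochner_Integration.integrable_bound[OF int0])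
      (auto intro!: AE_I2 order_trans[OF bound] simp del: real_norm_def, simp)
  with n sub show ?thesis unfolding W_def by (intro exI[of _ "en ` {..n}"]) auto
qed

text \<open>The Laplace transform of W - b equals one at \<theta> = 0 and has negative slope there,
  because the mean of W lies strictly below b. The explicit interval up to \<Lambda> allows one
  exponent to be shared by finitely many blocks.\<close>

lemma finite_passage_laplace:
  assumes \<Gamma>: "finite \<Gamma>" "\<Gamma> \<noteq> {}" "\<Gamma> \<subseteq> lattice_paths 0 z"
    and int: "integrable M (\<lambda>\<omega>. finite_passage (\<lambda>e. \<tau> e \<omega>) \<Gamma>)"
    and b: "expectation (\<lambda>\<omega>. finite_passage (\<lambda>e. \<tau> e \<omega>) \<Gamma>) < b"
  shows "\<exists>\<Lambda>>0. \<forall>\<theta>. 0 < \<theta> \<and> \<theta> \<le> \<Lambda> \<longrightarrow>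
    (\<integral>\<^sup>+\<omega>. ennreal (exp (\<theta> * (finite_passage (\<lambda>e. \<tau> e \<omega>) \<Gamma> - b))) \<partial>M) \<le> 1"
proof -
  define W where "W \<omega> = finite_passage (\<lambda>e. \<tau> e \<omega>) \<Gamma>" for \<omega>
  obtain \<gamma> where \<gamma>: "\<gamma> \<in> \<Gamma>" using \<Gamma>(2) by blast
  define P where "P = path_edges \<gamma>"
  have P: "finite P" "P \<subseteq> lattice_edges"
    unfolding P_def using finite_path_edges lattice_paths_edges[of \<gamma> 0 z] \<gamma> \<Gamma>(3) by auto
  have Wm [measurable]: "W \<in> borel_measurable M"
    unfolding W_def[abs_def] using int by (rule borel_measurable_integrable)
  have W0: "0 \<le> W \<omega>" if "\<omega> \<in> space M" for \<omega>
    using passage_le_finite_passage[OF weights_\<tau>[OF that] \<Gamma>] passage_nonneg[OF weights_\<tau>[OF that], of 0 z]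
    unfolding W_def by simp
  have WP: "W \<omega> \<le> (\<Sum>e\<in>P. \<tau> e \<omega>)" for \<omega>
    unfolding W_def finite_passage_def using \<Gamma> \<gamma> by (intro Min_le) (auto simp: path_time_def P_def)
  obtain C where C: "C \<ge> 0" "\<And>e s. e \<in> lattice_edges \<Longrightarrow> s \<ge> 0 \<Longrightarrow>
    (\<integral>\<^sup>+\<omega>. ennreal (exp (s * \<tau> e \<omega>)) \<partial>M) \<le> ennreal (exp (C * (s + s powr (r / (r - 1)))))"
    using laplace_bound[OF r1] by blast
  define D where "D = exp (C * 2) ^ card P"
  have D: "D > 0" by (simp add: D_def)
  have expW: "(\<integral>\<^sup>+\<omega>. ennreal (exp (W \<omega>)) \<partial>M) \<le> ennreal D"
  proof -
    have "(\<integral>\<^sup>+\<omega>. ennreal (exp (W \<omega>)) \<partial>M) \<le> (\<integral>\<^sup>+\<omega>. (\<Prod>e\<in>P. ennreal (exp (1 * \<tau> e \<omega>))) \<partial>M)"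
      using WP by (intro nn_integral_mono) (simp add: prod_ennreal exp_sum[OF P(1), symmetric] ennreal_leI)
    also have "\<dots> = (\<Prod>e\<in>P. \<integral>\<^sup>+\<omega>. ennreal (exp (1 * \<tau> e \<omega>)) \<partial>M)"
      by (rule nn_integral_edges[OF P, of "\<lambda>_ x. ennreal (exp (1 * x))"]) measurable
    also have "\<dots> \<le> (\<Prod>e\<in>P. ennreal (exp (C * (1 + 1 powr (r / (r - 1))))))"
      using P by (intro prod_mono_ennreal C(2)) auto
    also have "\<dots> = ennreal D" by (simp add: D_def ennreal_power)
    finally show ?thesis .
  qed
  define m where "m = expectation W"
  have m: "m < b" using b unfolding m_def W_def .
  have nnW: "(\<integral>\<^sup>+\<omega>. ennreal (W \<omega>) \<partial>M) = ennreal m"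
    unfolding m_def using int W0 by (intro nn_integral_eq_integral) (auto simp: W_def)
  have m0: "m \<ge> 0" unfolding m_def by (intro Bochner_Integration.integral_nonneg W0)
  \<comment> \<open>The bound 1/2 lets exp W dominate the quadratic remainder, and the other one
    makes this remainder smaller than the gain \<theta> (b - m).\<close>
  define \<Lambda> where "\<Lambda> = min (1 / 2) ((b - m) / (8 * D))"
  have \<Lambda>: "\<Lambda> > 0" using m D by (simp add: \<Lambda>_def)
  have "(\<integral>\<^sup>+\<omega>. ennreal (exp (\<theta> * (W \<omega> - b))) \<partial>M) \<le> 1" if \<theta>: "0 < \<theta>" "\<theta> \<le> \<Lambda>" for \<theta>
  proof -
    \<comment> \<open>Second order expansion of exp. The squared factor is absorbed by exp (y/2),
      and since \<theta> \<le> 1/2 the remaining factor exp (\<theta> y) is at most exp (y/2)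
      too.\<close>
    have pt: "exp (\<theta> * y) \<le> 1 + \<theta> * y + 8 * \<theta>\<^sup>2 * exp y" if y: "y \<ge> 0" for y
    proof -
      have "\<theta> \<le> 1 / 2" using \<theta> by (simp add: \<Lambda>_def)
      have ub: "exp u \<le> 1 + u + u\<^sup>2 * exp u" if "u \<ge> 0" for u :: real
      proof -
        have "1 - u \<le> exp (- u)" using exp_ge_add_one_self[of "- u"] by simp
        then have "(1 - u) * exp u \<le> 1" by (simp add: exp_minus field_simps)
        then have "exp u - 1 \<le> u * exp u" by (simp add: algebra_simps)
        then have "u * (exp u - 1) \<le> u * (u * exp u)" using that by (intro mult_left_mono)
        moreover have "exp u - 1 - u \<le> u * (exp u - 1)"
        proof -
          have "exp u - 1 \<le> u * exp u" by fact
          then show ?thesis by (simp add: algebra_simps)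
        qed
        ultimately show ?thesis by (simp add: power2_eq_square)
      qed
      have "1 + y / 2 + (y / 2)\<^sup>2 / 2 \<le> exp (y / 2)" using y by (intro exp_lower_Taylor_quadratic) simp
      then have y2: "y\<^sup>2 \<le> 8 * exp (y / 2)" using y by (simp add: power2_eq_square field_simps)
      have "\<theta> * y \<le> y / 2" using mult_right_mono[OF \<open>\<theta> \<le> 1 / 2\<close> y] by simp
      then have "y\<^sup>2 * exp (\<theta> * y) \<le> 8 * exp (y / 2) * exp (y / 2)"
        using y2 by (intro mult_mono) auto
      also have "\<dots> = 8 * exp y" by (simp add: exp_add[symmetric])
      finally have "\<theta>\<^sup>2 * (y\<^sup>2 * exp (\<theta> * y)) \<le> \<theta>\<^sup>2 * (8 * exp y)" by (intro mult_left_mono) auto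
      then have "(\<theta> * y)\<^sup>2 * exp (\<theta> * y) \<le> 8 * \<theta>\<^sup>2 * exp y" by (simp add: power_mult_distrib mult_ac)
      then show ?thesis using ub[of "\<theta> * y"] y \<theta> by simp
    qed
    have "(\<integral>\<^sup>+\<omega>. ennreal (exp (\<theta> * (W \<omega> - b))) \<partial>M)
      \<le> (\<integral>\<^sup>+\<omega>. ennreal (exp (- (\<theta> * b))) * (1 + ennreal \<theta> * ennreal (W \<omega>) + ennreal (8 * \<theta>\<^sup>2) * ennreal (exp (W \<omega>))) \<partial>M)"
    proof (intro nn_integral_mono)
      fix \<omega> assume w: "\<omega> \<in> space M"
      have "exp (\<theta> * (W \<omega> - b)) = exp (- (\<theta> * b)) * exp (\<theta> * W \<omega>)"
        by (simp add: exp_add[symmetric] algebra_simps)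
      also have "\<dots> \<le> exp (- (\<theta> * b)) * (1 + \<theta> * W \<omega> + 8 * \<theta>\<^sup>2 * exp (W \<omega>))"
        by (intro mult_left_mono pt W0 w) auto
      finally have "ennreal (exp (\<theta> * (W \<omega> - b))) \<le> ennreal (exp (- (\<theta> * b)) * (1 + \<theta> * W \<omega> + 8 * \<theta>\<^sup>2 * exp (W \<omega>)))"
        by (rule ennreal_leI)
      also have "\<dots> = ennreal (exp (- (\<theta> * b))) * (1 + ennreal \<theta> * ennreal (W \<omega>) + ennreal (8 * \<theta>\<^sup>2) * ennreal (exp (W \<omega>)))"
        using W0[OF w] \<theta> by (simp add: ennreal_mult ennreal_plus)
      finally show "ennreal (exp (\<theta> * (W \<omega> - b))) \<le> \<dots>" .
    qed
    also have "\<dots> = ennreal (exp (- (\<theta> * b))) * (1 + ennreal \<theta> * ennreal m + ennreal (8 * \<theta>\<^sup>2) * (\<integral>\<^sup>+\<omega>. ennreal (exp (W \<omega>)) \<partial>M))"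
      by (simp add: nn_integral_cmult nn_integral_add nnW emeasure_space_1)
    also have "\<dots> \<le> ennreal (exp (- (\<theta> * b))) * (1 + ennreal \<theta> * ennreal m + ennreal (8 * \<theta>\<^sup>2) * ennreal D)"
      by (intro mult_left_mono add_mono expW order_refl) auto
    also have "\<dots> = ennreal (exp (- (\<theta> * b)) * (1 + \<theta> * m + 8 * \<theta>\<^sup>2 * D))"
      using \<theta> m0 D by (simp add: ennreal_mult ennreal_plus)
    also have "\<dots> \<le> ennreal 1"
    proof (rule ennreal_leI)
      have "\<theta> * (8 * D) \<le> b - m" using \<theta> D by (simp add: \<Lambda>_def pos_le_divide_eq)
      then have "\<theta> * (\<theta> * (8 * D)) \<le> \<theta> * (b - m)" using \<theta> by (intro mult_left_mono) auto
      then have "1 + \<theta> * m + 8 * \<theta>\<^sup>2 * D \<le> 1 + \<theta> * b" by (simp add: power2_eq_square algebra_simps)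
      also have "\<dots> \<le> exp (\<theta> * b)" by (rule exp_ge_add_one_self)
      finally have "exp (- (\<theta> * b)) * (1 + \<theta> * m + 8 * \<theta>\<^sup>2 * D) \<le> exp (- (\<theta> * b)) * exp (\<theta> * b)"
        by (intro mult_left_mono) auto
      then show "exp (- (\<theta> * b)) * (1 + \<theta> * m + 8 * \<theta>\<^sup>2 * D) \<le> 1" by (simp add: exp_minus)
    qed
    finally show ?thesis by simp
  qed
  with \<Lambda> show ?thesis unfolding W_def by blast
qed

end

lemma finite_l1_ball: "finite {y :: 'd::finite vertex. l1_norm y \<le> c}"
proof (rule finite_subset[OF _ finite_lattice_box[of "real_of_int c"]])
  show "{y :: 'd vertex. l1_norm y \<le> c} \<subseteq> lattice_box (real_of_int c)"
    unfolding lattice_box_def using linf_le_l1_norm order_trans by (fastforce simp: of_int_le_iff)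
qed

context percolation
begin

lemma nn_integral_shift:
  assumes [measurable]: "G \<in> borel_measurable (PiM lattice_edges (\<lambda>_. borel))"
  shows "(\<integral>\<^sup>+\<omega>. G (\<lambda>e\<in>lattice_edges. \<tau> ((+) a ` e) \<omega>) \<partial>M)
     = (\<integral>\<^sup>+\<omega>. G (\<lambda>e\<in>lattice_edges. \<tau> e \<omega>) \<partial>M)"
  using arg_cong[OF distr_shift, of "\<lambda>N. integral\<^sup>N N G" a]
  by (simp add: nn_integral_distr restrict_shift_measurable restrict_\<tau>_measurable)

lemma nn_integral_finite_passage_shift:
  assumes \<Gamma>: "finite \<Gamma>" "\<Gamma> \<noteq> {}" "\<Gamma> \<subseteq> lattice_paths 0 y"
  shows "(\<integral>\<^sup>+\<omega>. ennreal (exp (\<theta> * (finite_passage (\<lambda>e. \<tau> ((+) a ` e) \<omega>) \<Gamma> - b))) \<partial>M)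
     = (\<integral>\<^sup>+\<omega>. ennreal (exp (\<theta> * (finite_passage (\<lambda>e. \<tau> e \<omega>) \<Gamma> - b))) \<partial>M)"
proof -
  have edges: "e \<in> lattice_edges" if "\<gamma> \<in> \<Gamma>" "e \<in> path_edges \<gamma>" for e \<gamma>
    using that \<Gamma>(3) lattice_paths_edges by blast
  have m [measurable]: "(\<lambda>t. finite_passage t \<Gamma>) \<in> borel_measurable (PiM lattice_edges (\<lambda>_. borel))"
    by (rule finite_passage_measurable[OF \<Gamma>(1,2)]) (rule measurable_component_singleton, rule edges)
  have m': "(\<lambda>t. ennreal (exp (\<theta> * (finite_passage t \<Gamma> - b)))) \<in> borel_measurable (PiM lattice_edges (\<lambda>_. borel))"
    by measurable
  have "finite_passage (\<lambda>e\<in>lattice_edges. t e) \<Gamma> = finite_passage t \<Gamma>" for t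
    by (rule finite_passage_cong) (simp add: edges)
  with nn_integral_shift[OF m', of a] show ?thesis by simp
qed

end

context percolation_superlinear
begin

lemma time_constant_nonneg: "time_constant M \<tau> x \<ge> 0"
  by (rule tendsto_lowerbound[OF time_constant_limit_nat[of x]]) (auto simp: mean_T_nonneg)

text \<open>Blocks of a chain have displacements in a finite set, so that finitely many paths and
  one exponent serve all of them.\<close>

lemma block_system:
  fixes Z :: "'d vertex set"
  assumes Z: "finite Z" "Z \<noteq> {}"
  shows "\<exists>\<Gamma> \<theta> L. \<theta> > 0 \<and> (\<forall>y\<in>Z. finite (\<Gamma> y) \<and> \<Gamma> y \<noteq> {} \<and> \<Gamma> y \<subseteq> lattice_paths 0 y \<and>
      (\<integral>\<^sup>+\<omega>. ennreal (exp (\<theta> * (finite_passage (\<lambda>e. \<tau> e \<omega>) (\<Gamma> y) - (mean_T y + 1)))) \<partial>M) \<le> 1 \<and>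
      (\<forall>\<gamma>\<in>\<Gamma> y. \<forall>e\<in>path_edges \<gamma>. \<forall>v\<in>e. linf_norm v \<le> int L))"
proof -
  have "\<exists>\<Gamma> \<Lambda>. \<Lambda> > 0 \<and> finite \<Gamma> \<and> \<Gamma> \<noteq> {} \<and> \<Gamma> \<subseteq> lattice_paths 0 y \<and> (\<forall>\<theta>. 0 < \<theta> \<and> \<theta> \<le> \<Lambda> \<longrightarrow>
    (\<integral>\<^sup>+\<omega>. ennreal (exp (\<theta> * (finite_passage (\<lambda>e. \<tau> e \<omega>) \<Gamma> - (mean_T y + 1)))) \<partial>M) \<le> 1)" for y
  proof -
    obtain \<Gamma> where \<Gamma>: "finite \<Gamma>" "\<Gamma> \<noteq> {}" "\<Gamma> \<subseteq> lattice_paths 0 y"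
      "integrable M (\<lambda>\<omega>. finite_passage (\<lambda>e. \<tau> e \<omega>) \<Gamma>)"
      "expectation (\<lambda>\<omega>. finite_passage (\<lambda>e. \<tau> e \<omega>) \<Gamma>) < mean_T y + 1"
      using finite_passage_approx[of 1 y] by auto
    from finite_passage_laplace[OF this] \<Gamma> show ?thesis by blast
  qed
  then obtain \<Gamma> \<Lambda> where *: "\<And>y. \<Lambda> y > 0 \<and> finite (\<Gamma> y) \<and> \<Gamma> y \<noteq> {} \<and> \<Gamma> y \<subseteq> lattice_paths 0 y \<and> (\<forall>\<theta>. 0 < \<theta> \<and> \<theta> \<le> \<Lambda> y \<longrightarrow>
    (\<integral>\<^sup>+\<omega>. ennreal (exp (\<theta> * (finite_passage (\<lambda>e. \<tau> e \<omega>) (\<Gamma> y) - (mean_T y + 1)))) \<partial>M) \<le> 1)"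
    by metis
  define \<theta> where "\<theta> = Min (\<Lambda> ` Z)"
  have \<theta>: "\<theta> > 0" unfolding \<theta>_def using Z * by (subst Min_gr_iff) auto
  have \<theta>le: "\<theta> \<le> \<Lambda> y" if "y \<in> Z" for y unfolding \<theta>_def using Z that by (intro Min_le) auto
  define V where "V = \<Union> (\<Union>y\<in>Z. \<Union>\<gamma>\<in>\<Gamma> y. path_edges \<gamma>)"
  have "finite V"
    unfolding V_def
  proof (rule finite_Union)
    show "finite (\<Union>y\<in>Z. \<Union>\<gamma>\<in>\<Gamma> y. path_edges \<gamma>)"
      using Z * by (intro finite_UN_I finite_path_edges) auto
    fix e assume "e \<in> (\<Union>y\<in>Z. \<Union>\<gamma>\<in>\<Gamma> y. path_edges \<gamma>)"
    then show "finite e" unfolding path_edges_def by auto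
  qed
  define L where "L = nat (\<Sum>v\<in>V. linf_norm v)"
  have L: "linf_norm v \<le> int L" if "v \<in> V" for v
  proof -
    have "linf_norm v \<le> (\<Sum>v\<in>V. linf_norm v)"
      using that \<open>finite V\<close> by (intro member_le_sum) (auto simp: linf_norm_nonneg)
    then show ?thesis by (simp add: L_def)
  qed
  show ?thesis
  proof (intro exI[of _ \<Gamma>] exI[of _ \<theta>] exI[of _ L] conjI ballI)
    fix y assume y: "y \<in> Z"
    show "finite (\<Gamma> y)" "\<Gamma> y \<noteq> {}" "\<Gamma> y \<subseteq> lattice_paths 0 y" using * by auto
    show "(\<integral>\<^sup>+\<omega>. ennreal (exp (\<theta> * (finite_passage (\<lambda>e. \<tau> e \<omega>) (\<Gamma> y) - (mean_T y + 1)))) \<partial>M) \<le> 1"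
      using * \<theta> \<theta>le[OF y] by blast
    fix \<gamma> e v assume "\<gamma> \<in> \<Gamma> y" "e \<in> path_edges \<gamma>" "v \<in> e"
    then show "linf_norm v \<le> int L" using y by (intro L) (auto simp: V_def)
  qed (rule \<theta>)
qed

end

section \<open>Parallel chains of blocks between the two simplices\<close>

context signed_percolation
begin

text \<open>Every coordinate of the rounded point moves weakly in its sign direction, and coordinate
  i0 moves by at least one unit. Successive block ends thus lie on strictly increasing
  levels.\<close>

lemma level_floor_increasing:
  fixes x :: "real ^ 'd"
  assumes sx: "\<And>i. 0 \<le> real_of_int (\<sigma> i) * x $ i" and m: "real m * \<bar>x $ i0\<bar> \<ge> 1"
  shows "level (floor_vec (real (j * m) *\<^sub>R x)) < level (floor_vec (real (Suc j * m) *\<^sub>R x))"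
proof -
  have step: "\<lfloor>real (Suc j * m) * x $ i\<rfloor> = \<lfloor>real (j * m) * x $ i + real m * x $ i\<rfloor>" for i
    by (simp add: algebra_simps)
  have cases: "\<sigma> i = 1 \<or> \<sigma> i = -1" for i using abs_sign[of i] by linarith
  have ge0: "\<sigma> i * \<lfloor>real (j * m) * x $ i\<rfloor> \<le> \<sigma> i * \<lfloor>real (Suc j * m) * x $ i\<rfloor>" for i
    using cases[of i]
  proof
    assume "\<sigma> i = 1"
    then have "real m * x $ i \<ge> 0" using sx[of i] by simp
    then show ?thesis using \<open>\<sigma> i = 1\<close> unfolding step by (simp add: floor_mono)
  next
    assume "\<sigma> i = -1"
    then have "real m * x $ i \<le> 0" using sx[of i] by (simp add: mult_nonneg_nonpos)
    then show ?thesis using \<open>\<sigma> i = -1\<close> unfolding step by (simp add: floor_mono)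
  qed
  have gt: "\<sigma> i0 * \<lfloor>real (j * m) * x $ i0\<rfloor> < \<sigma> i0 * \<lfloor>real (Suc j * m) * x $ i0\<rfloor>"
    using cases[of i0]
  proof
    assume "\<sigma> i0 = 1"
    then have "real m * x $ i0 \<ge> 1" using sx[of i0] m by simp
    then have "\<lfloor>real (j * m) * x $ i0\<rfloor> + 1 \<le> \<lfloor>real (j * m) * x $ i0 + real m * x $ i0\<rfloor>" by linarith
    then show ?thesis using \<open>\<sigma> i0 = 1\<close> unfolding step by simp
  next
    assume "\<sigma> i0 = -1"
    then have "\<bar>x $ i0\<bar> = - x $ i0" using sx[of i0] by simp
    then have "real m * x $ i0 \<le> -1" using m by simp
    then have "\<lfloor>real (j * m) * x $ i0 + real m * x $ i0\<rfloor> + 1 \<le> \<lfloor>real (j * m) * x $ i0\<rfloor>" by linarith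
    then show ?thesis using \<open>\<sigma> i0 = -1\<close> unfolding step by simp
  qed
  show ?thesis
    unfolding level_def floor_vec_def using ge0 gt
    by (intro sum_strict_mono_ex1) auto
qed

text \<open>Each simplex point starts a translated copy of one chain of about n/m blocks of length
  m. Block starts are pairwise distinct, and those congruent modulo 2L + 1 have disjoint blocks, so
  the bounded number of colours leaves an exponent proportional to the number of blocks, hence to n
  times the size of the simplex. The fixed shift w of the endpoint allows later for exits from a
  trap.\<close>

lemma bulk_tail:
  fixes x :: "real ^ 'd" and w :: "'d vertex"
  assumes sx: "\<And>i. 0 \<le> real_of_int (\<sigma> i) * x $ i" and x0: "x \<noteq> 0" and \<delta>: "\<delta> > 0"
  defines "z \<equiv> \<lambda>n. floor_vec (real n *\<^sub>R x)"
  shows "\<exists>Q \<kappa>. Q \<ge> 0 \<and> \<kappa> > 0 \<and> (\<forall>\<^sub>F n in sequentially. \<forall>N.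
    prob {\<omega>\<in>space M. (\<Sum>u\<in>nat_simplex N. T (orthant \<sigma> u) (z n + w + orthant \<sigma> u) \<omega>)
        \<ge> (time_constant M \<tau> x + \<delta>) * real n * simplex_card TYPE('d) N}
    \<le> Q * exp (- (\<kappa> * real n * simplex_card TYPE('d) N)))"
proof -
  define \<mu> where "\<mu> = time_constant M \<tau> x"
  have \<mu>0: "\<mu> \<ge> 0" unfolding \<mu>_def by (rule time_constant_nonneg)
  obtain i0 where i0: "x $ i0 \<noteq> 0" using x0 by (auto simp: vec_eq_iff)
  define d where "d = real CARD('d)"
  have "\<forall>\<^sub>F m in sequentially. mean_T (z m) / real m < \<mu> + \<delta> / 8"
    using time_constant_limit_nat[of x] \<delta> unfolding z_def \<mu>_def by (intro order_tendstoD) auto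
  \<comment> \<open>The first summand makes each block gain a level. The second makes the cost per
    block of rounding, c1 d, and of the extra 1 in \<open>block_system\<close> at most \<delta>/8 of
    the block length.\<close>
  moreover have "\<forall>\<^sub>F m in sequentially. real m \<ge> 1 / \<bar>x $ i0\<bar> + 8 * (c1 * d + 1) / \<delta> + 1"
    by (rule eventually_sequentiallyI[of "nat \<lceil>1 / \<bar>x $ i0\<bar> + 8 * (c1 * d + 1) / \<delta> + 1\<rceil>"]) linarith
  ultimately have "\<forall>\<^sub>F m in sequentially. mean_T (z m) / real m < \<mu> + \<delta> / 8 \<and>
      real m \<ge> 1 / \<bar>x $ i0\<bar> + 8 * (c1 * d + 1) / \<delta> + 1" by eventually_elim simp
  then obtain m where m: "mean_T (z m) / real m < \<mu> + \<delta> / 8"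
      "real m \<ge> 1 / \<bar>x $ i0\<bar> + 8 * (c1 * d + 1) / \<delta> + 1"
    unfolding eventually_sequentially by blast
  have p1: "1 / \<bar>x $ i0\<bar> \<ge> 0" "8 * (c1 * d + 1) / \<delta> \<ge> 0"
    using \<delta> c1(1) by (auto simp: d_def intro!: divide_nonneg_pos add_nonneg_nonneg)
  have m1: "real m \<ge> 1" "m > 0" using m(2) p1 by linarith+
  have mx: "real m * \<bar>x $ i0\<bar> \<ge> 1"
  proof -
    have "1 / \<bar>x $ i0\<bar> \<le> real m" using m(2) p1 by linarith
    then show ?thesis using i0 by (simp add: field_simps)
  qed
  have md: "c1 * d + 1 \<le> \<delta> / 8 * real m"
  proof -
    have "8 * (c1 * d + 1) / \<delta> \<le> real m" using m(2) p1 by linarith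
    then show ?thesis using \<delta> by (simp add: field_simps)
  qed
  have mz: "mean_T (z m) \<le> (\<mu> + \<delta> / 8) * real m" using m(1) m1 by (simp add: field_simps)
  define a where "a j = z (j * m)" for j
  have a_mono: "level (a j) < level (a (Suc j))" for j
    unfolding a_def z_def by (rule level_floor_increasing[OF sx mx])
  then have a_strict: "strict_mono (\<lambda>j. level (a j))" by (rule strict_mono_Suc_iff[THEN iffD2, OF allI])
  have add: "l1_norm (floor_vec ((s + t) *\<^sub>R x) - floor_vec (s *\<^sub>R x) - floor_vec (t *\<^sub>R x)) \<le> int CARD('d)" for s t
    using l1_floor_vec_add[of "s *\<^sub>R x" "t *\<^sub>R x"] by (simp add: scaleR_add_left)
  have inc: "l1_norm (a (Suc j) - a j - z m) \<le> int CARD('d)" for j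
    using add[of "real (j * m)" "real m"] unfolding a_def z_def by (simp add: algebra_simps)
  define A where "A = (\<Sum>i\<in>UNIV. \<bar>x $ i\<bar>) + real CARD('d)"
  have A0: "A \<ge> 0" unfolding A_def by (intro add_nonneg_nonneg sum_nonneg) auto
  \<comment> \<open>A common bound for all displacements, including the last incomplete block and
    the shift w. It does not depend on n, so finitely many block types suffice.\<close>
  define Cm where "Cm = l1_norm (z m) + int CARD('d) + \<lceil>A * (real m + 1)\<rceil> + l1_norm w"
  define Z where "Z = {y :: 'd vertex. l1_norm y \<le> Cm}"
  have ceil: "A * (real m + 1) \<le> real_of_int \<lceil>A * (real m + 1)\<rceil>" "\<lceil>A * (real m + 1)\<rceil> \<ge> 0"
    using A0 by (auto intro: order_trans[of _ "0::real"] mult_nonneg_nonneg simp: zero_le_ceiling less_le_trans[of "-1" 0])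
  have Cm0: "Cm \<ge> 0" unfolding Cm_def using l1_norm_nonneg[of "z m"] l1_norm_nonneg[of w] ceil by linarith
  have "0 \<in> Z" unfolding Z_def using Cm0 l1_norm_0_iff[of "0 :: 'd vertex"] by simp
  then have Z: "finite Z" "Z \<noteq> {}" unfolding Z_def using finite_l1_ball by auto
  obtain \<Gamma> \<theta> L where \<theta>: "\<theta> > 0" and all: "\<forall>y\<in>Z. finite (\<Gamma> y) \<and> \<Gamma> y \<noteq> {} \<and> \<Gamma> y \<subseteq> lattice_paths 0 y \<and>
      (\<integral>\<^sup>+\<omega>. ennreal (exp (\<theta> * (finite_passage (\<lambda>e. \<tau> e \<omega>) (\<Gamma> y) - (mean_T y + 1)))) \<partial>M) \<le> 1 \<and>
      (\<forall>\<gamma>\<in>\<Gamma> y. \<forall>e\<in>path_edges \<gamma>. \<forall>v\<in>e. linf_norm v \<le> int L)"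
    using block_system[OF Z] by (elim exE conjE) (rule that)
  note sys = \<theta> all[THEN bspec, THEN conjunct1] all[THEN bspec, THEN conjunct2, THEN conjunct1]
    all[THEN bspec, THEN conjunct2, THEN conjunct2, THEN conjunct1]
    all[THEN bspec, THEN conjunct2, THEN conjunct2, THEN conjunct2, THEN conjunct1]
    all[THEN bspec, THEN conjunct2, THEN conjunct2, THEN conjunct2, THEN conjunct2, THEN bspec, THEN bspec, THEN bspec]
  \<comment> \<open>Starts of two overlapping blocks differ by at most 2L in each coordinate;
    congruence modulo 2L + 1 then forces them to be equal.\<close>
  define L' where "L' = 2 * int L + 1"
  define Qs where "Qs = {v :: 'd vertex. \<forall>k. 0 \<le> v $ k \<and> v $ k < L'}"
  have Qs: "finite Qs" "Qs \<noteq> {}"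
  proof -
    have "Qs \<subseteq> lattice_box (real_of_int L')"
      unfolding Qs_def lattice_box_def by (auto simp: of_int_le_iff linf_norm_le_iff less_imp_le)
    then show "finite Qs" using finite_lattice_box finite_subset by blast
    have "0 \<in> Qs" unfolding Qs_def L'_def by auto
    then show "Qs \<noteq> {}" by blast
  qed
  define bmax where "bmax = c1 * real_of_int Cm + 1"
  define \<kappa> where "\<kappa> = \<theta> * (\<delta> / 4) / real (card Qs)"
  have cQ: "real (card Qs) > 0" using Qs by (simp add: card_gt_0_iff)
  have \<kappa>: "\<kappa> > 0" unfolding \<kappa>_def using sys(1) \<delta> cQ by (intro divide_pos_pos mult_pos_pos) auto
  have "\<forall>\<^sub>F n in sequentially. real n \<ge> 2 * bmax / \<delta>"
    by (rule eventually_sequentiallyI[of "nat \<lceil>2 * bmax / \<delta>\<rceil>"]) linarith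
  then have "\<forall>\<^sub>F n in sequentially. \<forall>N.
    prob {\<omega>\<in>space M. (\<Sum>u\<in>nat_simplex N. T (orthant \<sigma> u) (z n + w + orthant \<sigma> u) \<omega>)
        \<ge> (\<mu> + \<delta>) * real n * simplex_card TYPE('d) N}
    \<le> real (card Qs) * exp (- (\<kappa> * real n * simplex_card TYPE('d) N))"
  proof (eventually_elim, intro allI)
    fix n N assume n: "real n \<ge> 2 * bmax / \<delta>"
    define q where "q = n div m"
    define D where "D = simplex_card TYPE('d) N"
    have D0: "D > 0" unfolding D_def by (rule simplex_card_pos)
    \<comment> \<open>Index q stands for the final block, which absorbs the remainder of n modulo m
      and the shift w.\<close>
    define disp where "disp j = (if j < q then a (Suc j) - a j else z n + w - a q)" for j
    have qm: "q * m \<le> n" "n - q * m < m" unfolding q_def using m1 by (auto simp: minus_div_mult_eq_mod)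
    have Z1: "l1_norm (disp j) \<le> l1_norm (z m) + int CARD('d)" if "j < q" for j
    proof -
      have "l1_norm (z m + (a (Suc j) - a j - z m)) \<le> l1_norm (z m) + l1_norm (a (Suc j) - a j - z m)"
        by (rule l1_norm_triangle)
      then show ?thesis using inc[of j] that by (simp add: disp_def)
    qed
    have Z2: "l1_norm (z n + w - a q) \<le> int CARD('d) + \<lceil>A * (real m + 1)\<rceil> + l1_norm w"
    proof -
      define k where "k = n - q * m"
      have k: "real n = real (q * m) + real k" unfolding k_def using qm by (simp add: of_nat_diff)
      have "l1_norm (z n - a q - z k) \<le> int CARD('d)"
        using add[of "real (q * m)" "real k"] unfolding a_def z_def k .
      moreover have "real_of_int (l1_norm (z k)) \<le> A * (real k + 1)"
        unfolding z_def A_def by (rule l1_floor_vec_le) simp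
      moreover have "A * (real k + 1) \<le> A * (real m + 1)"
        using qm(2) A0 by (intro mult_left_mono) (auto simp: k_def)
      ultimately have "l1_norm (z k) \<le> \<lceil>A * (real m + 1)\<rceil>" by linarith
      moreover have "l1_norm ((z n - a q - z k) + (z k + w)) \<le> l1_norm (z n - a q - z k) + l1_norm (z k + w)"
        by (rule l1_norm_triangle)
      moreover have "l1_norm (z k + w) \<le> l1_norm (z k) + l1_norm w" by (rule l1_norm_triangle)
      moreover have "(z n - a q - z k) + (z k + w) = z n + w - a q" by simp
      ultimately show ?thesis using \<open>l1_norm (z n - a q - z k) \<le> int CARD('d)\<close> by simp
    qed
    have dispZ: "disp j \<in> Z" for j
    proof (cases "j < q")
      case True
      then show ?thesis using Z1[OF True] ceil(2) l1_norm_nonneg[of w] unfolding Z_def Cm_def mem_Collect_eq by linarith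
    next
      case False
      then show ?thesis using Z2 l1_norm_nonneg[of "z m"] unfolding Z_def Cm_def disp_def by simp
    qed
    define I where "I = {..q} \<times> (nat_simplex N :: ('d \<Rightarrow> nat) set)"
    define p where "p = (\<lambda>(j, u). a j + orthant \<sigma> u)"
    define E where "E i = (`) ((+) (p i)) ` (\<Union>\<gamma>\<in>\<Gamma> (disp (fst i)). path_edges \<gamma>)" for i
    define g where "g i t = finite_passage (\<lambda>e. t ((+) (p i) ` e)) (\<Gamma> (disp (fst i)))"
      for i :: "nat \<times> ('d \<Rightarrow> nat)" and t :: "'d edge \<Rightarrow> real"
    define b where "b i = mean_T (disp (fst i)) + 1" for i :: "nat \<times> ('d \<Rightarrow> nat)"
    define col where "col i = (\<chi> k. p i $ k mod L')" for i
    \<comment> \<open>What remains of \<delta> after \<open>sumb\<close>: the regular blocks use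
      \<delta>/4 and the final one \<delta>/2.\<close>
    define s where "s = \<delta> / 4 * real n * D"
    have finI: "finite I" unfolding I_def by (simp add: finite_simplex)
    have inj_p: "i = j" if "i \<in> I" "j \<in> I" "p i = p j" for i j
    proof -
      obtain j1 u1 where i: "i = (j1, u1)" by (cases i)
      obtain j2 u2 where j: "j = (j2, u2)" by (cases j)
      have u: "sum u1 UNIV = N" "sum u2 UNIV = N" using that i j by (auto simp: I_def nat_simplex_def)
      have eq: "a j1 + orthant \<sigma> u1 = a j2 + orthant \<sigma> u2" using that(3) i j by (simp add: p_def)
      \<comment> \<open>All simplex points share the level N, so the level of a block start
        identifies its index in the chain.\<close>
      from arg_cong[OF this, of level] have "level (a j1) = level (a j2)"
        by (simp add: level_add level_orthant u)
      then have "j1 = j2" using strict_mono_eq[OF a_strict] by blast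
      then have "u1 = u2" using eq injD[OF inj_orthant] by auto
      with \<open>j1 = j2\<close> show ?thesis using i j by simp
    qed
    have path_lat: "path_edges \<gamma> \<subseteq> lattice_edges" if "\<gamma> \<in> \<Gamma> (disp j)" for \<gamma> j
      using that sys(4)[OF dispZ] lattice_paths_edges by blast
    have Elat: "E i \<subseteq> lattice_edges" for i
      unfolding E_def using path_lat by (auto intro!: shift_lattice_edges)
    have colQ: "col i \<in> Qs" for i
      using pos_mod_bound[of L'] pos_mod_sign[of L'] unfolding col_def Qs_def by (simp add: L'_def)
    have disj: "E i \<inter> E j = {}" if "i \<in> I" "j \<in> I" "col i = col j" "i \<noteq> j" for i j
    proof (rule ccontr)
      assume "E i \<inter> E j \<noteq> {}"
      then obtain \<gamma> \<gamma>' e e' where e: "\<gamma> \<in> \<Gamma> (disp (fst i))" "e \<in> path_edges \<gamma>"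
        "\<gamma>' \<in> \<Gamma> (disp (fst j))" "e' \<in> path_edges \<gamma>'" "(+) (p i) ` e = (+) (p j) ` e'"
        unfolding E_def by blast
      obtain v where v: "v \<in> e" using e(2) unfolding path_edges_def by blast
      then have "p i + v \<in> (+) (p j) ` e'" using e(5) by blast
      then obtain v' where v': "v' \<in> e'" "p i + v = p j + v'" by blast
      have "linf_norm v \<le> int L" "linf_norm v' \<le> int L"
        using sys(6)[OF dispZ e(1,2) v] sys(6)[OF dispZ e(3,4) v'(1)] by auto
      have "p i $ k = p j $ k" for k
      proof -
        have "p i $ k + v $ k = p j $ k + v' $ k" using v'(2) by (metis vector_add_component)
        moreover have "\<bar>v $ k\<bar> \<le> int L" "\<bar>v' $ k\<bar> \<le> int L"
          using \<open>linf_norm v \<le> int L\<close> \<open>linf_norm v' \<le> int L\<close> by (auto simp: linf_norm_le_iff)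
        ultimately have "\<bar>p i $ k - p j $ k\<bar> < L'" unfolding L'_def by linarith
        moreover have "p i $ k mod L' = p j $ k mod L'" using that(3) unfolding col_def by (simp add: vec_eq_iff)
        then have "L' dvd p i $ k - p j $ k" by (simp add: mod_eq_dvd_iff)
        ultimately show ?thesis using dvd_imp_le_int[of "p i $ k - p j $ k" L'] by (auto simp: L'_def)
      qed
      then have "p i = p j" by (simp add: vec_eq_iff)
      then show False using inj_p that by blast
    qed
    have gm: "g i \<in> borel_measurable (PiM (E i) (\<lambda>_. borel))" for i
      unfolding g_def[abs_def]
      by (rule finite_passage_measurable[OF sys(2,3)[OF dispZ]])
        (rule measurable_component_singleton, auto simp: E_def)
    have geq: "g i (\<lambda>e\<in>E i. \<tau> e \<omega>) = finite_passage (\<lambda>e. \<tau> ((+) (p i) ` e) \<omega>) (\<Gamma> (disp (fst i)))" for i \<omega>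
      unfolding g_def by (rule finite_passage_cong) (auto simp: E_def)
    have ple: "prob {\<omega>\<in>space M. (\<Sum>i\<in>I. g i (\<lambda>e\<in>E i. \<tau> e \<omega>) - b i) \<ge> s}
       \<le> real (card Qs) * exp (- (\<theta> * s / real (card Qs)))"
    proof (rule coloured_Chernoff[OF finI Qs(1) _ Qs(2) Elat disj gm sys(1)])
      show "col ` I \<subseteq> Qs" using colQ by blast
      fix i
      show "(\<integral>\<^sup>+\<omega>. ennreal (exp (\<theta> * (g i (\<lambda>e\<in>E i. \<tau> e \<omega>) - b i))) \<partial>M) \<le> 1"
        unfolding geq b_def
        by (subst nn_integral_finite_passage_shift[OF sys(2,3,4)[OF dispZ]]) (rule sys(5)[OF dispZ])
    qed
    have sumb: "(\<Sum>i\<in>I. b i) \<le> (\<mu> + \<delta> * 3 / 4) * real n * D"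
    proof -
      have "(\<Sum>i\<in>I. b i) = (\<Sum>j\<le>q. \<Sum>u\<in>(nat_simplex N :: ('d \<Rightarrow> nat) set). mean_T (disp j) + 1)"
        unfolding I_def b_def sum.cartesian_product split_def ..
      also have "\<dots> = D * (\<Sum>j\<le>q. mean_T (disp j) + 1)"
        by (simp add: D_def simplex_card_def sum_distrib_left)
      also have "(\<Sum>j\<le>q. mean_T (disp j) + 1) = (\<Sum>j<q. mean_T (disp j) + 1) + (mean_T (disp q) + 1)"
        by (simp add: lessThan_Suc_atMost[symmetric])
      also have "(\<Sum>j<q. mean_T (disp j) + 1) \<le> (\<Sum>j<q. (\<mu> + \<delta> / 4) * real m)"
      proof (rule sum_mono)
        fix j assume "j \<in> {..<q}"
        then have j: "j < q" by simp
        have "mean_T (disp j) \<le> mean_T (z m) + c1 * real_of_int (l1_norm (disp j - z m))" by (rule mean_T_diff)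
        also have "c1 * real_of_int (l1_norm (disp j - z m)) \<le> c1 * d"
          using inc[of j] j c1(1) unfolding disp_def d_def
          by (intro mult_left_mono) (simp_all add: of_int_le_iff[symmetric] del: of_int_le_iff)
        finally show "mean_T (disp j) + 1 \<le> (\<mu> + \<delta> / 4) * real m"
          using mz md by (simp add: algebra_simps)
      qed
      also have "(\<Sum>j<q. (\<mu> + \<delta> / 4) * real m) = (\<mu> + \<delta> / 4) * real (q * m)" by simp
      also have "\<dots> \<le> (\<mu> + \<delta> / 4) * real n"
      proof (rule mult_left_mono)
        show "real (q * m) \<le> real n" using qm(1) of_nat_le_iff by blast
        show "0 \<le> \<mu> + \<delta> / 4" using \<mu>0 \<delta> by simp
      qed
      also have "mean_T (disp q) + 1 \<le> bmax"
      proof -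
        have "mean_T (disp q) \<le> c1 * real_of_int (l1_norm (disp q))" by (rule mean_T_le)
        also have "\<dots> \<le> c1 * real_of_int Cm"
          using dispZ[of q] c1(1) unfolding Z_def by (intro mult_left_mono) auto
        finally show ?thesis by (simp add: bmax_def)
      qed
      also have "bmax \<le> \<delta> / 2 * real n" using n \<delta> by (simp add: field_simps)
      finally show ?thesis using D0 by (simp add: algebra_simps)
    qed
    have "prob {\<omega>\<in>space M. (\<Sum>u\<in>nat_simplex N. T (orthant \<sigma> u) (z n + w + orthant \<sigma> u) \<omega>) \<ge> (\<mu> + \<delta>) * real n * D}
       \<le> prob {\<omega>\<in>space M. (\<Sum>i\<in>I. g i (\<lambda>e\<in>E i. \<tau> e \<omega>) - b i) \<ge> s}"
    proof (rule finite_measure_mono)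
      show "{\<omega>\<in>space M. (\<Sum>i\<in>I. g i (\<lambda>e\<in>E i. \<tau> e \<omega>) - b i) \<ge> s} \<in> events"
      proof -
        have [measurable]: "(\<lambda>\<omega>. g i (\<lambda>e\<in>E i. \<tau> e \<omega>)) \<in> borel_measurable M" for i
          by (rule measurable_compose[OF measurable_restrict gm]) (rule \<tau>_measurable, rule subsetD[OF Elat])
        show ?thesis by measurable
      qed
      show "{\<omega>\<in>space M. (\<Sum>u\<in>nat_simplex N. T (orthant \<sigma> u) (z n + w + orthant \<sigma> u) \<omega>) \<ge> (\<mu> + \<delta>) * real n * D}
         \<subseteq> {\<omega>\<in>space M. (\<Sum>i\<in>I. g i (\<lambda>e\<in>E i. \<tau> e \<omega>) - b i) \<ge> s}"
      proof
        fix \<omega> assume "\<omega> \<in> {\<omega>\<in>space M. (\<Sum>u\<in>nat_simplex N. T (orthant \<sigma> u) (z n + w + orthant \<sigma> u) \<omega>) \<ge> (\<mu> + \<delta>) * real n * D}"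
        then have ws: "\<omega> \<in> space M"
          and big: "(\<Sum>u\<in>nat_simplex N. T (orthant \<sigma> u) (z n + w + orthant \<sigma> u) \<omega>) \<ge> (\<mu> + \<delta>) * real n * D" by auto
        have block: "T (p i) (p i + disp (fst i)) \<omega> \<le> g i (\<lambda>e\<in>E i. \<tau> e \<omega>)" for i
        proof -
          have "T (p i) (p i + disp (fst i)) \<omega> = passage (\<lambda>e. \<tau> ((+) (p i) ` e) \<omega>) 0 (disp (fst i))"
            using passage_shift[of "\<lambda>e. \<tau> e \<omega>" "p i" 0] by (simp add: T_def)
          also have "\<dots> \<le> g i (\<lambda>e\<in>E i. \<tau> e \<omega>)"
            unfolding geq by (intro passage_le_finite_passage weights_shift[OF weights_\<tau>[OF ws]] sys(2,3,4) dispZ)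
          finally show ?thesis .
        qed
        have chain: "T (a 0 + v) (a k + v) \<omega> \<le> (\<Sum>j<k. T (a j + v) (a (Suc j) + v) \<omega>)" for k v
        proof (induction k)
          case 0
          then show ?case by (simp add: T_def passage_refl[OF weights_\<tau>[OF ws]])
        next
          case (Suc k)
          then show ?case using T_triangle[OF ws, of "a 0 + v" "a (Suc k) + v" "a k + v"] by simp
        qed
        have a0: "a 0 = 0" by (simp add: a_def z_def)
        have "T (orthant \<sigma> u) (z n + w + orthant \<sigma> u) \<omega> \<le> (\<Sum>j\<le>q. T (p (j, u)) (p (j, u) + disp j) \<omega>)" for u
        proof -
          let ?v = "orthant \<sigma> u"
          have "T ?v (z n + w + ?v) \<omega> \<le> T ?v (a q + ?v) \<omega> + T (a q + ?v) (z n + w + ?v) \<omega>"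
            by (rule T_triangle[OF ws])
          also have "T ?v (a q + ?v) \<omega> \<le> (\<Sum>j<q. T (a j + ?v) (a (Suc j) + ?v) \<omega>)"
            using chain[of ?v q] by (simp add: a0)
          also have "(\<Sum>j<q. T (a j + ?v) (a (Suc j) + ?v) \<omega>) = (\<Sum>j<q. T (p (j, u)) (p (j, u) + disp j) \<omega>)"
            by (intro sum.cong refl) (simp add: p_def disp_def algebra_simps)
          also have "T (a q + ?v) (z n + w + ?v) \<omega> = T (p (q, u)) (p (q, u) + disp q) \<omega>"
            by (simp add: p_def disp_def algebra_simps)
          finally show ?thesis by (simp add: lessThan_Suc_atMost[symmetric])
        qed
        then have "(\<Sum>u\<in>nat_simplex N. T (orthant \<sigma> u) (z n + w + orthant \<sigma> u) \<omega>)
           \<le> (\<Sum>u\<in>nat_simplex N. \<Sum>j\<le>q. T (p (j, u)) (p (j, u) + disp j) \<omega>)" by (rule sum_mono)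
        also have "\<dots> = (\<Sum>i\<in>I. T (p i) (p i + disp (fst i)) \<omega>)"
          unfolding I_def by (subst sum.swap) (simp add: sum.cartesian_product split_def)
        also have "\<dots> \<le> (\<Sum>i\<in>I. g i (\<lambda>e\<in>E i. \<tau> e \<omega>))" by (intro sum_mono block)
        finally have "(\<mu> + \<delta>) * real n * D \<le> (\<Sum>i\<in>I. g i (\<lambda>e\<in>E i. \<tau> e \<omega>))" using big by linarith
        then have "s \<le> (\<Sum>i\<in>I. g i (\<lambda>e\<in>E i. \<tau> e \<omega>)) - (\<Sum>i\<in>I. b i)"
          using sumb unfolding s_def by (simp add: algebra_simps)
        then show "\<omega> \<in> {\<omega>\<in>space M. (\<Sum>i\<in>I. g i (\<lambda>e\<in>E i. \<tau> e \<omega>) - b i) \<ge> s}"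
          using ws by (simp add: sum_subtractf)
      qed
    qed
    also note ple
    also have "\<theta> * s / real (card Qs) = \<kappa> * real n * D" unfolding s_def \<kappa>_def by simp
    finally show "prob {\<omega>\<in>space M. (\<Sum>u\<in>nat_simplex N. T (orthant \<sigma> u) (z n + w + orthant \<sigma> u) \<omega>)
        \<ge> (\<mu> + \<delta>) * real n * simplex_card TYPE('d) N}
      \<le> real (card Qs) * exp (- (\<kappa> * real n * simplex_card TYPE('d) N))" unfolding D_def .
  qed
  with \<kappa> cQ show ?thesis unfolding \<mu>_def by (intro exI[of _ "real (card Qs)"] exI[of _ \<kappa>]) auto
qed

end

section \<open>Typical passage times when the weights near both ends are bounded\<close>

context signed_percolation
begin

text \<open>Every level carries total flow one, so each of the R inner levels contributes at most
  h.\<close>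

lemma flow_sum_le:
  assumes w: "\<omega> \<in> space M" and h: "h \<ge> 0"
    and near: "\<And>e. e \<in> box_edges (real R) \<Longrightarrow> \<tau> ((+) v ` e) \<omega> \<le> h"
  shows "(\<Sum>k<N. \<Sum>y\<in>nat_simplex k. \<Sum>i\<in>UNIV. flow y i * \<tau> (flow_edge \<sigma> v y i) \<omega>)
    \<le> real R * h + outer_flow R N v \<omega>"
proof -
  define f where "f k = (\<Sum>y\<in>nat_simplex k. \<Sum>i\<in>UNIV. flow y i * \<tau> (flow_edge \<sigma> v y i) \<omega>)" for k
  have f0: "f k \<ge> 0" for k
    unfolding f_def
    by (intro sum_nonneg mult_nonneg_nonneg less_imp_le[OF flow_pos] nonneg flow_edge_lattice w)
  have "(\<Sum>k<N. f k) \<le> (\<Sum>k\<in>{..<R} \<union> {R..<N}. f k)" by (intro sum_mono2) (auto simp: f0)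
  also have "\<dots> = (\<Sum>k<R. f k) + (\<Sum>k=R..<N. f k)" by (rule sum.union_disjoint) auto
  also have "(\<Sum>k<R. f k) \<le> (\<Sum>k<R. h)"
  proof (rule sum_mono)
    fix k assume k: "k \<in> {..<R}"
    have "f k \<le> (\<Sum>y\<in>(nat_simplex k :: ('d \<Rightarrow> nat) set). \<Sum>i\<in>UNIV. flow y i * h)"
      unfolding f_def
    proof (intro sum_mono mult_left_mono less_imp_le[OF flow_pos])
      fix y :: "'d \<Rightarrow> nat" and i assume y: "y \<in> nat_simplex k"
      show "\<tau> (flow_edge \<sigma> v y i) \<omega> \<le> h"
        unfolding flow_edge_shift[of v] using k by (intro near flow_edge_in_box[OF y]) simp
    qed
    also have "\<dots> = h" by (simp add: sum_distrib_right[symmetric] flow_total)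
    finally show "f k \<le> h" .
  qed
  finally show ?thesis by (simp add: f_def outer_flow_def)
qed

text \<open>The exceptional event does not depend on h, and the bound h on the weights near the
  endpoints enters linearly. R is chosen before \<delta> and the shift w, so it can later be fixed
  before \<xi>.\<close>

lemma typical_passage:
  fixes x :: "real ^ 'd"
  assumes sx: "\<And>i. 0 \<le> real_of_int (\<sigma> i) * x $ i" and x0: "x \<noteq> 0"
    and rd: "r < real CARD('d)" and B: "B > 0"
  defines "z \<equiv> \<lambda>n. floor_vec (real n *\<^sub>R x)"
  shows "\<exists>R\<ge>1. \<forall>\<delta>>0. \<forall>w. \<exists>C\<ge>0. \<exists>Bad. \<forall>\<^sub>F n in sequentially.
    Bad n \<in> events \<and> prob (Bad n) \<le> C * exp (- (B * (\<delta> * real n) powr r)) \<and>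
    (\<forall>\<omega>\<in>space M - Bad n. \<forall>h\<ge>0.
      (\<forall>e\<in>box_edges (real R). \<tau> e \<omega> \<le> h \<and> \<tau> ((+) (z n + w) ` e) \<omega> \<le> h) \<longrightarrow>
      T 0 (z n + w) \<omega> \<le> (time_constant M \<tau> x + \<delta>) * real n + 2 * real R * h)"
proof -
  define \<mu> where "\<mu> = time_constant M \<tau> x"
  define d where "d = CARD('d)"
  have d2: "d \<ge> 2" using r1 rd unfolding d_def by linarith
  \<comment> \<open>The two flows and the bulk each receive a third of \<delta>; the factor
    \<open>3 powr r\<close> restores the exponent lost by this division.\<close>
  obtain R where R: "R \<ge> 1" "\<And>\<delta>. \<delta> > 0 \<Longrightarrow> \<exists>\<epsilon>>0. \<forall>v N. \<forall>n>0. real N \<le> \<epsilon> * n \<longrightarrow>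
    prob {\<omega>\<in>space M. outer_flow R N v \<omega> \<ge> \<delta> * n} \<le> exp (- (B * 3 powr r * (\<delta> * n) powr r))"
    using outer_flow_tail[OF rd, of "B * 3 powr r"] B by auto
  have "\<exists>C\<ge>0. \<exists>Bad. \<forall>\<^sub>F n in sequentially.
    Bad n \<in> events \<and> prob (Bad n) \<le> C * exp (- (B * (\<delta> * real n) powr r)) \<and>
    (\<forall>\<omega>\<in>space M - Bad n. \<forall>h\<ge>0.
      (\<forall>e\<in>box_edges (real R). \<tau> e \<omega> \<le> h \<and> \<tau> ((+) (z n + w) ` e) \<omega> \<le> h) \<longrightarrow>
      T 0 (z n + w) \<omega> \<le> (\<mu> + \<delta>) * real n + 2 * real R * h)" if \<delta>: "\<delta> > 0" for \<delta> w
  proof -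
    define \<delta>' where "\<delta>' = \<delta> / 3"
    have \<delta>': "\<delta>' > 0" using \<delta> by (simp add: \<delta>'_def)
    obtain \<epsilon> where \<epsilon>: "\<epsilon> > 0" "\<And>v N n. n > 0 \<Longrightarrow> real N \<le> \<epsilon> * n \<Longrightarrow>
      prob {\<omega>\<in>space M. outer_flow R N v \<omega> \<ge> \<delta>' * n} \<le> exp (- (B * 3 powr r * (\<delta>' * n) powr r))"
      using R(2)[OF \<delta>'] by blast
    obtain Q \<kappa> where Q: "Q \<ge> 0" "\<kappa> > 0" "\<forall>\<^sub>F n in sequentially. \<forall>N.
      prob {\<omega>\<in>space M. (\<Sum>u\<in>nat_simplex N. T (orthant \<sigma> u) (z n + w + orthant \<sigma> u) \<omega>)
        \<ge> (\<mu> + \<delta>') * real n * simplex_card TYPE('d) N}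
      \<le> Q * exp (- (\<kappa> * real n * simplex_card TYPE('d) N))"
      using bulk_tail[OF sx x0 \<delta>', of w] unfolding z_def \<mu>_def by blast
    \<comment> \<open>The flows run up to a level proportional to n, so the simplex there has of
      order n^(d-1) points.\<close>
    define N where "N n = nat \<lfloor>\<epsilon> * real n\<rfloor>" for n :: nat
    define D where "D n = simplex_card TYPE('d) (N n)" for n
    have D0: "D n > 0" for n unfolding D_def by (rule simplex_card_pos)
    define Bad1 where "Bad1 n = {\<omega>\<in>space M. outer_flow R (N n) 0 \<omega> \<ge> \<delta>' * real n}" for n
    define Bad2 where "Bad2 n = {\<omega>\<in>space M. outer_flow R (N n) (z n + w) \<omega> \<ge> \<delta>' * real n}" for n
    define Bad3 where "Bad3 n = {\<omega>\<in>space M. (\<Sum>u\<in>nat_simplex (N n). T (orthant \<sigma> u) (z n + w + orthant \<sigma> u) \<omega>)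
        \<ge> (\<mu> + \<delta>') * real n * D n}" for n
    define Bad where "Bad n = Bad1 n \<union> (Bad2 n \<union> Bad3 n)" for n
    have [measurable]: "Bad1 n \<in> events" "Bad2 n \<in> events" "Bad3 n \<in> events" for n
      unfolding Bad1_def Bad2_def Bad3_def by measurable
    have scale: "B * 3 powr r * (\<delta>' * real n) powr r = B * (\<delta> * real n) powr r" for n
    proof -
      have "(\<delta> * real n) powr r = (3 * (\<delta>' * real n)) powr r" by (simp add: \<delta>'_def)
      also have "\<dots> = 3 powr r * (\<delta>' * real n) powr r" using \<delta>' by (simp add: powr_mult)
      finally show ?thesis by simp
    qed
    define c where "c = \<kappa> * (\<epsilon> / real d) ^ (d - 1)"
    have c: "c > 0" unfolding c_def using Q(2) \<epsilon>(1) d2 by (intro mult_pos_pos zero_less_power) auto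
    \<comment> \<open>Here r < d enters again: the bulk exponent is of order n^d and eventually
      exceeds any multiple of n^r.\<close>
    have growth: "\<forall>\<^sub>F n in sequentially. real n powr (real d - r) \<ge> B * \<delta> powr r / c"
    proof -
      have "filterlim (\<lambda>n::nat. real n powr (real d - r)) at_top sequentially"
        using rd unfolding d_def by (intro filterlim_compose[OF real_powr_at_top filterlim_real_sequentially]) auto
      then show ?thesis unfolding filterlim_at_top by blast
    qed
    have "\<forall>\<^sub>F n in sequentially.
      Bad n \<in> events \<and> prob (Bad n) \<le> (2 + Q) * exp (- (B * (\<delta> * real n) powr r)) \<and>
      (\<forall>\<omega>\<in>space M - Bad n. \<forall>h\<ge>0.
        (\<forall>e\<in>box_edges (real R). \<tau> e \<omega> \<le> h \<and> \<tau> ((+) (z n + w) ` e) \<omega> \<le> h) \<longrightarrow>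
        T 0 (z n + w) \<omega> \<le> (\<mu> + \<delta>) * real n + 2 * real R * h)"
      using Q(3) growth eventually_gt_at_top[of "0::nat"]
    proof eventually_elim
      case (elim n)
      have n: "real n > 0" using elim(3) by simp
      have N: "real (N n) \<le> \<epsilon> * real n" "\<epsilon> * real n \<le> real (Suc (N n))"
        unfolding N_def using \<epsilon>(1) by (simp_all, linarith)
      have P12: "prob (Bad1 n) \<le> exp (- (B * (\<delta> * real n) powr r))" "prob (Bad2 n) \<le> exp (- (B * (\<delta> * real n) powr r))"
        unfolding Bad1_def Bad2_def scale[symmetric] by (rule \<epsilon>(2)[OF n N(1)])+
      have P3: "prob (Bad3 n) \<le> Q * exp (- (B * (\<delta> * real n) powr r))"
      proof -
        have "prob (Bad3 n) \<le> Q * exp (- (\<kappa> * real n * D n))"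
          unfolding Bad3_def D_def using elim(1) by blast
        also have "\<dots> \<le> Q * exp (- (B * (\<delta> * real n) powr r))"
        proof -
          have "B * (\<delta> * real n) powr r = (B * \<delta> powr r / c) * c * real n powr r"
            using \<delta> n c by (simp add: powr_mult)
          also have "\<dots> \<le> real n powr (real d - r) * c * real n powr r"
            using elim(2) c by (intro mult_right_mono) auto
          also have "\<dots> = c * real n ^ d"
            using n by (simp add: powr_diff powr_realpow)
          also have "\<dots> = \<kappa> * real n * (\<epsilon> * real n / real d) ^ (d - 1)"
            using d2 unfolding c_def by (cases d) (auto simp: power_mult_distrib power_divide)
          also have "\<dots> \<le> \<kappa> * real n * D n"
          proof (rule mult_left_mono)
            have "(\<epsilon> * real n / real d) ^ (d - 1) \<le> (real (Suc (N n)) / real d) ^ (d - 1)"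
              using N(2) \<epsilon>(1) by (intro power_mono divide_right_mono) auto
            also have "\<dots> \<le> D n" unfolding D_def d_def by (rule simplex_card_ge)
            finally show "(\<epsilon> * real n / real d) ^ (d - 1) \<le> D n" .
          qed (use Q(2) in simp)
          finally have "exp (- (\<kappa> * real n * D n)) \<le> exp (- (B * (\<delta> * real n) powr r))" by simp
          then show ?thesis using Q(1) by (rule mult_left_mono)
        qed
        finally show ?thesis .
      qed
      have "prob (Bad n) \<le> prob (Bad1 n) + prob (Bad2 n \<union> Bad3 n)"
        unfolding Bad_def by (intro measure_Un_le) auto
      also have "prob (Bad2 n \<union> Bad3 n) \<le> prob (Bad2 n) + prob (Bad3 n)" by (intro measure_Un_le) auto
      finally have P: "prob (Bad n) \<le> (2 + Q) * exp (- (B * (\<delta> * real n) powr r))"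
        using P12 P3 by (simp add: algebra_simps)
      moreover have "T 0 (z n + w) \<omega> \<le> (\<mu> + \<delta>) * real n + 2 * real R * h"
        if w: "\<omega> \<in> space M - Bad n" and h: "h \<ge> 0"
          and near: "\<forall>e\<in>box_edges (real R). \<tau> e \<omega> \<le> h \<and> \<tau> ((+) (z n + w) ` e) \<omega> \<le> h" for \<omega> h
      proof -
        let ?v = "z n + w"
        have ws: "\<omega> \<in> space M" using w by simp
        have nb: "outer_flow R (N n) 0 \<omega> < \<delta>' * real n" "outer_flow R (N n) ?v \<omega> < \<delta>' * real n"
          "(\<Sum>u\<in>nat_simplex (N n). T (orthant \<sigma> u) (?v + orthant \<sigma> u) \<omega>) < (\<mu> + \<delta>') * real n * D n"
          using w unfolding Bad_def Bad1_def Bad2_def Bad3_def by auto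
        have edge: "T a b \<omega> \<le> \<tau> {a, b} \<omega>" if "nearest_neighbors a b" for a b
          unfolding T_def by (rule passage_edge[OF weights_\<tau>[OF ws] that])
        have start: "(\<Sum>y\<in>nat_simplex (N n). T 0 (0 + orthant \<sigma> y) \<omega>) / D n \<le> real R * h + outer_flow R (N n) 0 \<omega>"
          unfolding D_def
        proof (rule order_trans[OF simplex_average_le[of "\<lambda>y. T 0 y \<omega>" 0 "\<lambda>e. \<tau> e \<omega>"]])
          show "T 0 0 \<omega> \<le> 0" by (simp add: T_def passage_refl[OF weights_\<tau>[OF ws]])
          show "T 0 b \<omega> \<le> T 0 a \<omega> + \<tau> {a, b} \<omega>" if "nearest_neighbors a b" for a b
            using T_triangle[OF ws, of 0 b a] edge[OF that] by simp
          show "(\<Sum>k<N n. \<Sum>y\<in>nat_simplex k. \<Sum>i\<in>UNIV. flow y i * \<tau> (flow_edge \<sigma> 0 y i) \<omega>)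
             \<le> real R * h + outer_flow R (N n) 0 \<omega>"
            using near by (intro flow_sum_le ws h) simp
        qed
        have finish: "(\<Sum>y\<in>nat_simplex (N n). T (?v + orthant \<sigma> y) ?v \<omega>) / D n \<le> real R * h + outer_flow R (N n) ?v \<omega>"
          unfolding D_def
        proof (rule order_trans[OF simplex_average_le[of "\<lambda>y. T y ?v \<omega>" ?v "\<lambda>e. \<tau> e \<omega>"]])
          show "T ?v ?v \<omega> \<le> 0" by (simp add: T_def passage_refl[OF weights_\<tau>[OF ws]])
          show "T b ?v \<omega> \<le> T a ?v \<omega> + \<tau> {a, b} \<omega>" if "nearest_neighbors a b" for a b
            using T_triangle[OF ws, of b ?v a] edge[of b a] that nearest_neighbors_sym[of a b]
            by (simp add: insert_commute)
          show "(\<Sum>k<N n. \<Sum>y\<in>nat_simplex k. \<Sum>i\<in>UNIV. flow y i * \<tau> (flow_edge \<sigma> ?v y i) \<omega>)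
             \<le> real R * h + outer_flow R (N n) ?v \<omega>"
            using near by (intro flow_sum_le ws h) simp
        qed
        have "T 0 ?v \<omega> * D n = (\<Sum>u\<in>(nat_simplex (N n) :: ('d \<Rightarrow> nat) set). T 0 ?v \<omega>)"
          by (simp add: D_def simplex_card_def)
        \<comment> \<open>Each simplex point u offers a route from 0 through u and its translate to
          the endpoint. The average over u bounds the passage time and splits into the two flows and
          the bulk sum.\<close>
        also have "\<dots> \<le> (\<Sum>u\<in>nat_simplex (N n). T 0 (0 + orthant \<sigma> u) \<omega> + T (orthant \<sigma> u) (?v + orthant \<sigma> u) \<omega>
             + T (?v + orthant \<sigma> u) ?v \<omega>)"
        proof (rule sum_mono)
          fix u
          show "T 0 ?v \<omega> \<le> T 0 (0 + orthant \<sigma> u) \<omega> + T (orthant \<sigma> u) (?v + orthant \<sigma> u) \<omega> + T (?v + orthant \<sigma> u) ?v \<omega>"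
            using T_triangle[OF ws, of 0 ?v "orthant \<sigma> u"] T_triangle[OF ws, of "orthant \<sigma> u" ?v "?v + orthant \<sigma> u"]
            by simp
        qed
        also have "\<dots> = (\<Sum>u\<in>nat_simplex (N n). T 0 (0 + orthant \<sigma> u) \<omega>)
            + (\<Sum>u\<in>nat_simplex (N n). T (orthant \<sigma> u) (?v + orthant \<sigma> u) \<omega>)
            + (\<Sum>u\<in>nat_simplex (N n). T (?v + orthant \<sigma> u) ?v \<omega>)"
          by (simp only: sum.distrib)
        also have "\<dots> \<le> (real R * h + \<delta>' * real n) * D n + (\<mu> + \<delta>') * real n * D n + (real R * h + \<delta>' * real n) * D n"
        proof (intro add_mono)
          have "(\<Sum>u\<in>nat_simplex (N n). T 0 (0 + orthant \<sigma> u) \<omega>) \<le> (real R * h + outer_flow R (N n) 0 \<omega>) * D n"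
            using start D0[of n] by (simp only: pos_divide_le_eq)
          also have "\<dots> \<le> (real R * h + \<delta>' * real n) * D n"
            using nb(1) D0[of n] by (intro mult_right_mono) auto
          finally show "(\<Sum>u\<in>nat_simplex (N n). T 0 (0 + orthant \<sigma> u) \<omega>) \<le> (real R * h + \<delta>' * real n) * D n" .
          show "(\<Sum>u\<in>nat_simplex (N n). T (orthant \<sigma> u) (?v + orthant \<sigma> u) \<omega>) \<le> (\<mu> + \<delta>') * real n * D n"
            using nb(3) by simp
          have "(\<Sum>u\<in>nat_simplex (N n). T (?v + orthant \<sigma> u) ?v \<omega>) \<le> (real R * h + outer_flow R (N n) ?v \<omega>) * D n"
            using finish D0[of n] by (simp only: pos_divide_le_eq)
          also have "\<dots> \<le> (real R * h + \<delta>' * real n) * D n"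
            using nb(2) D0[of n] by (intro mult_right_mono) auto
          finally show "(\<Sum>u\<in>nat_simplex (N n). T (?v + orthant \<sigma> u) ?v \<omega>) \<le> (real R * h + \<delta>' * real n) * D n" .
        qed
        also have "\<dots> = ((\<mu> + \<delta>) * real n + 2 * real R * h) * D n"
          by (simp add: \<delta>'_def algebra_simps)
        finally show ?thesis using D0[of n] by (simp only: mult_le_cancel_right_pos)
      qed
      ultimately show ?case unfolding Bad_def by auto
    qed
    then show ?thesis using Q(1) by (intro exI[of _ "2 + Q"] exI[of _ Bad] conjI) auto
  qed
  with R(1) show ?thesis unfolding \<mu>_def by blast
qed

end

section \<open>Conditioning on a large passage time\<close>

text \<open>Counting all pairs of vertices is crude, but any polynomial bound is good enough against
  a stretched exponential.\<close>

lemma card_box_edges_le: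
  assumes m: "m \<ge> 0"
  shows "real (card (box_edges m :: 'd::finite edge set)) \<le> (2 * m + 1) ^ (2 * CARD('d))"
proof -
  let ?B = "lattice_box m :: 'd vertex set"
  let ?P = "PiE UNIV (\<lambda>_::'d. {- \<lfloor>m\<rfloor> .. \<lfloor>m\<rfloor>})"
  have "card ?B \<le> card ?P"
    by (rule surj_card_le[OF finite_PiE lattice_box_subset]) auto
  also have "card ?P = nat (2 * \<lfloor>m\<rfloor> + 1) ^ CARD('d)"
    by (subst card_PiE) (simp_all add: algebra_simps)
  finally have "real (card ?B) \<le> real (nat (2 * \<lfloor>m\<rfloor> + 1)) ^ CARD('d)"
    by (simp only: of_nat_power[symmetric] of_nat_le_iff)
  also have "\<dots> \<le> (2 * m + 1) ^ CARD('d)"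
  proof (rule power_mono)
    have "real (nat (2 * \<lfloor>m\<rfloor> + 1)) = real_of_int (2 * \<lfloor>m\<rfloor> + 1)" using m by simp
    then show "real (nat (2 * \<lfloor>m\<rfloor> + 1)) \<le> 2 * m + 1" by linarith
  qed simp
  finally have B: "real (card ?B) \<le> (2 * m + 1) ^ CARD('d)" .
  have "box_edges m \<subseteq> (\<lambda>(v, w). {v, w}) ` (?B \<times> ?B)" unfolding box_edges_def by auto
  then have "card (box_edges m :: 'd edge set) \<le> card (?B \<times> ?B)"
    using finite_lattice_box by (intro surj_card_le) auto
  then have "real (card (box_edges m :: 'd edge set)) \<le> real (card ?B) * real (card ?B)"
    by (simp only: card_cartesian_product of_nat_mult[symmetric] of_nat_le_iff)
  also have "\<dots> \<le> (2 * m + 1) ^ CARD('d) * (2 * m + 1) ^ CARD('d)"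
    using B m by (intro mult_mono) auto
  finally show ?thesis unfolding mult_2[of "CARD('d)"] power_add .
qed

section \<open>The case r at least d\<close>

context percolation
begin

text \<open>A union bound over polynomially many edges is compared with the cost of one cheap trap,
  for an arbitrary level m of the passage time.\<close>

lemma supercritical_no_large_weights:
  fixes x :: "real ^ 'd"
  assumes dim: "CARD('d) \<ge> 2" and rd: "r \<ge> real CARD('d)" and x: "x \<noteq> 0"
    and a: "a > 0" and \<epsilon>: "\<epsilon> > 0"
  shows "(\<lambda>n::nat. \<P>(\<omega> in M. (\<forall>e\<in>box_edges (real n powr a). \<tau> e \<omega> \<le> \<epsilon> * real n) \<bar>
      T 0 (floor_vec (real n *\<^sub>R x)) \<omega> \<ge> m * real n)) \<longlonglongrightarrow> 1"
proof -
  \<comment> \<open>The depth of a trap must be positive, while m is arbitrary.\<close>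
  define s where "s = max m 1"
  have s: "s > 0" "m \<le> s" by (auto simp: s_def)
  \<comment> \<open>Half the exponent of a single large weight. The trap is chosen to cost at most
    this much, so the ratio still decays at rate c.\<close>
  define c where "c = \<alpha> * \<epsilon> powr r / 2"
  have c: "c > 0" using \<alpha> \<epsilon> by (simp add: c_def)
  have "\<epsilon> powr r / (2 * s powr r) > 0" using \<epsilon> s by simp
  from cheap_blocking[OF dim rd this] obtain K and f :: "'d edge \<Rightarrow> real"
    where f: "blocking K f" "energy r K f < \<epsilon> powr r / (2 * s powr r)" by blast
  define p where "p = \<beta>\<^sub>1 ^ card (box_edges (real K) :: 'd edge set)"
  have p: "p > 0" using \<beta>\<^sub>1 by (simp add: p_def)
  define z where "z n = floor_vec (real n *\<^sub>R x)" for n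
  define B where "B n = (box_edges (real n powr a) :: 'd edge set)" for n :: nat
  define D where "D n = {\<omega>\<in>space M. T 0 (z n) \<omega> \<ge> m * real n}" for n
  define G where "G n = {\<omega>\<in>space M. \<forall>e\<in>B n. \<tau> e \<omega> \<le> \<epsilon> * real n}" for n
  define Bad where "Bad n = (\<Union>e\<in>B n. {\<omega>\<in>space M. \<tau> e \<omega> > \<epsilon> * real n})" for n
  have Bn: "finite (B n)" "B n \<subseteq> lattice_edges" for n
    unfolding B_def using finite_box_edges box_edges_lattice by auto
  have [measurable]: "e \<in> B n \<Longrightarrow> \<tau> e \<in> borel_measurable M" for e n
    by (rule \<tau>_measurable[OF subsetD[OF Bn(2)]])
  have D_ev [measurable]: "D n \<in> events" for n unfolding D_def by measurable
  have G_ev [measurable]: "G n \<in> events" for n unfolding G_def using Bn(1) by measurable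
  have Bad_ev [measurable]: "Bad n \<in> events" for n
    unfolding Bad_def using Bn(1) by (intro sets.finite_UN) auto
  define rate where "rate n = 3 ^ (2 * CARD('d)) * \<beta>\<^sub>2 / p
     * (real n powr (a * real (2 * CARD('d))) * exp (- c * real n powr r))" for n :: nat
  have rate0: "rate \<longlonglongrightarrow> 0"
  proof -
    have "(\<lambda>n::nat. real n powr (a * real (2 * CARD('d))) * exp (- c * real n powr r)) \<longlonglongrightarrow> 0"
      using c r by real_asymp
    from tendsto_mult_right_zero[OF this, of "3 ^ (2 * CARD('d)) * \<beta>\<^sub>2 / p"] show ?thesis
      unfolding rate_def[abs_def] by simp
  qed
  have lower: "\<forall>\<^sub>F n in sequentially. 1 - rate n \<le> \<P>(\<omega> in M. (\<forall>e\<in>B n. \<tau> e \<omega> \<le> \<epsilon> * real n) \<bar> T 0 (z n) \<omega> \<ge> m * real n)"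
    using lower_deviation_one_trap[OF f(1) s(1) x] eventually_gt_at_top[of "0::nat"]
  proof eventually_elim
    case (elim n)
    have n: "real n \<ge> 1" using elim(2) by simp
    have "energy r K f * (s * real n) powr r \<le> \<epsilon> powr r / (2 * s powr r) * (s * real n) powr r"
      using f(2) by (intro mult_right_mono) auto
    also have "\<dots> = \<epsilon> powr r / 2 * real n powr r" using s by (simp add: powr_mult)
    finally have "\<alpha> * (energy r K f * (s * real n) powr r) \<le> \<alpha> * (\<epsilon> powr r / 2 * real n powr r)"
      using \<alpha> by (intro mult_left_mono) auto
    then have "- (c * real n powr r) \<le> - \<alpha> * (energy r K f * (s * real n) powr r)"
      by (simp add: c_def mult.assoc)
    then have "p * exp (- (c * real n powr r)) \<le> p * exp (- \<alpha> * (energy r K f * (s * real n) powr r))"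
      using p by simp
    also have "\<dots> \<le> prob {\<omega>\<in>space M. T 0 (z n) \<omega> \<ge> s * real n}"
      using elim(1) unfolding p_def z_def .
    also have "\<dots> \<le> prob (D n)"
    proof (rule finite_measure_mono[OF _ D_ev])
      have "m * real n \<le> s * real n" using s(2) by (intro mult_right_mono) auto
      then show "{\<omega>\<in>space M. T 0 (z n) \<omega> \<ge> s * real n} \<subseteq> D n" unfolding D_def by auto
    qed
    finally have PD: "prob (D n) \<ge> p * exp (- (c * real n powr r))" .
    then have PD0: "prob (D n) > 0" using p by (meson exp_gt_zero less_le_trans mult_pos_pos)
    have split_pow: "(3 * real n powr a) ^ (2 * CARD('d)) = 3 ^ (2 * CARD('d)) * real n powr (a * real (2 * CARD('d)))"
      using n by (simp only: power_mult_distrib powr_power) (simp add: mult_ac)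
    have "\<alpha> * (\<epsilon> * real n) powr r = c * real n powr r + c * real n powr r"
      using \<epsilon> n by (simp add: c_def powr_mult)
    then have split_exp: "exp (- \<alpha> * (\<epsilon> * real n) powr r) = exp (- c * real n powr r) * exp (- (c * real n powr r))"
      by (simp add: exp_add[symmetric])
    have "prob (Bad n) \<le> (\<Sum>e\<in>B n. prob {\<omega>\<in>space M. \<tau> e \<omega> > \<epsilon> * real n})"
      unfolding Bad_def using Bn(1) by (intro finite_measure_subadditive_finite) auto
    also have "\<dots> \<le> (\<Sum>e\<in>B n. \<beta>\<^sub>2 * exp (- \<alpha> * (\<epsilon> * real n) powr r))"
    proof (rule sum_mono)
      fix e assume "e \<in> B n"
      from tail[OF subsetD[OF Bn(2) this], of "\<epsilon> * real n"] \<epsilon>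
      show "prob {\<omega>\<in>space M. \<tau> e \<omega> > \<epsilon> * real n} \<le> \<beta>\<^sub>2 * exp (- \<alpha> * (\<epsilon> * real n) powr r)" by simp
    qed
    also have "\<dots> = real (card (B n)) * (\<beta>\<^sub>2 * exp (- \<alpha> * (\<epsilon> * real n) powr r))" by simp
    also have "\<dots> \<le> (3 * real n powr a) ^ (2 * CARD('d)) * (\<beta>\<^sub>2 * exp (- \<alpha> * (\<epsilon> * real n) powr r))"
    proof (rule mult_right_mono)
      have n1: "real n powr a \<ge> 1" using n a by (simp add: ge_one_powr_ge_zero)
      have "real (card (B n)) \<le> (2 * real n powr a + 1) ^ (2 * CARD('d))"
        unfolding B_def by (rule card_box_edges_le) simp
      also have "\<dots> \<le> (3 * real n powr a) ^ (2 * CARD('d))" using n1 by (intro power_mono) auto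
      finally show "real (card (B n)) \<le> (3 * real n powr a) ^ (2 * CARD('d))" .
    qed (use \<beta>\<^sub>2 in simp)
    also have "\<dots> = rate n * (p * exp (- (c * real n powr r)))"
      using p unfolding split_exp split_pow by (simp add: rate_def)
    finally have "prob (Bad n) \<le> rate n * (p * exp (- (c * real n powr r)))" .
    also have "\<dots> \<le> rate n * prob (D n)"
      using PD \<beta>\<^sub>2 p by (intro mult_left_mono) (auto simp: rate_def)
    finally have PB: "prob (Bad n) \<le> rate n * prob (D n)" .
    have "prob (D n) \<le> prob ((G n \<inter> D n) \<union> Bad n)"
    proof (rule finite_measure_mono)
      show "D n \<subseteq> (G n \<inter> D n) \<union> Bad n" by (auto simp: D_def G_def Bad_def not_le)
    qed (intro sets.Un sets.Int G_ev D_ev Bad_ev)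
    also have "\<dots> \<le> prob (G n \<inter> D n) + prob (Bad n)" by (intro measure_Un_le) auto
    finally have "prob (D n) * (1 - rate n) \<le> prob (G n \<inter> D n)" using PB by (simp add: algebra_simps)
    then have "1 - rate n \<le> prob (G n \<inter> D n) / prob (D n)"
      using PD0 by (simp add: pos_le_divide_eq mult.commute)
    moreover have "\<P>(\<omega> in M. (\<forall>e\<in>B n. \<tau> e \<omega> \<le> \<epsilon> * real n) \<bar> T 0 (z n) \<omega> \<ge> m * real n)
       = prob (G n \<inter> D n) / prob (D n)"
      unfolding cond_prob_def G_def D_def by (intro arg_cong2[where f = "(/)"] arg_cong[where f = prob]) auto
    ultimately show ?case by simp
  qed
  have upper: "\<forall>\<^sub>F n in sequentially. \<P>(\<omega> in M. (\<forall>e\<in>B n. \<tau> e \<omega> \<le> \<epsilon> * real n) \<bar> T 0 (z n) \<omega> \<ge> m * real n) \<le> 1"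
  proof (rule always_eventually, rule allI)
    fix n
    have eq: "\<P>(\<omega> in M. (\<forall>e\<in>B n. \<tau> e \<omega> \<le> \<epsilon> * real n) \<bar> T 0 (z n) \<omega> \<ge> m * real n)
       = prob (G n \<inter> D n) / prob (D n)"
      unfolding cond_prob_def G_def D_def by (intro arg_cong2[where f = "(/)"] arg_cong[where f = prob]) auto
    have "prob (G n \<inter> D n) \<le> prob (D n)" by (intro finite_measure_mono) auto
    then show "\<P>(\<omega> in M. (\<forall>e\<in>B n. \<tau> e \<omega> \<le> \<epsilon> * real n) \<bar> T 0 (z n) \<omega> \<ge> m * real n) \<le> 1"
      unfolding eq by (intro divide_le_eq_1[THEN iffD2]) (use measure_nonneg[of M "D n"] in linarith)
  qed
  have "(\<lambda>n. 1 - rate n) \<longlonglongrightarrow> 1" using tendsto_diff[OF tendsto_const rate0, of 1] by simp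
  from tendsto_sandwich[OF lower upper this tendsto_const] show ?thesis unfolding B_def z_def .
qed

end

text \<open>Splitting the excess between the two endpoints is cheaper than putting all of it at one,
  because \<open>r > 1\<close>.\<close>

lemma splitting_gain:
  fixes r :: real
  assumes "r > 1"
  shows "\<exists>q>0. q < 1 / 4 \<and> 2 * (1 / 2 + q) powr r < (1 - 2 * q) powr r"
proof -
  have lim: "((\<lambda>q. (1 - 2 * q) powr r - 2 * (1 / 2 + q) powr r) \<longlongrightarrow> (1 - 2 * 0) powr r - 2 * (1 / 2 + 0) powr r) (at_right 0)"
    using assms by (intro tendsto_intros) auto
  have "(1 / 2 :: real) powr r < (1 / 2) powr 1" using assms by (intro powr_less_mono') auto
  then have "(0::real) < (1 - 2 * 0) powr r - 2 * (1 / 2 + 0) powr r" by simp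
  from order_tendstoD(1)[OF lim this]
  have "\<forall>\<^sub>F q::real in at_right 0. 2 * (1 / 2 + q) powr r < (1 - 2 * q) powr r" by eventually_elim simp
  moreover have "\<forall>\<^sub>F q::real in at_right 0. 0 < q" by (rule eventually_at_right_less)
  moreover have "\<forall>\<^sub>F q::real in at_right 0. q < 1 / 4" by (rule eventually_at_right_real[of 0 "1/4", THEN eventually_mono]) auto
  ultimately have "\<forall>\<^sub>F q::real in at_right 0. q > 0 \<and> q < 1 / 4 \<and> 2 * (1 / 2 + q) powr r < (1 - 2 * q) powr r"
    by eventually_elim simp
  then show ?thesis by (rule eventually_happens'[OF trivial_limit_at_right_real, THEN exE]) blast
qed

section \<open>The case r between 1 and d\<close>

context signed_percolation
begin

text \<open>If no weight near the origin is large, then the whole excess is due to a trap around the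
  endpoint. Either some shell around the endpoint is free of large weights, and one may leave the
  trap there, or all of many shells contain a large weight.\<close>

lemma endpoint_energy:
  assumes w: "\<omega> \<in> space M" and h: "h > 0" and s: "s > 0"
    and origin: "\<And>e. e \<in> box_edges (real R) \<Longrightarrow> \<tau> e \<omega> \<le> h"
    and typical: "\<And>y h. linf_norm y \<le> int ((2 * R + 1) * J) \<Longrightarrow> h \<ge> 0 \<Longrightarrow>
      \<forall>e\<in>box_edges (real R). \<tau> e \<omega> \<le> h \<and> \<tau> ((+) (z + y) ` e) \<omega> \<le> h \<Longrightarrow> T 0 (z + y) \<omega> \<le> m + 2 * real R * h"
    and large: "T 0 z \<omega> \<ge> m + 2 * real R * h + s"
    and J: "real J * h powr r \<ge> capacity TYPE('d) r ((2 * R + 1) * J) * s powr r"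
  shows "(\<Sum>e\<in>box_edges (real ((2 * R + 1) * J)). \<tau> ((+) z ` e) \<omega> powr r)
    \<ge> capacity TYPE('d) r ((2 * R + 1) * J) * s powr r"
proof -
  define K where "K = (2 * R + 1) * J"
  define B where "B = (box_edges (real K) :: 'd edge set)"
  \<comment> \<open>Each shell covers 2R + 1 consecutive radii, just wide enough for boxes of radius
    R around the points of its middle sphere.\<close>
  define S where "S j = {e \<in> B. \<forall>v\<in>e. int ((2 * R + 1) * j) \<le> linf_norm v \<and> linf_norm v \<le> int ((2 * R + 1) * j + 2 * R)}" for j
  show ?thesis
  proof (cases "\<exists>j<J. \<forall>e\<in>S j. \<tau> ((+) z ` e) \<omega> \<le> h")
    case True
    then obtain j where j: "j < J" "\<forall>e\<in>S j. \<tau> ((+) z ` e) \<omega> \<le> h" by blast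
    \<comment> \<open>The middle radius of the good shell. From its points the weights within
      distance R are at most h, so \<open>typical\<close> applies to each of them.\<close>
    define k where "k = (2 * R + 1) * j + R"
    have "(2 * R + 1) * Suc j \<le> K" unfolding K_def using j(1) by (intro mult_le_mono2) simp
    then have kK: "k + R < K" unfolding k_def by simp
    have esc: "T 0 (z + y) \<omega> \<le> m + 2 * real R * h" if y: "linf_norm y = int k" for y
    proof (rule typical)
      show "linf_norm y \<le> int ((2 * R + 1) * J)" using y kK unfolding K_def[symmetric] by simp
      show "\<forall>e\<in>box_edges (real R). \<tau> e \<omega> \<le> h \<and> \<tau> ((+) (z + y) ` e) \<omega> \<le> h"
      proof (intro ballI conjI)
        fix e :: "'d edge" assume e: "e \<in> box_edges (real R)"
        then show "\<tau> e \<omega> \<le> h" by (rule origin)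
        from e obtain a b where ab: "e = {a, b}" "linf_norm a \<le> int R" "linf_norm b \<le> int R" "nearest_neighbors a b"
          unfolding box_edges_def lattice_box_def by auto
        have near: "int ((2 * R + 1) * j) \<le> linf_norm (y + v) \<and> linf_norm (y + v) \<le> int ((2 * R + 1) * j + 2 * R)
            \<and> linf_norm (y + v) \<le> int K"
          if "linf_norm v \<le> int R" for v
        proof -
          have 1: "linf_norm (y + v) \<le> linf_norm y + linf_norm v" by (rule linf_norm_triangle)
          have 2: "linf_norm y \<le> linf_norm (y + v) + linf_norm v"
            using linf_norm_triangle[of "y + v" "- v"] by (simp add: linf_norm_minus)
          have "int k = int ((2 * R + 1) * j) + int R"
            "int ((2 * R + 1) * j + 2 * R) = int ((2 * R + 1) * j) + 2 * int R"
            by (simp_all only: k_def of_nat_add of_nat_mult of_nat_numeral)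
          moreover have "int k + int R < int K" using kK by linarith
          ultimately show ?thesis using 1 2 that y by (intro conjI) linarith+
        qed
        have "(+) y ` e = {y + a, y + b}" by (simp add: ab(1))
        moreover have "nearest_neighbors (y + a) (y + b)" using ab(4) by (simp add: nearest_neighbors_add)
        ultimately have "(+) y ` e \<in> B"
          unfolding B_def box_edges_def lattice_box_def using near[OF ab(2)] near[OF ab(3)] by fastforce
        moreover have "\<forall>v\<in>(+) y ` e. int ((2 * R + 1) * j) \<le> linf_norm v \<and> linf_norm v \<le> int ((2 * R + 1) * j + 2 * R)"
          using near[OF ab(2)] near[OF ab(3)] unfolding \<open>(+) y ` e = {y + a, y + b}\<close> by blast
        ultimately have "(+) y ` e \<in> S j" unfolding S_def by blast
        then have "\<tau> ((+) z ` (+) y ` e) \<omega> \<le> h" using j(2) by blast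
        moreover have "(+) z ` (+) y ` e = (+) (z + y) ` e" by (simp add: image_image add.assoc)
        ultimately show "\<tau> ((+) (z + y) ` e) \<omega> \<le> h" by simp
      qed
    qed (use h in simp)
    show ?thesis
      unfolding K_def[symmetric]
    proof (rule trapped_energy[OF weights_\<tau>[OF w] _ s])
      show "k \<le> K" using kK by simp
      show "passage (\<lambda>e. \<tau> e \<omega>) 0 (z + y) \<le> m + 2 * real R * h" if "linf_norm y = int k" for y
        using esc[OF that] by (simp add: T_def)
      show "m + 2 * real R * h + s \<le> passage (\<lambda>e. \<tau> e \<omega>) 0 z" using large by (simp add: T_def)
    qed
  next
    case False
    then have "\<forall>j\<in>{..<J}. \<exists>e. e \<in> S j \<and> \<tau> ((+) z ` e) \<omega> > h" by (auto simp: not_le)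
    from bchoice[OF this] obtain e where e: "\<And>j. j < J \<Longrightarrow> e j \<in> S j" "\<And>j. j < J \<Longrightarrow> \<tau> ((+) z ` e j) \<omega> > h" by blast
    \<comment> \<open>Shells occupy disjoint ranges of radii, so the large weights found in them sit
      on J different edges. Their energy alone then reaches the required bound by the choice of
      J.\<close>
    have "inj_on e {..<J}"
    proof (rule inj_onI)
      fix i j assume ij: "i \<in> {..<J}" "j \<in> {..<J}" "e i = e j"
      have ei: "e i \<in> S i" "e i \<in> S j" using e(1)[of i] e(1)[of j] ij by auto
      then obtain v where v: "v \<in> e i" unfolding S_def B_def box_edges_def by blast
      have vi: "int ((2 * R + 1) * i) \<le> linf_norm v" "linf_norm v < int ((2 * R + 1) * Suc i)"
        "int ((2 * R + 1) * j) \<le> linf_norm v" "linf_norm v < int ((2 * R + 1) * Suc j)"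
        using ei v unfolding S_def by force+
      then have "int ((2 * R + 1) * i) < int ((2 * R + 1) * Suc j)" "int ((2 * R + 1) * j) < int ((2 * R + 1) * Suc i)"
        by linarith+
      then have "i < Suc j" "j < Suc i" by (simp_all only: of_nat_less_iff mult_less_cancel1)
      then show "i = j" by simp
    qed
    have "capacity TYPE('d) r K * s powr r \<le> real J * h powr r" using J unfolding K_def .
    also have "\<dots> = (\<Sum>j<J. h powr r)" by simp
    also have "\<dots> \<le> (\<Sum>j<J. \<tau> ((+) z ` e j) \<omega> powr r)"
      using e(2) h r by (intro sum_mono powr_mono2) (auto intro: less_imp_le)
    also have "\<dots> = (\<Sum>e\<in>e ` {..<J}. \<tau> ((+) z ` e) \<omega> powr r)"
      by (simp add: sum.reindex[OF \<open>inj_on e {..<J}\<close>])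
    also have "\<dots> \<le> (\<Sum>e\<in>B. \<tau> ((+) z ` e) \<omega> powr r)"
      using e(1) unfolding S_def B_def by (intro sum_mono2 finite_box_edges) auto
    finally show ?thesis unfolding B_def K_def .
  qed
qed

text \<open>Three exponents are compared in units of n^r: l for two traps, u1 for a single trap at
  the endpoint, and u2 for an atypical bulk or flow. The conditional probability vanishes because l
  is smaller than both u1 and u2.\<close>

lemma subcritical_large_weights:
  fixes x :: "real ^ 'd"
  assumes sx: "\<And>i. 0 \<le> real_of_int (\<sigma> i) * x $ i" and x0: "x \<noteq> 0" and rd: "r < real CARD('d)"
  shows "\<exists>R>0. \<forall>\<xi>>0. \<exists>\<epsilon>>0. (\<lambda>n::nat. \<P>(\<omega> in M. (\<forall>e\<in>box_edges R. \<tau> e \<omega> \<le> \<epsilon> * real n) \<bar>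
      T 0 (floor_vec (real n *\<^sub>R x)) \<omega> \<ge> (time_constant M \<tau> x + \<xi>) * real n)) \<longlonglongrightarrow> 0"
proof -
  define \<mu> where "\<mu> = time_constant M \<tau> x"
  define z where "z n = floor_vec (real n *\<^sub>R x)" for n
  define Cu where "Cu = real (card (box_edges 1 :: 'd edge set))"
  obtain q where q: "q > 0" "q < 1 / 4" "2 * (1 / 2 + q) powr r < (1 - 2 * q) powr r"
    using splitting_gain[OF r1] by blast
  define \<rho> where "\<rho> = 2 * (1 / 2 + q) powr r / (1 - 2 * q) powr r"
  have g0: "(1 - 2 * q) powr r > 0" using q by simp
  have \<rho>: "0 < \<rho>" "\<rho> < 1" unfolding \<rho>_def using q g0 by (auto simp: divide_less_eq_1)
  \<comment> \<open>Chosen so that an atypical excess q \<xi> costs more than two traps do. It uses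
    the bound Cu valid for every box, and Cu + 1 leaves room for \<eta> \<le> 1.\<close>
  define B where "B = (2 * \<alpha> * (Cu + 1) * (1 / 2 + q) powr r + 1) / q powr r"
  have Cu0: "Cu \<ge> 0" by (simp add: Cu_def)
  have Bq: "B * q powr r = 2 * \<alpha> * (Cu + 1) * (1 / 2 + q) powr r + 1" using q by (simp add: B_def)
  have B: "B > 0" unfolding B_def using q \<alpha> Cu0
    by (intro divide_pos_pos add_nonneg_pos mult_nonneg_nonneg) auto
  obtain R where R: "R \<ge> 1" and typical: "\<And>\<delta> w. \<delta> > 0 \<Longrightarrow> \<exists>C\<ge>0. \<exists>Bad. \<forall>\<^sub>F n in sequentially.
    Bad n \<in> events \<and> prob (Bad n) \<le> C * exp (- (B * (\<delta> * real n) powr r)) \<and>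
    (\<forall>\<omega>\<in>space M - Bad n. \<forall>h\<ge>0.
      (\<forall>e\<in>box_edges (real R). \<tau> e \<omega> \<le> h \<and> \<tau> ((+) (z n + w) ` e) \<omega> \<le> h) \<longrightarrow>
      T 0 (z n + w) \<omega> \<le> (\<mu> + \<delta>) * real n + 2 * real R * h)"
    using typical_passage[OF sx x0 rd B] unfolding z_def \<mu>_def by blast
  have "\<exists>\<epsilon>>0. (\<lambda>n::nat. \<P>(\<omega> in M. (\<forall>e\<in>box_edges (real R). \<tau> e \<omega> \<le> \<epsilon> * real n) \<bar>
      T 0 (z n) \<omega> \<ge> (\<mu> + \<xi>) * real n)) \<longlonglongrightarrow> 0" if \<xi>: "\<xi> > 0" for \<xi>
  proof -
    \<comment> \<open>The inner levels at both ends then contribute at most q \<xi> n in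
      total.\<close>
    define \<epsilon> where "\<epsilon> = q * \<xi> / (2 * real R)"
    have \<epsilon>: "\<epsilon> > 0" "2 * real R * \<epsilon> = q * \<xi>" using q \<xi> R by (auto simp: \<epsilon>_def)
    \<comment> \<open>The part of \<xi> left for the endpoint trap after q is given to typical
      fluctuations and q to the inner levels.\<close>
    define s where "s = (1 - 2 * q) * \<xi>"
    have s: "s > 0" unfolding s_def using q \<xi> by (intro mult_pos_pos) auto
    \<comment> \<open>The number of shells is bounded through Cu and not through the capacity of the
      box, whose size depends on J itself.\<close>
    obtain J0 :: nat where J0: "real J0 \<ge> Cu * s powr r / \<epsilon> powr r" using real_arch_simple by blast
    define J where "J = Suc J0"
    define K where "K = (2 * R + 1) * J"
    have K1: "K \<ge> 1" by (simp add: K_def J_def)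
    define cK where "cK = capacity TYPE('d) r K"
    have cK: "cK > 0" "cK \<le> Cu" unfolding cK_def Cu_def using capacity_pos[OF K1 r] capacity_le_unit[OF K1] by auto
    have Jbig: "real J * \<epsilon> powr r \<ge> cK * s powr r"
    proof -
      have "cK * s powr r \<le> Cu * s powr r" using cK(2) by (intro mult_right_mono) auto
      also have "\<dots> \<le> real J0 * \<epsilon> powr r" using J0 \<epsilon> by (simp add: pos_divide_le_eq)
      also have "\<dots> \<le> real J * \<epsilon> powr r" by (intro mult_right_mono) (auto simp: J_def)
      finally show ?thesis .
    qed
    \<comment> \<open>A near-minimiser must not use up the gain 1 - \<rho> of splitting; a quarter
      of it is spent here.\<close>
    define \<eta> where "\<eta> = min 1 (cK * (1 - \<rho>) / 4)"
    have \<eta>: "\<eta> > 0" "\<eta> \<le> 1" "\<eta> \<le> cK * (1 - \<rho>) / 4" unfolding \<eta>_def using cK \<rho> by auto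
    obtain f :: "'d edge \<Rightarrow> real" where f: "blocking K f" "energy r K f < cK + \<eta>"
      using capacity_near[OF K1 \<eta>(1)] unfolding cK_def by blast
    \<comment> \<open>Two traps of this depth exceed \<xi> by 2 q \<xi>, which pays for the loss 2 q
      \<xi> allowed to the space between them.\<close>
    define s' where "s' = (1 / 2 + q) * \<xi>"
    have s': "s' > 0" unfolding s'_def using q \<xi> by (intro mult_pos_pos) auto
    obtain c where c: "c > 0" "\<forall>\<^sub>F n in sequentially.
      prob {\<omega>\<in>space M. T 0 (z n) \<omega> \<ge> (\<mu> - 2 * q * \<xi> + 2 * s') * real n}
      \<ge> c * exp (- 2 * \<alpha> * (energy r K f * (s' * real n) powr r))"
      using lower_deviation_two_traps[OF f(1) s' _ x0, of "2 * q * \<xi>"] q \<xi> unfolding \<mu>_def z_def by auto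
    have level: "\<mu> - 2 * q * \<xi> + 2 * s' = \<mu> + \<xi>" by (simp add: s'_def algebra_simps)
    define l where "l = 2 * \<alpha> * (cK + \<eta>) * s' powr r"
    \<comment> \<open>Midway between \<rho> \<alpha> and \<alpha>: admissible in
      \<open>sum_powr_tail\<close>, yet large enough for u1 to exceed l.\<close>
    define \<gamma> where "\<gamma> = \<alpha> * (1 + \<rho>) / 2"
    have \<gamma>: "0 \<le> \<gamma>" "\<gamma> < \<alpha>" unfolding \<gamma>_def using \<alpha> \<rho> by auto
    obtain C where C: "C \<ge> 1" "\<And>F u. finite F \<Longrightarrow> F \<subseteq> lattice_edges \<Longrightarrow>
       prob {\<omega>\<in>space M. (\<Sum>e\<in>F. \<tau> e \<omega> powr r) \<ge> u} \<le> C ^ card F * exp (- \<gamma> * u)"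
      using sum_powr_tail[OF \<gamma>] by blast
    define u1 where "u1 = \<gamma> * (cK * s powr r)"
    define u2 where "u2 = B * (q * \<xi>) powr r"
    have u1l: "u1 > l"
    proof -
      have s'r: "s' powr r = (1 / 2 + q) powr r * \<xi> powr r" unfolding s'_def using q \<xi> by (simp add: powr_mult)
      have sr: "s powr r = (1 - 2 * q) powr r * \<xi> powr r" unfolding s_def using q \<xi> by (simp add: powr_mult)
      have "2 * (1 / 2 + q) powr r = \<rho> * (1 - 2 * q) powr r" unfolding \<rho>_def using g0 by simp
      moreover have "l = \<alpha> * (cK + \<eta>) * (2 * (1 / 2 + q) powr r) * \<xi> powr r"
        unfolding l_def s'r by simp
      ultimately have "l = \<alpha> * (cK + \<eta>) * \<rho> * s powr r" unfolding sr by simp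
      also have "\<dots> < \<gamma> * cK * s powr r"
      proof (rule mult_strict_right_mono)
        have "(cK + \<eta>) * \<rho> \<le> cK * \<rho> + \<eta> * 1" using \<rho> \<eta> by (simp add: algebra_simps mult_left_le)
        also have "\<dots> \<le> cK * \<rho> + cK * (1 - \<rho>) / 4" using \<eta> by simp
        also have "\<dots> < cK * ((1 + \<rho>) / 2)"
        proof -
          have "cK * (1 - \<rho>) > 0" using cK \<rho> by simp
          then show ?thesis by (simp add: field_simps)
        qed
        finally have "\<alpha> * ((cK + \<eta>) * \<rho>) < \<alpha> * (cK * ((1 + \<rho>) / 2))" using \<alpha> by simp
        then show "\<alpha> * (cK + \<eta>) * \<rho> < \<gamma> * cK" by (simp add: \<gamma>_def mult_ac)
      qed (use s in simp)
      finally show ?thesis by (simp add: u1_def)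
    qed
    have u2l: "u2 > l"
    proof -
      have "l \<le> 2 * \<alpha> * (Cu + 1) * s' powr r"
        unfolding l_def using cK \<eta> \<alpha> by (intro mult_right_mono mult_left_mono) auto
      also have "\<dots> = (2 * \<alpha> * (Cu + 1) * (1 / 2 + q) powr r) * \<xi> powr r"
        unfolding s'_def using q \<xi> by (simp add: powr_mult)
      also have "\<dots> < (B * q powr r) * \<xi> powr r" unfolding Bq using \<xi> by simp
      also have "\<dots> = u2" unfolding u2_def using q \<xi> by (simp add: powr_mult)
      finally show ?thesis .
    qed
    \<comment> \<open>All points where the endpoint trap could be left; the typical estimate is
      applied to each, at the cost of a fixed factor.\<close>
    define W where "W = (lattice_box (real K) :: 'd vertex set)"
    have finW: "finite W" unfolding W_def by (rule finite_lattice_box)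
    have "\<exists>Cw Bad. \<forall>w. Cw w \<ge> 0 \<and> (\<forall>\<^sub>F n in sequentially.
      Bad w n \<in> events \<and> prob (Bad w n) \<le> Cw w * exp (- (B * (q * \<xi> * real n) powr r)) \<and>
      (\<forall>\<omega>\<in>space M - Bad w n. \<forall>h\<ge>0.
        (\<forall>e\<in>box_edges (real R). \<tau> e \<omega> \<le> h \<and> \<tau> ((+) (z n + w) ` e) \<omega> \<le> h) \<longrightarrow>
        T 0 (z n + w) \<omega> \<le> (\<mu> + q * \<xi>) * real n + 2 * real R * h))"
      using typical[of "q * \<xi>"] q \<xi> by (subst choice_iff[symmetric] | simp)+
    then obtain Cw Bad where Cw: "\<And>w. Cw w \<ge> 0" and Bad: "\<And>w. \<forall>\<^sub>F n in sequentially.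
      Bad w n \<in> events \<and> prob (Bad w n) \<le> Cw w * exp (- (B * (q * \<xi> * real n) powr r)) \<and>
      (\<forall>\<omega>\<in>space M - Bad w n. \<forall>h\<ge>0.
        (\<forall>e\<in>box_edges (real R). \<tau> e \<omega> \<le> h \<and> \<tau> ((+) (z n + w) ` e) \<omega> \<le> h) \<longrightarrow>
        T 0 (z n + w) \<omega> \<le> (\<mu> + q * \<xi>) * real n + 2 * real R * h)"
      by blast
    define C1 where "C1 = C ^ card (box_edges (real K) :: 'd edge set)"
    define C2 where "C2 = (\<Sum>w\<in>W. Cw w)"
    define rate where "rate n = (C1 * exp (- (u1 - l) * real n powr r) + C2 * exp (- (u2 - l) * real n powr r)) / c" for n :: nat
    define P where "P n = \<P>(\<omega> in M. (\<forall>e\<in>box_edges (real R). \<tau> e \<omega> \<le> \<epsilon> * real n) \<bar> T 0 (z n) \<omega> \<ge> (\<mu> + \<xi>) * real n)" for n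
    have rate0: "rate \<longlonglongrightarrow> 0"
    proof -
      have dec: "(\<lambda>n::nat. exp (- v * real n powr r)) \<longlonglongrightarrow> 0" if "v > 0" for v
        using that r by real_asymp
      have "rate \<longlonglongrightarrow> (C1 * 0 + C2 * 0) / c"
        unfolding rate_def[abs_def] using u1l u2l c by (intro tendsto_intros dec) auto
      then show ?thesis by simp
    qed
    have evBad: "\<forall>\<^sub>F n in sequentially. \<forall>w\<in>W.
      Bad w n \<in> events \<and> prob (Bad w n) \<le> Cw w * exp (- (B * (q * \<xi> * real n) powr r)) \<and>
      (\<forall>\<omega>\<in>space M - Bad w n. \<forall>h\<ge>0.
        (\<forall>e\<in>box_edges (real R). \<tau> e \<omega> \<le> h \<and> \<tau> ((+) (z n + w) ` e) \<omega> \<le> h) \<longrightarrow>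
        T 0 (z n + w) \<omega> \<le> (\<mu> + q * \<xi>) * real n + 2 * real R * h)"
      using finW Bad by (intro eventually_ball_finite) blast+
    have "\<forall>\<^sub>F n in sequentially. P n \<le> rate n"
      using c(2) evBad eventually_gt_at_top[of "0::nat"]
    proof eventually_elim
      case (elim n)
      have n: "real n > 0" using elim(3) by simp
      define D where "D = {\<omega>\<in>space M. T 0 (z n) \<omega> \<ge> (\<mu> + \<xi>) * real n}"
      define A where "A = {\<omega>\<in>space M. (\<forall>e\<in>box_edges (real R). \<tau> e \<omega> \<le> \<epsilon> * real n) \<and> T 0 (z n) \<omega> \<ge> (\<mu> + \<xi>) * real n}"
      define F where "F = (`) ((+) (z n)) ` (box_edges (real K) :: 'd edge set)"
      define S where "S = {\<omega>\<in>space M. (\<Sum>e\<in>F. \<tau> e \<omega> powr r) \<ge> cK * (s * real n) powr r}"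
      have inj: "inj_on ((`) ((+) (z n))) (box_edges (real K))" by (rule inj_on_subset[OF inj_image_add]) simp
      have F: "finite F" "F \<subseteq> lattice_edges" "card F = card (box_edges (real K) :: 'd edge set)"
        unfolding F_def using finite_box_edges
        by (auto simp: card_image[OF inj] intro!: shift_lattice_edges intro: subsetD[OF box_edges_lattice])
      have [measurable]: "e \<in> F \<Longrightarrow> \<tau> e \<in> borel_measurable M" for e using F(2) by auto
      have S_ev: "S \<in> events" unfolding S_def by measurable
      have Bad_ev: "Bad w n \<in> events" if "w \<in> W" for w using elim(2) that by blast
      \<comment> \<open>Outside the exceptional events, bounded weights near the origin leave the
        excess to a trap at the endpoint, so \<open>endpoint_energy\<close> forces a large energy
        there.\<close>
      have sub: "A \<subseteq> S \<union> (\<Union>w\<in>W. Bad w n)"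
      proof
        fix \<omega> assume w: "\<omega> \<in> A"
        show "\<omega> \<in> S \<union> (\<Union>w\<in>W. Bad w n)"
        proof (cases "\<omega> \<in> (\<Union>w\<in>W. Bad w n)")
          case False
          have ws: "\<omega> \<in> space M" using w by (simp add: A_def)
          have en: "\<epsilon> * real n > 0" "s * real n > 0" using \<epsilon> s n by auto
          have "(\<Sum>e\<in>box_edges (real ((2 * R + 1) * J)). \<tau> ((+) (z n) ` e) \<omega> powr r)
             \<ge> capacity TYPE('d) r ((2 * R + 1) * J) * (s * real n) powr r"
          proof (rule endpoint_energy[OF ws en(1) en(2), where m = "(\<mu> + q * \<xi>) * real n"])
            show "\<tau> e \<omega> \<le> \<epsilon> * real n" if "e \<in> box_edges (real R)" for e
              using w that by (simp add: A_def)
            show "T 0 (z n + y) \<omega> \<le> (\<mu> + q * \<xi>) * real n + 2 * real R * h"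
              if "linf_norm y \<le> int ((2 * R + 1) * J)" "h \<ge> 0"
                "\<forall>e\<in>box_edges (real R). \<tau> e \<omega> \<le> h \<and> \<tau> ((+) (z n + y) ` e) \<omega> \<le> h" for y h
            proof -
              have "y \<in> W" using that(1) unfolding W_def lattice_box_def K_def[symmetric] by simp
              moreover have "\<omega> \<in> space M - Bad y n" using False ws \<open>y \<in> W\<close> by blast
              ultimately show ?thesis using elim(2) that(2,3) by blast
            qed
            have "(\<mu> + q * \<xi>) * real n + 2 * real R * (\<epsilon> * real n) + s * real n
               = (\<mu> + q * \<xi> + 2 * real R * \<epsilon> + s) * real n" by (simp add: algebra_simps)
            also have "\<dots> = (\<mu> + \<xi>) * real n" unfolding \<epsilon>(2) s_def by (simp add: algebra_simps)
            also have "\<dots> \<le> T 0 (z n) \<omega>" using w by (simp add: A_def)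
            finally show "(\<mu> + q * \<xi>) * real n + 2 * real R * (\<epsilon> * real n) + s * real n \<le> T 0 (z n) \<omega>" .
            have "cK * s powr r * real n powr r \<le> real J * \<epsilon> powr r * real n powr r"
              using Jbig by (intro mult_right_mono) auto
            then show "capacity TYPE('d) r ((2 * R + 1) * J) * (s * real n) powr r \<le> real J * (\<epsilon> * real n) powr r"
              unfolding K_def[symmetric] cK_def[symmetric] using s \<epsilon> n by (simp add: powr_mult mult.assoc)
          qed
          then have "\<omega> \<in> S"
            unfolding S_def F_def K_def[symmetric] cK_def[symmetric] using ws by (simp add: sum.reindex[OF inj])
          then show ?thesis by blast
        qed blast
      qed
      have "prob A \<le> prob (S \<union> (\<Union>w\<in>W. Bad w n))"
        using sub S_ev Bad_ev finW by (intro finite_measure_mono sets.Un sets.finite_UN) auto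
      also have "\<dots> \<le> prob S + prob (\<Union>w\<in>W. Bad w n)"
        using S_ev Bad_ev finW by (intro measure_Un_le sets.finite_UN) auto
      also have "prob (\<Union>w\<in>W. Bad w n) \<le> (\<Sum>w\<in>W. prob (Bad w n))"
        using Bad_ev finW by (intro finite_measure_subadditive_finite) auto
      also have "\<dots> \<le> (\<Sum>w\<in>W. Cw w * exp (- (B * (q * \<xi> * real n) powr r)))"
        using elim(2) by (intro sum_mono) blast
      also have "\<dots> = C2 * exp (- u2 * real n powr r)"
        unfolding C2_def u2_def sum_distrib_right using q \<xi> n by (simp add: powr_mult mult.assoc)
      also have "prob S \<le> C1 * exp (- u1 * real n powr r)"
      proof -
        have "prob S \<le> C ^ card F * exp (- \<gamma> * (cK * (s * real n) powr r))" unfolding S_def by (rule C(2)[OF F(1,2)])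
        also have "\<dots> = C1 * exp (- u1 * real n powr r)"
          unfolding C1_def F(3) u1_def using s n by (simp add: powr_mult mult.assoc)
        finally show ?thesis .
      qed
      finally have PA: "prob A \<le> C1 * exp (- u1 * real n powr r) + C2 * exp (- u2 * real n powr r)" by simp
      have PD: "prob D \<ge> c * exp (- l * real n powr r)"
      proof -
        have "2 * \<alpha> * (energy r K f * (s' * real n) powr r) \<le> 2 * \<alpha> * ((cK + \<eta>) * (s' * real n) powr r)"
          using f(2) \<alpha> by (intro mult_left_mono mult_right_mono) auto
        also have "\<dots> = l * real n powr r" unfolding l_def using s' n by (simp add: powr_mult mult.assoc)
        finally have "c * exp (- l * real n powr r) \<le> c * exp (- 2 * \<alpha> * (energy r K f * (s' * real n) powr r))"
          using c(1) by simp
        also have "\<dots> \<le> prob D" using elim(1) unfolding level D_def .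
        finally show ?thesis .
      qed
      have "P n = prob A / prob D" unfolding P_def cond_prob_def A_def D_def ..
      also have "\<dots> \<le> (C1 * exp (- u1 * real n powr r) + C2 * exp (- u2 * real n powr r)) / (c * exp (- l * real n powr r))"
        using PA PD c(1) C(1) Cw
        by (intro frac_le) (auto simp: C1_def C2_def intro!: add_nonneg_nonneg mult_nonneg_nonneg sum_nonneg)
      also have "\<dots> = rate n"
      proof -
        have shift: "exp (- (u - l) * y) = exp (- u * y) / exp (- l * y)" for u y
          by (simp add: exp_diff[symmetric] algebra_simps)
        show ?thesis unfolding rate_def shift by (simp add: add_divide_distrib mult.commute)
      qed
      finally show ?case .
    qed
    moreover have "\<forall>\<^sub>F n in sequentially. 0 \<le> P n"
      by (rule always_eventually) (simp add: P_def cond_prob_def)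
    ultimately have "P \<longlonglongrightarrow> 0" by (intro tendsto_sandwich[OF _ _ tendsto_const rate0])
    then show ?thesis using \<epsilon>(1) unfolding P_def[abs_def] by blast
  qed
  then show ?thesis using R unfolding \<mu>_def z_def by (intro exI[of _ "real R"]) auto
qed

end

theorem theorem1p12:
  fixes M :: "'a measure"
    and \<tau> :: "'d::finite edge \<Rightarrow> 'a \<Rightarrow> real"
    and x :: "real ^ 'd"
    and \<beta>\<^sub>1 \<beta>\<^sub>2 \<alpha> r :: real
  assumes "prob_space M"
    and dim: "CARD('d) \<ge> 2"
    and indep: "prob_space.indep_vars M (\<lambda>_. borel) \<tau> lattice_edges"
    and ident: "\<And>e e'. e \<in> lattice_edges \<Longrightarrow> e' \<in> lattice_edges \<Longrightarrow>
          distr M borel (\<tau> e) = distr M borel (\<tau> e')"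
    and nonneg: "\<And>e \<omega>. e \<in> lattice_edges \<Longrightarrow> \<omega> \<in> space M \<Longrightarrow> \<tau> e \<omega> \<ge> 0"
    and pos: "\<beta>\<^sub>1 > 0" "\<beta>\<^sub>2 > 0" "\<alpha> > 0" "r > 0"
    and tail: "\<And>e t. e \<in> lattice_edges \<Longrightarrow> t \<ge> 0 \<Longrightarrow>
          \<beta>\<^sub>1 * exp (- \<alpha> * t powr r) \<le> \<P>(\<omega> in M. \<tau> e \<omega> > t) \<and>
          \<P>(\<omega> in M. \<tau> e \<omega> > t) \<le> \<beta>\<^sub>2 * exp (- \<alpha> * t powr r)"
    and x: "x \<noteq> 0"
  shows "(1 < r \<and> r < real CARD('d) \<longrightarrow>
           (\<exists>R>0. \<forall>\<xi>>0. \<exists>\<epsilon>\<^sub>0>0.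
             (\<lambda>n::nat. \<P>(\<omega> in M.
                 (\<forall>e\<in>box_edges R. \<tau> e \<omega> \<le> \<epsilon>\<^sub>0 * real n) \<bar>
                 first_passage_time (\<lambda>e. \<tau> e \<omega>) 0 (real n *\<^sub>R x)
                   \<ge> (time_constant M \<tau> x + \<xi>) * real n))
             \<longlonglongrightarrow> 0))
       \<and> (r \<ge> real CARD('d) \<longrightarrow>
           (\<forall>a>0. \<forall>\<xi>>0. \<forall>\<epsilon>\<^sub>0>0.
             (\<lambda>n::nat. \<P>(\<omega> in M.
                 (\<forall>e\<in>box_edges (real n powr a). \<tau> e \<omega> \<le> \<epsilon>\<^sub>0 * real n) \<bar>
                 first_passage_time (\<lambda>e. \<tau> e \<omega>) 0 (real n *\<^sub>R x)
                   \<ge> (time_constant M \<tau> x + \<xi>) * real n))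
             \<longlonglongrightarrow> 1))"
proof -
  interpret percolation M \<tau> \<beta>\<^sub>1 \<beta>\<^sub>2 \<alpha> r
    by (intro percolation.intro percolation_axioms.intro assms)
  show ?thesis
    unfolding first_passage_T
  proof (intro conjI impI)
    assume r: "1 < r \<and> r < real CARD('d)"
    \<comment> \<open>Coordinates where x vanishes get the sign 1; either sign keeps the product
      with x nonnegative.\<close>
    define \<sigma> where "\<sigma> i = (if x $ i < 0 then - 1 else 1 :: int)" for i
    interpret signed_percolation M \<tau> \<beta>\<^sub>1 \<beta>\<^sub>2 \<alpha> r \<sigma>
      using r by unfold_locales (auto simp: \<sigma>_def)
    show "\<exists>R>0. \<forall>\<xi>>0. \<exists>\<epsilon>\<^sub>0>0. (\<lambda>n::nat. \<P>(\<omega> in M. (\<forall>e\<in>box_edges R. \<tau> e \<omega> \<le> \<epsilon>\<^sub>0 * real n) \<bar>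
        T 0 (floor_vec (real n *\<^sub>R x)) \<omega> \<ge> (time_constant M \<tau> x + \<xi>) * real n)) \<longlonglongrightarrow> 0"
      using r by (intro subcritical_large_weights x) (auto simp: \<sigma>_def)
  qed (use supercritical_no_large_weights[OF dim _ x] in blast)
qed

end
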